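(* Let $M$ be a continuous local $P$-martingale on $[0,T]$ with $M_0=0$ and $\langle M\rangle_T<\infty$ $P$-a.s., and suppose that its stochastic exponential $\mathcal{E}(M)$ is a uniformly integrable martingale. Let $d\tilde P=\mathcal{E}_T(M)\,dP$ and $\tilde M=\langle M\rangle-M$. Then the following conditions are equivalent: (i) $\tilde M\in BMO(\tilde P)$; (ii) $\mathcal{E}(M)$ satisfies the $(R_p)$ condition for some $p>1$; (iii) $M\in BMO(P)$; (iv) $\mathcal{E}(M)$ satisfies the $(A_p)$ condition for some $p>1$.
   Context: Let $(\Omega,\mathcal{F},P)$ be a probability space, $0<T<\infty$ a finite time horizon, and $(\mathcal{F}_t)_{0\le t\le T}$ a filtration satisfying the usual conditions of right-continuity and completeness. Stopping times take values in $[0,T]$. $\langle M\rangle$ is the square characteristic (quadratic variation) of $M$. Stochastic exponential: $\mathcal{E}_t(M)=\exp\{M_t-\tfrac12\langle M\rangle_t\}$, and $\mathcal{E}_{\tau,T}(M)=\mathcal{E}_T(M)/\mathcal{E}_\tau(M)$. $BMO$: for a probability measure $Q$ ($Q=P$ or $Q=\tilde P$), a continuous uniformly integrable $Q$-martingale $N$ with $N_0=0$ belongs to $BMO(Q)$ if $$\|N\|_{BMO(Q)}=\sup_\tau\Big\|E^{Q}\big[\langle N\rangle_T-\langle N\rangle_\tau\,\big|\,\mathcal{F}_\tau\big]^{1/2}\Big\|_\infty<\infty,$$ the supremum being over all stopping times $\tau\in[0,T]$. Condition $(R_p)$ (reverse Hölder), $1<p<\infty$: there is a constant $C_p>0$ such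 that $E\big[\{\mathcal{E}_{\tau,T}(M)\}^{p}\,\big|\,\mathcal{F}_\tau\big]\le C_p$ for every stopping time $\tau$ (expectation under $P$). Condition $(A_p)$ (Muckenhoupt), $1<p<\infty$: there is a constant $D_p>0$ such that $E\big[\{\mathcal{E}_{\tau,T}(M)\}^{-\frac{1}{p-1}}\,\big|\,\mathcal{F}_\tau\big]\le D_p$ for every stopping time $\tau$ (expectation under $P$). *)

theory Defs
  imports "HOL-Probability.Probability"
begin

text \<open>
  Only the restriction of the filtration \<open>F\<close> to \<open>{0..T}\<close> is ever used. Indexing by all
  reals is a matter of convenience: a filtration on \<open>{0..T}\<close> extends by \<open>F 0\<close> to
  the left and by \<open>F T\<close> to the right, and neither the stopping times with values in
  \<open>{0..T}\<close> nor their sigma-algebras depend on the extension.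
\<close>

locale usual_conditions =
  prob_space P + complete_measure P + filtration "space P" F
  for P :: "'a measure" and F :: "real \<Rightarrow> 'a measure" +
  fixes T :: real
  assumes T_pos: "0 < T"
    and sets_F_subset: "sets (F T) \<subseteq> sets P"
    and null_sets_subset: "null_sets P \<subseteq> sets (F 0)"
    and right_continuous: "\<And>t. 0 \<le> t \<Longrightarrow> t < T \<Longrightarrow> sets (F t) = (\<Inter>s\<in>{t<..T}. sets (F s))"

definition stopping_times :: "'a measure \<Rightarrow> (real \<Rightarrow> 'a measure) \<Rightarrow> real \<Rightarrow> ('a \<Rightarrow> real) set" where
  "stopping_times Q F T = {\<tau>. stopping_time F \<tau> \<and> (\<forall>x\<in>space Q. \<tau> x \<in> {0..T})}"

definition adapted :: "(real \<Rightarrow> 'a measure) \<Rightarrow> real \<Rightarrow> (real \<Rightarrow> 'a \<Rightarrow> real) \<Rightarrow> bool" where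
  "adapted F T X \<longleftrightarrow> (\<forall>t\<in>{0..T}. X t \<in> borel_measurable (F t))"

definition continuous_paths :: "'a measure \<Rightarrow> real \<Rightarrow> (real \<Rightarrow> 'a \<Rightarrow> real) \<Rightarrow> bool" where
  "continuous_paths Q T X \<longleftrightarrow> (AE x in Q. continuous_on {0..T} (\<lambda>t. X t x))"

definition martingale ::
  "'a measure \<Rightarrow> (real \<Rightarrow> 'a measure) \<Rightarrow> real \<Rightarrow> (real \<Rightarrow> 'a \<Rightarrow> real) \<Rightarrow> bool" where
  "martingale Q F T X \<longleftrightarrow>
     adapted F T X \<and>
     (\<forall>t\<in>{0..T}. integrable Q (X t)) \<and>
     (\<forall>s t. 0 \<le> s \<longrightarrow> s \<le> t \<longrightarrow> t \<le> T \<longrightarrow> (AE x in Q. real_cond_exp Q (F s) (X t) x = X s x))"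

definition uniformly_integrable ::
  "'a measure \<Rightarrow> real \<Rightarrow> (real \<Rightarrow> 'a \<Rightarrow> real) \<Rightarrow> bool" where
  "uniformly_integrable Q T X \<longleftrightarrow>
     ((\<lambda>c::real. SUP t\<in>{0..T}. \<integral>\<^sup>+x. ennreal \<bar>X t x\<bar> * indicator {y. c < \<bar>X t y\<bar>} x \<partial>Q)
        \<longlongrightarrow> 0) at_top"

text \<open>
  On a compact time interval the localizing sequence has to reach \<open>T\<close> after finitely many steps,
  almost surely.
\<close>

definition local_martingale ::
  "'a measure \<Rightarrow> (real \<Rightarrow> 'a measure) \<Rightarrow> real \<Rightarrow> (real \<Rightarrow> 'a \<Rightarrow> real) \<Rightarrow> bool" where
  "local_martingale Q F T X \<longleftrightarrow>
     adapted F T X \<and>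
     (\<exists>\<sigma>::nat \<Rightarrow> 'a \<Rightarrow> real.
        (\<forall>n. \<sigma> n \<in> stopping_times Q F T) \<and>
        (AE x in Q. incseq (\<lambda>n. \<sigma> n x)) \<and>
        (AE x in Q. \<forall>\<^sub>F n in sequentially. \<sigma> n x = T) \<and>
        (\<forall>n. martingale Q F T (\<lambda>t x. X (min t (\<sigma> n x)) x - X 0 x)))"

text \<open>
  \<open>square_char Q F T X A\<close> states that \<open>A\<close> is (a version of) the square characteristic of the
  continuous local \<open>Q\<close>-martingale \<open>X\<close>. Such an \<open>A\<close> is unique up to indistinguishability.
\<close>

definition square_char ::
  "'a measure \<Rightarrow> (real \<Rightarrow> 'a measure) \<Rightarrow> real \<Rightarrow> (real \<Rightarrow> 'a \<Rightarrow> real) \<Rightarrow> (real \<Rightarrow> 'a \<Rightarrow> real) \<Rightarrow> bool"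
where
  "square_char Q F T X A \<longleftrightarrow>
     adapted F T A \<and>
     continuous_paths Q T A \<and>
     (AE x in Q. A 0 x = 0) \<and>
     (AE x in Q. mono_on {0..T} (\<lambda>t. A t x)) \<and>
     local_martingale Q F T (\<lambda>t x. (X t x)\<^sup>2 - A t x)"

definition ennreal_sqrt :: "ennreal \<Rightarrow> ennreal" where
  "ennreal_sqrt c = (if c = \<infinity> then \<infinity> else ennreal (sqrt (enn2real c)))"

text \<open>
  The BMO norm of a process is expressed through its square characteristic \<open>A\<close>. Conditional
  expectations of nonnegative variables are taken in \<^typ>\<open>ennreal\<close>, because
  \<^const>\<open>real_cond_exp\<close> is meaningless where the conditional expectation is infinite.
\<close>

definition bmo_norm ::
  "'a measure \<Rightarrow> (real \<Rightarrow> 'a measure) \<Rightarrow> real \<Rightarrow> (real \<Rightarrow> 'a \<Rightarrow> real) \<Rightarrow> ennreal" where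
  "bmo_norm Q F T A =
     (SUP \<tau>\<in>stopping_times Q F T.
        esssup Q (\<lambda>x. ennreal_sqrt
          (nn_cond_exp Q (filtration.pre_sigma (space Q) F \<tau>)
             (\<lambda>y. ennreal (A T y - A (\<tau> y) y)) x)))"

definition BMO ::
  "'a measure \<Rightarrow> (real \<Rightarrow> 'a measure) \<Rightarrow> real \<Rightarrow> (real \<Rightarrow> 'a \<Rightarrow> real) set" where
  "BMO Q F T =
     {N. martingale Q F T N \<and> uniformly_integrable Q T N \<and> continuous_paths Q T N \<and>
         (AE x in Q. N 0 x = 0) \<and>
         (\<exists>A. square_char Q F T N A \<and> bmo_norm Q F T A < \<infinity>)}"

text \<open>In the following, \<open>A\<close> stands for the square characteristic of \<open>M\<close>.\<close>

definition stoch_exp :: "(real \<Rightarrow> 'a \<Rightarrow> real) \<Rightarrow> (real \<Rightarrow> 'a \<Rightarrow> real) \<Rightarrow> real \<Rightarrow> 'a \<Rightarrow> real" where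
  "stoch_exp M A t x = exp (M t x - A t x / 2)"

definition stoch_exp_from ::
  "real \<Rightarrow> (real \<Rightarrow> 'a \<Rightarrow> real) \<Rightarrow> (real \<Rightarrow> 'a \<Rightarrow> real) \<Rightarrow> ('a \<Rightarrow> real) \<Rightarrow> 'a \<Rightarrow> real" where
  "stoch_exp_from T M A \<tau> x = stoch_exp M A T x / stoch_exp M A (\<tau> x) x"

definition reverse_Hoelder ::
  "'a measure \<Rightarrow> (real \<Rightarrow> 'a measure) \<Rightarrow> real \<Rightarrow> (real \<Rightarrow> 'a \<Rightarrow> real) \<Rightarrow> (real \<Rightarrow> 'a \<Rightarrow> real) \<Rightarrow> real \<Rightarrow> bool"
where
  "reverse_Hoelder P F T M A p \<longleftrightarrow>
     (\<exists>C>0. \<forall>\<tau>\<in>stopping_times P F T.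
        AE x in P. nn_cond_exp P (filtration.pre_sigma (space P) F \<tau>)
          (\<lambda>y. ennreal (stoch_exp_from T M A \<tau> y powr p)) x \<le> ennreal C)"

definition Muckenhoupt ::
  "'a measure \<Rightarrow> (real \<Rightarrow> 'a measure) \<Rightarrow> real \<Rightarrow> (real \<Rightarrow> 'a \<Rightarrow> real) \<Rightarrow> (real \<Rightarrow> 'a \<Rightarrow> real) \<Rightarrow> real \<Rightarrow> bool"
where
  "Muckenhoupt P F T M A p \<longleftrightarrow>
     (\<exists>D>0. \<forall>\<tau>\<in>stopping_times P F T.
        AE x in P. nn_cond_exp P (filtration.pre_sigma (space P) F \<tau>)
          (\<lambda>y. ennreal (stoch_exp_from T M A \<tau> y powr (- 1 / (p - 1)))) x \<le> ennreal D)"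

end

theory Submission
  imports Defs
begin

text \<open>
  Write \<open>L = ln \<E>(M) = M - \<langle>M\<rangle>/2\<close>. All conditions are tested against stopping times only. If \<open>M\<close> is in
  \<open>BMO\<close>, then \<open>E[\<bar>L\<^sub>\<sigma> - L\<^sub>\<tau>\<bar>; \<tau> < T]\<close> is bounded by a multiple of \<open>P(\<tau> < T)\<close>, so after \<open>\<tau>\<close> the process \<open>L\<close>
  leaves an interval of fixed length with conditional probability bounded away from one; restarting at the
  exit time bounds a truncated exponential moment \<open>V\<close> by \<open>c + \<kappa> V\<close> with \<open>\<kappa> < 1\<close>. Run
  downwards under \<open>P\<close> this gives \<open>(A\<^sub>p)\<close>, run upwards under the measure with density \<open>\<E>(M)\<close> it gives
  \<open>(R\<^sub>p)\<close>. Conversely \<open>(A\<^sub>p)\<close> bounds \<open>-E[L\<^sub>T - L\<^sub>\<tau>]\<close>, hence \<open>E[\<langle>M\<rangle>\<^sub>T - \<langle>M\<rangle>\<^sub>\<tau>]\<close>. Finally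
  \<open>\<E>(M')\<close> under \<open>P'\<close> is \<open>1/\<E>(M)\<close>, so passing from \<open>(P, M)\<close> to \<open>(P', M')\<close> exchanges the exponents \<open>q\<close>
  and \<open>1 - q\<close>, that is \<open>(A\<^sub>p)\<close> and \<open>(R\<^sub>p)\<close>. That \<open>M'\<close> is a local \<open>P'\<close>-martingale with square
  characteristic \<open>\<langle>M\<rangle>\<close> is the only place where an Ito type expansion is needed.
\<close>

section \<open>Stopping times and stopped processes\<close>

text \<open>The implications form one cycle. Write bmo, pos, neg for a finite BMO norm, a bounded
  conditional moment of some order \<open>q > 1\<close>, and one of some order \<open>q < 0\<close>,
  with a prime under \<open>P'\<close>. Then bmo gives pos; pos is neg' by duality, which is
  equivalent to bmo'; this gives pos', which is neg by duality and so bmo again. The way from pos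
  back to bmo therefore runs through \<open>P'\<close>, and every hypothesis on
  \<open>(P, M)\<close> has to be inherited by \<open>(P', M')\<close>. A continuous martingale
  enters only through the constancy of its expectation over stopping times. An event known at
  \<open>\<tau>\<close> is encoded by moving \<open>\<tau>\<close> to \<open>T\<close> off the
  event, so conditional bounds become bounds on plain integrals; for this the right-hand sides must
  carry the factor \<open>P(\<tau> < T)\<close>, which shrinks along with the event. The moments to
  be bounded may be infinite beforehand, hence the truncation in the restart argument. BMO
  membership speaks of some version of the square characteristic; bounds pass from one version to
  another through squared increments of \<open>M\<close>, which mention no version.\<close>

abbreviation at_time :: "(real \<Rightarrow> 'a \<Rightarrow> real) \<Rightarrow> ('a \<Rightarrow> real) \<Rightarrow> 'a \<Rightarrow> real" where
  "at_time X \<tau> \<equiv> \<lambda>x. X (\<tau> x) x"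

text \<open>Rounding up, not down, makes the discretized time depend on the past only: that it
  equals a given grid point is known at that grid point. For \<open>t = 0\<close> also
  \<open>s = 0\<close>, and division by zero makes every expression vanish.\<close>

lemma grid_point_bounds:
  fixes s t :: real and n :: nat
  assumes "0 \<le> s" "s \<le> t" "0 < n"
  shows "nat \<lceil>real n * s / t\<rceil> \<le> n" "0 \<le> t * real (nat \<lceil>real n * s / t\<rceil>) / n"
    "t * real (nat \<lceil>real n * s / t\<rceil>) / n \<le> t" "s \<le> t * real (nat \<lceil>real n * s / t\<rceil>) / n"
    "t * real (nat \<lceil>real n * s / t\<rceil>) / n \<le> s + t / n"
proof -
  let ?k = "nat \<lceil>real n * s / t\<rceil>"
  have "s / t \<le> 1" using assms by (auto simp: divide_le_eq_1)
  from mult_left_mono[OF this, of "real n"] have r: "real n * s / t \<le> n" "0 \<le> real n * s / t"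
    using assms by auto
  then have "\<lceil>real n * s / t\<rceil> \<le> int n" by (simp add: ceiling_le_iff)
  then show k: "?k \<le> n" by linarith
  have t: "0 \<le> t" using assms by simp
  show "0 \<le> t * real ?k / n" by (rule divide_nonneg_nonneg[OF mult_nonneg_nonneg[OF t of_nat_0_le_iff] of_nat_0_le_iff])
  have "real ?k \<le> real n" using k by (rule of_nat_mono)
  from mult_left_mono[OF this t] show "t * real ?k / n \<le> t" using assms(3) by (simp add: divide_le_eq del: of_nat_nat)
  have k1: "real n * s / t \<le> ?k" "?k \<le> real n * s / t + 1"
    using r by linarith+
  show "s \<le> t * real ?k / n"
  proof (cases "t = 0")
    case False
    have "t * (real n * s / t) \<le> t * real ?k" by (rule mult_left_mono[OF k1(1) t])
    then show ?thesis using assms(3) False by (simp add: le_divide_eq mult.commute del: of_nat_nat)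
  qed (use assms in auto)
  show "t * real ?k / n \<le> s + t / n"
  proof (cases "t = 0")
    case False
    have "t * real ?k \<le> t * (real n * s / t + 1)" by (rule mult_left_mono[OF k1(2) t])
    also have "\<dots> = (s + t / n) * n" using assms(3) False by (simp add: field_simps)
    finally show ?thesis using assms(3) by (simp add: divide_le_eq del: of_nat_nat)
  qed (use assms in auto)
qed

lemma grid_point_tendsto:
  fixes s t :: real
  assumes "0 \<le> s" "s \<le> t"
  shows "(\<lambda>n. t * real (nat \<lceil>real (Suc n) * s / t\<rceil>) / real (Suc n)) \<longlonglongrightarrow> s"
proof (rule tendsto_sandwich)
  show "\<forall>\<^sub>F n in sequentially. s \<le> t * real (nat \<lceil>real (Suc n) * s / t\<rceil>) / real (Suc n)"
    by (intro always_eventually allI grid_point_bounds(4)[OF assms]) auto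
  show "\<forall>\<^sub>F n in sequentially. t * real (nat \<lceil>real (Suc n) * s / t\<rceil>) / real (Suc n) \<le> s + t / real (Suc n)"
    by (intro always_eventually allI grid_point_bounds(5)[OF assms]) auto
  have "(\<lambda>n. t * (1 / real (Suc n))) \<longlonglongrightarrow> t * 0"
    by (intro tendsto_intros LIMSEQ_Suc[OF lim_1_over_n])
  then show "(\<lambda>n. s + t / real (Suc n)) \<longlonglongrightarrow> s"
    using tendsto_add[of "\<lambda>_. s" s] by fastforce
qed auto

lemma continuous_on_grid_tendsto:
  fixes f :: "real \<Rightarrow> real"
  assumes "continuous_on {0..u} f" "0 \<le> s" "s \<le> t" "t \<le> u"
  shows "(\<lambda>n. f (t * real (nat \<lceil>real (Suc n) * s / t\<rceil>) / real (Suc n))) \<longlonglongrightarrow> f s"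
proof (rule continuous_on_tendsto_compose[OF assms(1) grid_point_tendsto[OF assms(2,3)]])
  show "s \<in> {0..u}" using assms by auto
  show "\<forall>\<^sub>F n in sequentially. t * real (nat \<lceil>real (Suc n) * s / t\<rceil>) / real (Suc n) \<in> {0..u}"
    using grid_point_bounds(2,3)[OF assms(2,3) zero_less_Suc] assms(4)
    by (intro always_eventually) (auto intro: order_trans)
qed

context usual_conditions
begin

abbreviation ST :: "('a \<Rightarrow> real) set" where "ST \<equiv> stopping_times P F T"

abbreviation before :: "('a \<Rightarrow> real) \<Rightarrow> 'a set" where "before \<tau> \<equiv> {x \<in> space P. \<tau> x < T}"

lemma STD: assumes "\<tau> \<in> ST" shows "stopping_time F \<tau>" and "\<And>x. x \<in> space P \<Longrightarrow> 0 \<le> \<tau> x"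
  and "\<And>x. x \<in> space P \<Longrightarrow> \<tau> x \<le> T"
  using assms by (auto simp: stopping_times_def)

lemma STI: "stopping_time F \<tau> \<Longrightarrow> (\<And>x. x \<in> space P \<Longrightarrow> 0 \<le> \<tau> x \<and> \<tau> x \<le> T) \<Longrightarrow> \<tau> \<in> ST"
  by (auto simp: stopping_times_def)

lemma ST_leI:
  assumes "\<And>t. 0 \<le> t \<Longrightarrow> t < T \<Longrightarrow> {x \<in> space P. \<tau> x \<le> t} \<in> sets (F t)"
    and "\<And>x. x \<in> space P \<Longrightarrow> 0 \<le> \<tau> x \<and> \<tau> x \<le> T"
  shows "\<tau> \<in> ST"
proof (rule STI[OF _ assms(2)], rule stopping_timeI)
  fix t
  have "{x \<in> space P. \<tau> x \<le> t} \<in> sets (F t)"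
  proof (cases "t < 0 \<or> t \<ge> T")
    case True
    then have "{x \<in> space P. \<tau> x \<le> t} = (if t < 0 then {} else space (F t))"
      using assms(2) T_pos by (force simp: space_F)
    then show ?thesis by auto
  qed (use assms(1) in auto)
  then show "Measurable.pred (F t) (\<lambda>x. \<tau> x \<le> t)"
    by (simp add: pred_def space_F)
qed auto

lemma ST_le_sets: "\<tau> \<in> ST \<Longrightarrow> s \<le> t \<Longrightarrow> {x \<in> space P. \<tau> x \<le> s} \<in> sets (F t)"
  using stopping_time_le_const[OF STD(1)] by (auto simp: pred_def space_F)

lemma const_ST: "0 \<le> c \<Longrightarrow> c \<le> T \<Longrightarrow> (\<lambda>_. c) \<in> ST"
  by (intro STI stopping_time_const) auto

lemma min_ST: 
  assumes "\<tau> \<in> ST" "\<sigma> \<in> ST" shows "(\<lambda>x. min (\<tau> x) (\<sigma> x)) \<in> ST"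
  using STD[OF assms(1)] STD[OF assms(2)]
  by (intro STI stopping_time_min) (simp_all add: min_le_iff_disj)

section \<open>Sub-sigma-algebras and null sets\<close>

lemma sets_F_P: "t \<le> T \<Longrightarrow> sets (F t) \<subseteq> sets P"
  using sets_F_mono[of t T] sets_F_subset by auto

lemma subalgebra_F: "t \<le> T \<Longrightarrow> subalgebra P (F t)"
  using sets_F_P by (auto simp: subalgebra_def space_F)

lemma measurable_F_P: "t \<le> T \<Longrightarrow> f \<in> measurable (F t) N \<Longrightarrow> f \<in> measurable P N"
  by (rule measurable_from_subalg[OF subalgebra_F])

lemma measurable_F_mono: "s \<le> t \<Longrightarrow> f \<in> measurable (F s) N \<Longrightarrow> f \<in> measurable (F t) N"
  by (rule measurable_from_subalg[of "F t" "F s"]) (simp_all add: subalgebra_def space_F sets_F_mono)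

lemma ST_measurable_F: assumes "\<tau> \<in> ST" "\<And>x. x \<in> space P \<Longrightarrow> \<tau> x \<le> t"
  shows "\<tau> \<in> borel_measurable (F t)"
proof (rule borel_measurableI_le)
  fix s
  show "{x \<in> space (F t). \<tau> x \<le> s} \<in> sets (F t)"
  proof (cases "s \<le> t")
    case True
    then show ?thesis using ST_le_sets[OF assms(1)] by (simp add: space_F)
  next
    case False
    then have "{x \<in> space (F t). \<tau> x \<le> s} = space (F t)" using assms(2) by (force simp: space_F)
    then show ?thesis by auto
  qed
qed

lemma ST_measurable: "\<tau> \<in> ST \<Longrightarrow> \<tau> \<in> borel_measurable P"
  by (rule measurable_F_P[OF order_refl ST_measurable_F[OF _ STD(3)]])

text \<open>Completeness of \<open>P\<close> makes subsets of null sets measurable, and the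
  filtration contains all null sets from time 0 on. So almost sure properties, such as path
  continuity, can be treated as sure in questions of adaptedness.\<close>

lemma null_set_in_F:
  assumes "AE x in P. x \<notin> N" "N \<subseteq> space P" "0 \<le> t"
  shows "N \<in> sets (F t)"
proof -
  obtain N' where N': "{x \<in> space P. \<not> x \<notin> N} \<subseteq> N'" "N' \<in> null_sets P"
    using assms(1) by (auto simp: eventually_ae_filter)
  then have "N \<in> sets P" using complete[of N N'] assms(2) by auto
  then have "N \<in> null_sets P" using N' Complete_Measure.null_sets_subset[of N' P N] assms(2) by auto
  then show ?thesis using null_sets_subset sets_F_mono[OF assms(3)] by auto
qed

lemma AE_measurable_F:
  fixes f g :: "'a \<Rightarrow> 'b :: topological_space"
  assumes "AE x in P. f x = g x" "g \<in> borel_measurable (F t)" "0 \<le> t"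
  shows "f \<in> borel_measurable (F t)"
proof (rule measurableI)
  fix B :: "'b set" assume B: "B \<in> sets borel"
  let ?N1 = "{x \<in> space P. f x \<in> B \<and> g x \<notin> B}" and ?N2 = "{x \<in> space P. f x \<notin> B \<and> g x \<in> B}"
  have "?N1 \<in> sets (F t)" "?N2 \<in> sets (F t)"
    using assms(1) by (auto intro!: null_set_in_F[OF _ _ assms(3)] elim: eventually_mono)
  moreover have "g -` B \<inter> space (F t) \<in> sets (F t)" using assms(2) B by measurable
  moreover have "f -` B \<inter> space (F t) = (g -` B \<inter> space (F t) - ?N2) \<union> ?N1"
    by (auto simp: space_F)
  ultimately show "f -` B \<inter> space (F t) \<in> sets (F t)" by auto
qed auto

lemma AE_set_in_F:
  assumes "AE x in P. x \<in> A \<longleftrightarrow> x \<in> B" "A \<subseteq> space P" "B \<in> sets (F t)" "0 \<le> t"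
  shows "A \<in> sets (F t)"
proof -
  have B: "B \<subseteq> space P" using sets.sets_into_space[OF assms(3)] by (simp add: space_F)
  have "A - B \<in> sets (F t)" "B - A \<in> sets (F t)"
    using assms(1,2) B by (auto intro!: null_set_in_F[OF _ _ assms(4)] elim: eventually_mono)
  moreover have "A = (B - (B - A)) \<union> (A - B)" by auto
  ultimately show ?thesis using assms(3) by (metis sets.Diff sets.Un)
qed

section \<open>Sigma-algebras at stopping times\<close>

lemma sets_pre_sigma_F:
  assumes "\<tau> \<in> ST" "B \<in> sets (pre_sigma \<tau>)" shows "B \<in> sets (F T)"
proof -
  have "{x \<in> B. \<tau> x \<le> T} \<in> sets (F T)" using sets_pre_sigmaD[OF STD(1)[OF assms(1)] assms(2)] .
  moreover have "{x \<in> B. \<tau> x \<le> T} = B"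
    using sets.sets_into_space[OF assms(2)] STD(3)[OF assms(1)] by (auto simp: space_pre_sigma)
  ultimately show ?thesis by simp
qed

lemma subalgebra_pre_sigma: "\<tau> \<in> ST \<Longrightarrow> subalgebra P (pre_sigma \<tau>)"
  using sets_pre_sigma_F sets_F_subset by (auto simp: subalgebra_def space_pre_sigma)

lemma sets_pre_sigma_P: "\<tau> \<in> ST \<Longrightarrow> B \<in> sets (pre_sigma \<tau>) \<Longrightarrow> B \<in> sets P"
  using sets_pre_sigma_F sets_F_subset by blast

lemma measurable_pre_sigma_P:
  "\<tau> \<in> ST \<Longrightarrow> f \<in> measurable (pre_sigma \<tau>) N \<Longrightarrow> f \<in> measurable P N"
  using measurable_from_subalg[OF subalgebra_pre_sigma] by blast

lemma finite_subalgebra_pre_sigma: "\<tau> \<in> ST \<Longrightarrow> sigma_finite_subalgebra P (pre_sigma \<tau>)"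
  by (intro finite_measure_subalgebra_is_sigma_finite)
     (simp add: finite_measure_subalgebra_def finite_measure_subalgebra_axioms_def
        subalgebra_pre_sigma finite_measure_axioms)

lemma finite_subalgebra_F: "t \<le> T \<Longrightarrow> sigma_finite_subalgebra P (F t)"
  by (intro finite_measure_subalgebra_is_sigma_finite)
     (simp add: finite_measure_subalgebra_def finite_measure_subalgebra_axioms_def
        subalgebra_F finite_measure_axioms)

lemma sets_pre_sigma_const: "B \<in> sets (F s) \<Longrightarrow> B \<in> sets (pre_sigma (\<lambda>_. s))"
proof (intro sets_pre_sigmaI stopping_time_const)
  fix t assume "B \<in> sets (F s)"
  then show "{x \<in> B. s \<le> t} \<in> sets (F t)"
    using sets_F_mono[of s t] by (cases "s \<le> t") auto
qed

lemma sets_pre_sigma_mono: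
  assumes "\<tau> \<in> ST" "\<sigma> \<in> ST" "\<And>x. x \<in> space P \<Longrightarrow> \<tau> x \<le> \<sigma> x" "B \<in> sets (pre_sigma \<tau>)"
  shows "B \<in> sets (pre_sigma \<sigma>)"
  using mono_pre_sigma[OF STD(1)[OF assms(1)] STD(1)[OF assms(2)] assms(3)] assms(4) by auto

lemma sets_pre_sigma_less:
  "\<tau> \<in> ST \<Longrightarrow> \<sigma> \<in> ST \<Longrightarrow> {x \<in> space P. \<tau> x < \<sigma> x} \<in> sets (pre_sigma \<tau>)"
  using stopping_time_less[OF STD(1) STD(1)] by (auto simp: pred_def space_pre_sigma)

lemma sets_pre_sigma_less_T: "\<tau> \<in> ST \<Longrightarrow> before \<tau> \<in> sets (pre_sigma \<tau>)"
  using sets_pre_sigma_less[OF _ const_ST] T_pos by auto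

text \<open>The event is unchanged when \<open>\<tau>\<close> is replaced by the minimum of both
  times, and what is known at the minimum is known at \<open>\<sigma>\<close>.\<close>

lemma sets_pre_sigma_less_min:
  assumes "\<tau> \<in> ST" "\<sigma> \<in> ST" 
  shows "{x \<in> space P. \<tau> x < \<sigma> x} \<in> sets (pre_sigma \<sigma>)"
proof -
  have "{x \<in> space P. min (\<tau> x) (\<sigma> x) < \<sigma> x} \<in> sets (pre_sigma (\<lambda>x. min (\<tau> x) (\<sigma> x)))"
    using assms by (intro sets_pre_sigma_less min_ST)
  moreover have "{x \<in> space P. min (\<tau> x) (\<sigma> x) < \<sigma> x} = {x \<in> space P. \<tau> x < \<sigma> x}" by auto
  ultimately show ?thesis
    by (intro sets_pre_sigma_mono[OF min_ST[OF assms] assms(2)]) auto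
qed

text \<open>The device that removes conditioning: a bound valid for all stopping times can be
  applied to the switched time and then speaks about \<open>B\<close> alone. Because
  \<open>\<tau> \<le> \<sigma>\<close>, having stopped by \<open>t\<close> means
  \<open>\<sigma> \<le> t\<close>, or lying in \<open>B\<close> with
  \<open>\<tau> \<le> t\<close>.\<close>

lemma switch_ST:
  assumes "\<tau> \<in> ST" "\<sigma> \<in> ST" "\<And>x. x \<in> space P \<Longrightarrow> \<tau> x \<le> \<sigma> x" "B \<in> sets (pre_sigma \<tau>)"
  shows "(\<lambda>x. if x \<in> B then \<tau> x else \<sigma> x) \<in> ST"
proof (rule ST_leI)
  fix t :: real
  have "B \<subseteq> space P" using sets.sets_into_space[OF assms(4)] by (simp add: space_pre_sigma)
  then have "{x \<in> space P. (if x \<in> B then \<tau> x else \<sigma> x) \<le> t} = {x \<in> B. \<tau> x \<le> t} \<union> {x \<in> space P. \<sigma> x \<le> t}"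
    using assms(3) by force
  then show "{x \<in> space P. (if x \<in> B then \<tau> x else \<sigma> x) \<le> t} \<in> sets (F t)"
    using ST_le_sets[OF assms(2)] sets_pre_sigmaD[OF STD(1)[OF assms(1)] assms(4)] by auto
qed (use STD[OF assms(1)] STD[OF assms(2)] in auto)

section \<open>Continuous adapted processes at stopping times\<close>

definition cont_adapted :: "(real \<Rightarrow> 'a \<Rightarrow> real) \<Rightarrow> bool" where
  "cont_adapted X \<longleftrightarrow> adapted F T X \<and> continuous_paths P T X"

text \<open>On a grid the process is composed with a countably valued index. Path continuity passes
  measurability to the limit, once the null set of discontinuous paths has been sent to 0.\<close>

lemma stopped_measurable_F:
  assumes X: "cont_adapted X" and \<tau>: "\<tau> \<in> ST" "\<And>x. x \<in> space P \<Longrightarrow> \<tau> x \<le> t" and t: "0 \<le> t" "t \<le> T"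
  shows "at_time X \<tau> \<in> borel_measurable (F t)"
proof -
  define k where "k n x = nat \<lceil>real (Suc n) * \<tau> x / t\<rceil>" for n x
  \<comment> \<open>The cap at \<open>Suc n\<close> keeps the grid time at most \<open>t\<close> for
    every index, also for indices that \<open>k n\<close> never attains, so that each sampled
    variable is measurable at time \<open>t\<close>.\<close>
  define Y where "Y n x = X (t * real (min (k n x) (Suc n)) / real (Suc n)) x" for n x
  have [measurable]: "\<tau> \<in> borel_measurable (F t)" by (rule ST_measurable_F[OF \<tau>])
  have k[measurable]: "k n \<in> measurable (F t) (count_space UNIV)" for n
    unfolding k_def by measurable
  have Y[measurable]: "Y n \<in> borel_measurable (F t)" for n
  proof -
    have "(\<lambda>x. (\<lambda>i x. X (t * real (min i (Suc n)) / real (Suc n)) x) (k n x) x) \<in> borel_measurable (F t)"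
    proof (rule measurable_compose_countable[OF _ k])
      fix i
      have r: "0 \<le> t * real (min i (Suc n)) / real (Suc n)" "t * real (min i (Suc n)) / real (Suc n) \<le> t"
        using t by (auto simp: divide_le_eq mult_left_mono)
      then show "X (t * real (min i (Suc n)) / real (Suc n)) \<in> borel_measurable (F t)"
        using X t(2) by (intro measurable_F_mono[OF r(2)]) (auto simp: cont_adapted_def adapted_def)
    qed
    then show ?thesis unfolding Y_def .
  qed
  define G where "G = {x \<in> space P. \<not> continuous_on {0..T} (\<lambda>t. X t x)}"
  have G[measurable]: "G \<in> sets (F t)" and GA: "AE x in P. x \<notin> G"
    using X unfolding cont_adapted_def continuous_paths_def G_def
    by (auto intro!: null_set_in_F t(1) elim: eventually_mono)
  have "(\<lambda>x. if x \<in> G then 0 else X (\<tau> x) x) \<in> borel_measurable (F t)"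
  proof (rule borel_measurable_LIMSEQ_real)
    show "(\<lambda>x. if x \<in> G then 0 else Y n x) \<in> borel_measurable (F t)" for n by measurable
    fix x assume x: "x \<in> space (F t)"
    then have b: "0 \<le> \<tau> x" "\<tau> x \<le> t" using STD(2)[OF \<tau>(1)] \<tau>(2) by (auto simp: space_F)
    show "(\<lambda>n. if x \<in> G then 0 else Y n x) \<longlonglongrightarrow> (if x \<in> G then 0 else X (\<tau> x) x)"
    proof (cases "x \<in> G")
      case False
      then have "continuous_on {0..T} (\<lambda>t. X t x)" using x by (auto simp: G_def space_F)
      from continuous_on_grid_tendsto[OF this b t(2)] show ?thesis
        using False grid_point_bounds(1)[OF b zero_less_Suc] by (simp add: Y_def k_def min_def)
    qed auto
  qed
  then show ?thesis
    by (rule AE_measurable_F[rotated]) (use GA t in \<open>auto elim: eventually_mono\<close>)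
qed

lemma stopped_measurable:
  assumes "cont_adapted X" "\<tau> \<in> ST" shows "at_time X \<tau> \<in> borel_measurable P"
  using stopped_measurable_F[OF assms STD(3)[OF assms(2)]] T_pos
  by (intro measurable_F_P[OF order_refl]) auto

text \<open>On \<open>\<tau> \<le> t\<close> the time \<open>\<tau>\<close> agrees with its minimum
  with \<open>min t T\<close>, and the process stopped there is already measurable at
  \<open>min t T\<close>.\<close>

lemma stopped_measurable_pre_sigma:
  assumes X: "cont_adapted X" and \<tau>: "\<tau> \<in> ST" shows "at_time X \<tau> \<in> borel_measurable (pre_sigma \<tau>)"
proof (intro borel_measurableI_le sets_pre_sigmaI STD(1)[OF \<tau>])
  fix c t :: real
  show "{x \<in> {x \<in> space (pre_sigma \<tau>). X (\<tau> x) x \<le> c}. \<tau> x \<le> t} \<in> sets (F t)"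
  proof (cases "t < 0")
    case True
    then have "\<not> \<tau> x \<le> t" if "x \<in> space P" for x
      using STD(2)[OF \<tau> that] by simp
    then have "{x \<in> {x \<in> space (pre_sigma \<tau>). X (\<tau> x) x \<le> c}. \<tau> x \<le> t} = {}"
      by (auto simp: space_pre_sigma)
    then show ?thesis by (simp only: sets.empty_sets)
  next
    case False
    let ?u = "min t T" and ?\<sigma> = "\<lambda>x. min (\<tau> x) (min t T)"
    have u: "0 \<le> ?u" "?u \<le> T" using False T_pos by auto
    have [measurable]: "at_time X ?\<sigma> \<in> borel_measurable (F ?u)"
      using u by (intro stopped_measurable_F[OF X] min_ST[OF \<tau>] const_ST) auto
    have [measurable]: "{x \<in> space P. \<tau> x \<le> ?u} \<in> sets (F ?u)" by (rule ST_le_sets[OF \<tau>]) simp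
    have "{x \<in> space (F ?u). at_time X ?\<sigma> x \<le> c} \<inter> {x \<in> space P. \<tau> x \<le> ?u} \<in> sets (F ?u)"
      by measurable
    also have "{x \<in> space (F ?u). at_time X ?\<sigma> x \<le> c} \<inter> {x \<in> space P. \<tau> x \<le> ?u}
        = {x \<in> {x \<in> space (pre_sigma \<tau>). X (\<tau> x) x \<le> c}. \<tau> x \<le> t}"
      using STD(3)[OF \<tau>] by (auto simp: space_pre_sigma space_F min_absorb1 order_trans[OF STD(3)[OF \<tau>]])
    finally show ?thesis using sets_F_mono[of ?u t] by auto
  qed
qed

lemma cont_adapted_stopped:
  assumes X: "cont_adapted X" and \<tau>: "\<tau> \<in> ST"
  shows "cont_adapted (\<lambda>t x. X (min t (\<tau> x)) x)"
  unfolding cont_adapted_def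
proof
  show "adapted F T (\<lambda>t x. X (min t (\<tau> x)) x)"
    unfolding adapted_def
    by (auto intro!: stopped_measurable_F[OF X, of "\<lambda>x. min _ (\<tau> x)"] min_ST const_ST \<tau>)
  have "AE x in P. x \<in> space P" by (rule AE_space)
  moreover have "AE x in P. continuous_on {0..T} (\<lambda>t. X t x)"
    using X by (simp add: cont_adapted_def continuous_paths_def)
  ultimately show "continuous_paths P T (\<lambda>t x. X (min t (\<tau> x)) x)"
    unfolding continuous_paths_def
  proof eventually_elim
    case (elim x)
    show ?case
      by (rule continuous_on_compose2[OF elim(2)])
         (use STD[OF \<tau>] elim(1) in \<open>auto intro!: continuous_intros\<close>)
  qed
qed

lemma cont_adapted_binop:
  assumes "cont_adapted X" "cont_adapted Y" and g: "continuous_on UNIV (\<lambda>p. g (fst p) (snd p) :: real)"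
  shows "cont_adapted (\<lambda>t x. g (X t x) (Y t x))"
  unfolding cont_adapted_def adapted_def
proof (intro conjI ballI)
  fix t assume "t \<in> {0..T}"
  then have [measurable]: "X t \<in> borel_measurable (F t)" "Y t \<in> borel_measurable (F t)"
    using assms by (auto simp: cont_adapted_def adapted_def)
  show "(\<lambda>x. g (X t x) (Y t x)) \<in> borel_measurable (F t)"
    by (rule borel_measurable_continuous_Pair[OF _ _ g]) measurable
next
  have "AE x in P. continuous_on {0..T} (\<lambda>t. X t x)" "AE x in P. continuous_on {0..T} (\<lambda>t. Y t x)"
    using assms by (auto simp: cont_adapted_def continuous_paths_def)
  then show "continuous_paths P T (\<lambda>t x. g (X t x) (Y t x))"
    unfolding continuous_paths_def
  proof eventually_elim
    case (elim x)
    have "continuous_on {0..T} (\<lambda>t. (\<lambda>p. g (fst p) (snd p)) (X t x, Y t x))"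
      by (rule continuous_on_compose2[OF g]) (auto intro!: continuous_on_Pair elim)
    then show ?case by simp
  qed
qed

end

section \<open>Hitting times\<close>

context usual_conditions
begin

text \<open>Inserting \<open>T\<close> keeps the set nonempty and supplies the default value when
  the level is never reached. Hence only \<open>hit X c x < T\<close> certifies that the level is
  attained.\<close>

definition hit :: "(real \<Rightarrow> 'a \<Rightarrow> real) \<Rightarrow> real \<Rightarrow> 'a \<Rightarrow> real" where
  "hit X c x = Inf (insert T {t \<in> {0..T}. c \<le> X t x})"

lemma hit_bounds: "0 \<le> hit X c x" "hit X c x \<le> T"
  unfolding hit_def using T_pos
  by (auto intro!: cInf_greatest cInf_lower bdd_belowI[of _ 0])

lemma hit_lower: "0 \<le> s \<Longrightarrow> s \<le> T \<Longrightarrow> c \<le> X s x \<Longrightarrow> hit X c x \<le> s"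
  unfolding hit_def using T_pos by (intro cInf_lower bdd_belowI[of _ 0]) auto

lemma less_before_hit: "0 \<le> s \<Longrightarrow> s < hit X c x \<Longrightarrow> X s x < c"
  using hit_lower[of s c X x] hit_bounds(2)[of X c x] by (meson not_less order_trans less_imp_le)

lemma hit_less_T:
  assumes X: "continuous_on {0..T} (\<lambda>t. X t x)" and h: "hit X c x < T"
  shows "c \<le> X (hit X c x) x"
proof -
  let ?S = "{t \<in> {0..T}. c \<le> X t x}"
  have cl: "closed (insert T ?S)"
    using continuous_closed_preimage[OF X, of "{c..}"] by (auto simp: vimage_def Int_def)
  have "hit X c x \<in> insert T ?S"
    unfolding hit_def using T_pos by (intro closed_contains_Inf cl bdd_belowI[of _ 0]) auto
  then show ?thesis using h by auto
qed

text \<open>A larger value would, by the intermediate value theorem, force the level itself to be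
  met strictly earlier.\<close>

lemma le_until_hit:
  assumes X: "continuous_on {0..T} (\<lambda>t. X t x)" and "X 0 x \<le> c" "0 \<le> s" "s \<le> hit X c x"
  shows "X s x \<le> c"
proof (rule ccontr)
  assume n: "\<not> X s x \<le> c"
  have "\<exists>u\<ge>0. u \<le> s \<and> X u x = c"
    using assms n hit_bounds(2)[of X c x] by (intro IVT' continuous_on_subset[OF X]) auto
  then obtain u where u: "0 \<le> u" "u \<le> s" "X u x = c" by auto
  with n have "u < s" by (cases "u = s") auto
  then show False using less_before_hit[of u X c x] u assms(4) by auto
qed

lemma hit_eq:
  assumes "continuous_on {0..T} (\<lambda>t. X t x)" "X 0 x \<le> c" "hit X c x < T"
  shows "X (hit X c x) x = c"
  using hit_less_T[of X x, OF assms(1,3)] le_until_hit[of X x, OF assms(1,2) hit_bounds(1) order_refl] by auto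

lemma hit_mono: "c \<le> d \<Longrightarrow> hit X c x \<le> hit X d x"
  unfolding hit_def by (intro cInf_superset_mono bdd_belowI[of _ 0]) (use T_pos in auto)

lemma hit_eventually_T:
  assumes X: "continuous_on {0..T} (\<lambda>t. X t x)"
  shows "\<forall>\<^sub>F n in sequentially. hit X (real n) x = T"
proof -
  have "\<exists>s\<in>{0..T}. \<forall>t\<in>{0..T}. X t x \<le> X s x"
    using T_pos by (intro continuous_attains_sup[OF compact_Icc _ X]) auto
  then obtain s where "\<And>t. t \<in> {0..T} \<Longrightarrow> X t x \<le> X s x" by blast
  moreover obtain n where n: "X s x < real n" using reals_Archimedean2 by auto
  ultimately have "hit X (real m) x = T" if "m \<ge> n" for m
    unfolding hit_def using that by (intro cInf_eq_minimum) (auto, fastforce)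
  then show ?thesis by (auto simp: eventually_sequentially)
qed

text \<open>This makes hitting events measurable: the quantifier over uncountably many times is
  replaced by countably many grid times, at the price of relaxing the level to
  \<open>c - 1 / Suc m\<close>. The maximum of the path on \<open>[0,t]\<close> recovers the exact
  level.\<close>

lemma ex_ge_iff_grid:
  assumes X: "continuous_on {0..T} (X :: real \<Rightarrow> real)" and t: "0 \<le> t" "t \<le> T"
  shows "(\<exists>s\<in>{0..t}. c \<le> X s) \<longleftrightarrow>
    (\<forall>m::nat. \<exists>n i. i \<le> Suc n \<and> c - 1 / Suc m < X (t * real i / real (Suc n)))"
proof
  assume "\<exists>s\<in>{0..t}. c \<le> X s"
  then obtain s where s: "0 \<le> s" "s \<le> t" "c \<le> X s" by auto
  show "\<forall>m::nat. \<exists>n i. i \<le> Suc n \<and> c - 1 / Suc m < X (t * real i / real (Suc n))"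
  proof
    fix m :: nat
    have "c - 1 / Suc m < X s" using s(3) by (smt (verit) zero_less_divide_1_iff of_nat_0_less_iff zero_less_Suc)
    from order_tendstoD(1)[OF continuous_on_grid_tendsto[OF X s(1,2) t(2)] this]
    obtain n where "c - 1 / Suc m < X (t * real (nat \<lceil>real (Suc n) * s / t\<rceil>) / real (Suc n))"
      by (auto simp: eventually_sequentially)
    then show "\<exists>n i. i \<le> Suc n \<and> c - 1 / Suc m < X (t * real i / real (Suc n))"
      using grid_point_bounds(1)[OF s(1,2) zero_less_Suc, of n] by blast
  qed
next
  assume R: "\<forall>m::nat. \<exists>n i. i \<le> Suc n \<and> c - 1 / Suc m < X (t * real i / real (Suc n))"
  obtain s where s: "s \<in> {0..t}" "\<And>u. u \<in> {0..t} \<Longrightarrow> X u \<le> X s"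
    using continuous_attains_sup[OF compact_Icc _ continuous_on_subset[OF X], of 0 t] t by auto
  have "c \<le> X s + 1 / Suc m" for m
  proof -
    obtain n i where ni: "i \<le> Suc n" "c - 1 / Suc m < X (t * real i / real (Suc n))" using R by blast
    have "t * real i \<le> t * real (Suc n)" by (rule mult_left_mono[OF of_nat_mono[OF ni(1)] t(1)])
    then have "X (t * real i / real (Suc n)) \<le> X s"
      using t by (intro s(2)) (auto simp: divide_le_eq simp del: of_nat_Suc)
    then show ?thesis using ni by simp
  qed
  moreover have "(\<lambda>m. X s + 1 / real (Suc m)) \<longlonglongrightarrow> X s + 0"
    by (intro tendsto_intros LIMSEQ_Suc[OF lim_1_over_n])
  ultimately have "c \<le> X s"
    by (intro LIMSEQ_le_const[of _ "X s"]) auto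
  then show "\<exists>s\<in>{0..t}. c \<le> X s" using s by auto
qed

lemma hit_ST:
  assumes X: "cont_adapted X" shows "hit X c \<in> ST"
proof (rule ST_leI)
  fix t assume t: "0 \<le> t" "t < T"
  have XF: "X (t * real (min i (Suc n)) / real (Suc n)) \<in> borel_measurable (F t)" for i n
  proof -
    have "t * real (min i (Suc n)) \<le> t * real (Suc n)" by (intro mult_left_mono t(1)) auto
    then have r: "0 \<le> t * real (min i (Suc n)) / real (Suc n)" "t * real (min i (Suc n)) / real (Suc n) \<le> t"
      using t by (auto simp: divide_le_eq simp del: of_nat_Suc)
    then show ?thesis
      using X t(2) by (intro measurable_F_mono[OF r(2)]) (auto simp: cont_adapted_def adapted_def)
  qed
  let ?B = "{x \<in> space (F t). \<forall>m::nat. \<exists>n i. i \<le> Suc n \<and> c - 1 / Suc m < X (t * real (min i (Suc n)) / real (Suc n)) x}"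
  have B: "?B \<in> sets (F t)"
    using XF by measurable
  show "{x \<in> space P. hit X c x \<le> t} \<in> sets (F t)"
  proof (rule AE_set_in_F[OF _ _ B t(1)])
    have "AE x in P. x \<in> space P" by (rule AE_space)
    moreover have "AE x in P. continuous_on {0..T} (\<lambda>t. X t x)"
      using X by (simp add: cont_adapted_def continuous_paths_def)
    ultimately show "AE x in P. x \<in> {x \<in> space P. hit X c x \<le> t} \<longleftrightarrow> x \<in> ?B"
    proof eventually_elim
      case (elim x)
      have "hit X c x \<le> t \<longleftrightarrow> (\<exists>s\<in>{0..t}. c \<le> X s x)"
      proof
        assume h: "hit X c x \<le> t"
        then show "\<exists>s\<in>{0..t}. c \<le> X s x"
          using hit_less_T[of X x, OF elim(2)] hit_bounds[of X c x] t by (intro bexI[of _ "hit X c x"]) auto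
      next
        assume "\<exists>s\<in>{0..t}. c \<le> X s x"
        then show "hit X c x \<le> t" using hit_lower[of _ c X x] t by force
      qed
      also have "\<dots> \<longleftrightarrow> x \<in> ?B"
        unfolding ex_ge_iff_grid[OF elim(2) t(1) less_imp_le[OF t(2)]] using elim(1)
        by (simp add: space_F cong: conj_cong)
      finally show ?case using elim(1) by simp
    qed
  qed auto
qed (use hit_bounds in auto)

end

section \<open>Optional stopping\<close>

text \<open>Vitali's theorem, with uniform integrability measured by the excess
  \<open>max 0 (|f| - c)\<close>. The excess is convex in \<open>f\<close>, so a martingale controls
  it by its value at \<open>T\<close>, and it is exactly the error of truncating \<open>f\<close> at
  height \<open>c\<close>.\<close>

lemma (in finite_measure) integral_tendsto_of_excess:
  fixes f :: "nat \<Rightarrow> 'a \<Rightarrow> real"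
  assumes f: "\<And>n. integrable M (f n)" and g[measurable]: "g \<in> borel_measurable M"
    and lim: "AE x in M. (\<lambda>n. f n x) \<longlonglongrightarrow> g x"
    and UI: "\<And>e. 0 < e \<Longrightarrow> \<exists>c\<ge>0. \<forall>n. (\<integral>x. max 0 (\<bar>f n x\<bar> - c) \<partial>M) \<le> e"
  shows "integrable M g" "(\<lambda>n. \<integral>x. f n x \<partial>M) \<longlonglongrightarrow> (\<integral>x. g x \<partial>M)"
proof -
  have [measurable]: "f n \<in> borel_measurable M" for n using f by auto
  have ex: "integrable M (\<lambda>x. max 0 (\<bar>f n x\<bar> - c))" for n c
    using f[of n] by (intro Bochner_Integration.integrable_max integrable_abs Bochner_Integration.integrable_diff) auto
  have exg: "integrable M (\<lambda>x. max 0 (\<bar>g x\<bar> - c)) \<and> (\<integral>x. max 0 (\<bar>g x\<bar> - c) \<partial>M) \<le> e"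
    if c: "\<forall>n. (\<integral>x. max 0 (\<bar>f n x\<bar> - c) \<partial>M) \<le> e" and "0 < e" for c e
  proof -
    have "(\<integral>\<^sup>+x. ennreal (max 0 (\<bar>g x\<bar> - c)) \<partial>M)
        = (\<integral>\<^sup>+x. liminf (\<lambda>n. ennreal (max 0 (\<bar>f n x\<bar> - c))) \<partial>M)"
    proof (rule nn_integral_cong_AE)
      show "AE x in M. ennreal (max 0 (\<bar>g x\<bar> - c)) = liminf (\<lambda>n. ennreal (max 0 (\<bar>f n x\<bar> - c)))"
        using lim
      proof eventually_elim
        case (elim x)
        then have "(\<lambda>n. ennreal (max 0 (\<bar>f n x\<bar> - c))) \<longlonglongrightarrow> ennreal (max 0 (\<bar>g x\<bar> - c))"
          by (intro tendsto_intros) auto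
        then show ?case by (simp add: lim_imp_Liminf)
      qed
    qed
    also have "\<dots> \<le> liminf (\<lambda>n. \<integral>\<^sup>+x. ennreal (max 0 (\<bar>f n x\<bar> - c)) \<partial>M)"
      by (rule nn_integral_liminf) measurable
    also have "\<dots> \<le> limsup (\<lambda>n. \<integral>\<^sup>+x. ennreal (max 0 (\<bar>f n x\<bar> - c)) \<partial>M)"
      by (rule Liminf_le_Limsup) simp
    also have "\<dots> \<le> ennreal e"
    proof (intro Limsup_bounded always_eventually allI)
      fix n
      have "(\<integral>\<^sup>+x. ennreal (max 0 (\<bar>f n x\<bar> - c)) \<partial>M) = ennreal (\<integral>x. max 0 (\<bar>f n x\<bar> - c) \<partial>M)"
        by (rule nn_integral_eq_integral[OF ex]) auto
      then show "(\<integral>\<^sup>+x. ennreal (max 0 (\<bar>f n x\<bar> - c)) \<partial>M) \<le> ennreal e"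
        using c by (simp only: ennreal_leI)
    qed
    finally have le: "(\<integral>\<^sup>+x. ennreal (max 0 (\<bar>g x\<bar> - c)) \<partial>M) \<le> ennreal e" .
    have i: "integrable M (\<lambda>x. max 0 (\<bar>g x\<bar> - c))"
      using le by (intro integrableI_nonneg) (auto intro: le_less_trans)
    have "(\<integral>\<^sup>+x. ennreal (max 0 (\<bar>g x\<bar> - c)) \<partial>M) = ennreal (\<integral>x. max 0 (\<bar>g x\<bar> - c) \<partial>M)"
      by (rule nn_integral_eq_integral[OF i]) auto
    with le have "ennreal (\<integral>x. max 0 (\<bar>g x\<bar> - c) \<partial>M) \<le> ennreal e" by (simp only:)
    then show ?thesis using i \<open>0 < e\<close> by (simp only: ennreal_le_iff less_imp_le simp_thms)
  qed
  obtain c1 where "\<forall>n. (\<integral>x. max 0 (\<bar>f n x\<bar> - c1) \<partial>M) \<le> 1" using UI[of 1] by auto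
  from exg[OF this] have "integrable M (\<lambda>x. c1 + max 0 (\<bar>g x\<bar> - c1))" by auto
  then show gi: "integrable M g"
    by (rule Bochner_Integration.integrable_bound) (auto simp: max_def)
  show "(\<lambda>n. \<integral>x. f n x \<partial>M) \<longlonglongrightarrow> (\<integral>x. g x \<partial>M)"
  proof (rule LIMSEQ_I)
    fix r :: real assume r: "0 < r"
    obtain c where c: "0 \<le> c" "\<forall>n. (\<integral>x. max 0 (\<bar>f n x\<bar> - c) \<partial>M) \<le> r / 4" using UI[of "r / 4"] r by auto
    define h where "h y = max (- c) (min c y)" for y :: real
    have h[measurable]: "h \<in> borel_measurable borel" unfolding h_def by measurable
    have hb: "\<bar>h y\<bar> \<le> c" and he: "\<bar>y - h y\<bar> = max 0 (\<bar>y\<bar> - c)" for y using c(1) by (auto simp: h_def max_def min_def)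
    have hi: "integrable M (\<lambda>x. h (u x))" if "u \<in> borel_measurable M" for u
      using that by (intro integrable_const_bound[of _ c]) (auto simp: hb)
    have dist: "\<bar>(\<integral>x. u x \<partial>M) - (\<integral>x. h (u x) \<partial>M)\<bar> \<le> (\<integral>x. max 0 (\<bar>u x\<bar> - c) \<partial>M)" if "integrable M u" for u
    proof -
      have "(\<integral>x. u x \<partial>M) - (\<integral>x. h (u x) \<partial>M) = (\<integral>x. u x - h (u x) \<partial>M)"
        using that by (intro Bochner_Integration.integral_diff[symmetric] hi) auto
      then show ?thesis using integral_abs_bound[of M "\<lambda>x. u x - h (u x)"] by (simp add: he)
    qed
    have "(\<lambda>n. \<integral>x. h (f n x) \<partial>M) \<longlonglongrightarrow> (\<integral>x. h (g x) \<partial>M)"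
    proof (rule integral_dominated_convergence[where w = "\<lambda>_. c"])
      show "AE x in M. (\<lambda>n. h (f n x)) \<longlonglongrightarrow> h (g x)"
        using lim unfolding h_def by (rule eventually_mono) (auto intro!: tendsto_intros)
    qed (auto simp: hb)
    from LIMSEQ_D[OF this, of "r / 4"] r
    obtain N where N: "\<And>n. n \<ge> N \<Longrightarrow> \<bar>(\<integral>x. h (f n x) \<partial>M) - (\<integral>x. h (g x) \<partial>M)\<bar> < r / 4" by auto
    have "\<bar>(\<integral>x. f n x \<partial>M) - (\<integral>x. g x \<partial>M)\<bar> < r" if "n \<ge> N" for n
    proof -
      have "(\<integral>x. max 0 (\<bar>g x\<bar> - c) \<partial>M) \<le> r / 4" using exg[OF c(2)] r by simp
      then show ?thesis
        using dist[OF f[of n]] dist[OF gi] N[OF that] c(2)[rule_format, of n] r by linarith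
    qed
    then show "\<exists>no. \<forall>n\<ge>no. norm ((\<integral>x. f n x \<partial>M) - (\<integral>x. g x \<partial>M)) < r" by auto
  qed
qed

lemma integrable_excess_small:
  fixes f :: "'a \<Rightarrow> real"
  assumes f: "integrable M f" and e: "0 < e"
  shows "\<exists>c\<ge>0. (\<integral>x. max 0 (\<bar>f x\<bar> - c) \<partial>M) \<le> e"
proof -
  have [measurable]: "f \<in> borel_measurable M" using f by auto
  have "(\<lambda>n. \<integral>x. max 0 (\<bar>f x\<bar> - real n) \<partial>M) \<longlonglongrightarrow> (\<integral>x. 0 \<partial>M)"
  proof (rule integral_dominated_convergence[where w = "\<lambda>x. \<bar>f x\<bar>"])
    show "AE x in M. (\<lambda>n. max 0 (\<bar>f x\<bar> - real n)) \<longlonglongrightarrow> 0"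
    proof (intro AE_I2 tendsto_eventually)
      fix x
      obtain n where "\<bar>f x\<bar> \<le> real n" using real_arch_simple by auto
      then show "\<forall>\<^sub>F n in sequentially. max 0 (\<bar>f x\<bar> - real n) = 0"
        by (auto simp: eventually_sequentially intro!: exI[of _ n])
    qed
  qed (use f in auto)
  from LIMSEQ_D[OF this e] obtain n where "\<bar>\<integral>x. max 0 (\<bar>f x\<bar> - real n) \<partial>M\<bar> < e" by auto
  then show ?thesis by (intro exI[of _ "real n"]) auto
qed

context usual_conditions
begin

lemma integrable_indicator_mult:
  fixes f :: "'a \<Rightarrow> real"
  shows "integrable P f \<Longrightarrow> B \<in> sets P \<Longrightarrow> integrable P (\<lambda>x. f x * indicator B x)"
  using integrable_real_mult_indicator by blast

lemma martingale_set_integral: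
  assumes X: "martingale P F T X" and st: "0 \<le> s" "s \<le> t" "t \<le> T" and B: "B \<in> sets (F s)"
  shows "(\<integral>x. X s x * indicator B x \<partial>P) = (\<integral>x. X t x * indicator B x \<partial>P)"
proof -
  interpret sigma_finite_subalgebra P "F s" using st by (intro finite_subalgebra_F) auto
  have [measurable]: "X s \<in> borel_measurable P" "integrable P (X t)" "B \<in> sets P"
    using X st B sets_F_P[of s] by (auto simp: martingale_def)
  have "(\<integral>x\<in>B. X t x \<partial>P) = (\<integral>x\<in>B. real_cond_exp P (F s) (X t) x \<partial>P)"
    by (rule real_cond_exp_intA[OF _ B]) measurable
  also have "\<dots> = (\<integral>x\<in>B. X s x \<partial>P)"
  proof -
    have "AE x in P. real_cond_exp P (F s) (X t) x = X s x" using X st by (auto simp: martingale_def)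
    then show ?thesis
      unfolding set_lebesgue_integral_def by (intro integral_cong_AE) (auto elim: eventually_mono)
  qed
  finally show ?thesis by (simp add: set_lebesgue_integral_def mult.commute)
qed

text \<open>Jensen's inequality for \<open>max 0 (|y| - c)\<close> by hand: at time \<open>s\<close>
  this function is linear on each of the events \<open>X s > c\<close> and \<open>X s < -c\<close>,
  where the martingale property applies, and at time \<open>t\<close> the same linear expressions
  lie below it.\<close>

lemma martingale_excess_le:
  assumes X: "martingale P F T X" and st: "0 \<le> s" "s \<le> t" "t \<le> T" and B: "B \<in> sets (F s)" and c: "0 \<le> c"
  shows "(\<integral>x. max 0 (\<bar>X s x\<bar> - c) * indicator B x \<partial>P) \<le> (\<integral>x. max 0 (\<bar>X t x\<bar> - c) * indicator B x \<partial>P)"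
proof -
  have sF[measurable]: "X s \<in> borel_measurable (F s)" using X st by (auto simp: martingale_def adapted_def)
  have i[simp]: "integrable P (X s)" "integrable P (X t)" using X st by (auto simp: martingale_def)
  let ?U = "B \<inter> {x \<in> space (F s). c < X s x}" and ?L = "B \<inter> {x \<in> space (F s). X s x < - c}"
  have UL: "?U \<in> sets (F s)" "?L \<in> sets (F s)" using B by measurable
  then have ULP[simp]: "?U \<in> sets P" "?L \<in> sets P" "B \<in> sets P" using sets_F_P[of s] st B by auto
  have s: "B \<subseteq> space (F s)" using B by (rule sets.sets_into_space)
  have I: "integrable P (\<lambda>x. (X u x - c) * indicator ?U x - (X u x + c) * indicator ?L x)" if "u = s \<or> u = t" for u
    using that i by (intro Bochner_Integration.integrable_diff integrable_indicator_mult Bochner_Integration.integrable_add) auto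
  have split: "(\<integral>x. (X u x - c) * indicator ?U x - (X u x + c) * indicator ?L x \<partial>P)
     = (\<integral>x. X u x * indicator ?U x \<partial>P) - c * prob ?U - (\<integral>x. X u x * indicator ?L x \<partial>P) - c * prob ?L"
    if "u = s \<or> u = t" for u
  proof -
    have iu: "integrable P (X u)" using that i by auto
    have "(\<integral>x. (X u x - c) * indicator ?U x - (X u x + c) * indicator ?L x \<partial>P)
      = (\<integral>x. (X u x * indicator ?U x - c * indicator ?U x) - X u x * indicator ?L x - c * indicator ?L x \<partial>P)"
      by (intro Bochner_Integration.integral_cong) (auto simp: algebra_simps)
    also have "\<dots> = (\<integral>x. X u x * indicator ?U x \<partial>P) - c * prob ?U - (\<integral>x. X u x * indicator ?L x \<partial>P) - c * prob ?L"
      using integrable_indicator_mult[OF iu ULP(1)] integrable_indicator_mult[OF iu ULP(2)] ULP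
      by (simp add: emeasure_eq_measure)
    finally show ?thesis .
  qed
  have "(\<integral>x. max 0 (\<bar>X s x\<bar> - c) * indicator B x \<partial>P)
     = (\<integral>x. (X s x - c) * indicator ?U x - (X s x + c) * indicator ?L x \<partial>P)"
    using s c by (intro Bochner_Integration.integral_cong) (auto simp: indicator_def max_def)
  also have "\<dots> = (\<integral>x. (X t x - c) * indicator ?U x - (X t x + c) * indicator ?L x \<partial>P)"
    by (simp only: split simp_thms martingale_set_integral[OF X st UL(1)] martingale_set_integral[OF X st UL(2)])
  also have "\<dots> \<le> (\<integral>x. max 0 (\<bar>X t x\<bar> - c) * indicator B x \<partial>P)"
    using c by (intro integral_mono I integrable_indicator_mult Bochner_Integration.integrable_max
        Bochner_Integration.integrable_diff integrable_abs) (auto simp: indicator_def max_def)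
  finally show ?thesis .
qed

text \<open>Approximate \<open>\<tau>\<close> from above by grid times. On the event that the grid
  time is \<open>u n i\<close>, the martingale property replaces \<open>X\<close> there by
  \<open>X T\<close>; the excess inequality on the same events gives the uniform integrability for
  the limit.\<close>

lemma martingale_optional_stopping:
  assumes X: "martingale P F T X" and Xc: "continuous_paths P T X" and \<tau>: "\<tau> \<in> ST"
  shows "integrable P (at_time X \<tau>)" "(\<integral>x. at_time X \<tau> x \<partial>P) = (\<integral>x. X T x \<partial>P)"
proof -
  have ca: "cont_adapted X" using X Xc by (auto simp: cont_adapted_def martingale_def)
  define k where "k n x = nat \<lceil>real (Suc n) * \<tau> x / T\<rceil>" for n x
  define u where "u n i = T * real i / real (Suc n)" for n i
  have u: "0 \<le> u n i" "i \<le> Suc n \<Longrightarrow> u n i \<le> T" for n i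
    using T_pos mult_left_mono[OF of_nat_mono, of i "Suc n" T] by (auto simp: u_def divide_le_eq simp del: of_nat_Suc)
  have k_le: "k n x \<le> Suc n" if "x \<in> space P" for n x
    using grid_point_bounds(1)[OF STD(2,3)[OF \<tau> that] zero_less_Suc] by (simp add: k_def)
  have k_iff: "k n x \<le> i \<longleftrightarrow> \<tau> x \<le> u n i" for n i x
  proof -
    have "k n x \<le> i \<longleftrightarrow> real (Suc n) * \<tau> x / T \<le> real i"
      unfolding k_def by (simp add: nat_le_iff ceiling_le_iff del: of_nat_Suc)
    also have "\<dots> \<longleftrightarrow> \<tau> x \<le> u n i"
      using T_pos by (simp add: u_def field_simps del: of_nat_Suc)
    finally show ?thesis .
  qed
  \<comment> \<open>Here rounding up matters: for \<open>i > 0\<close> the event is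
    \<open>u n (i - 1) < \<tau> \<le> u n i\<close>, which is decided at time
    \<open>u n i\<close>.\<close>
  have K: "{x \<in> space P. k n x = i} \<in> sets (F (u n i))" for n i
  proof (cases i)
    case 0
    then have "{x \<in> space P. k n x = i} = {x \<in> space P. \<tau> x \<le> u n i}" using k_iff[of n _ i] by auto
    then show ?thesis using ST_le_sets[OF \<tau>] by simp
  next
    case (Suc j)
    have "{x \<in> space P. k n x = i} = {x \<in> space P. \<tau> x \<le> u n i} - {x \<in> space P. \<tau> x \<le> u n j}"
      unfolding k_iff[symmetric] Suc by auto
    moreover have "u n j \<le> u n i" using Suc T_pos by (auto simp: u_def intro!: divide_right_mono mult_left_mono)
    ultimately show ?thesis using ST_le_sets[OF \<tau>, of "u n i" "u n i"] ST_le_sets[OF \<tau>, of "u n j" "u n i"] by auto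
  qed
  have KP: "{x \<in> space P. k n x = i} \<in> sets P" if "i \<le> Suc n" for n i
    using K sets_F_P[OF u(2)[OF that]] by auto
  have ks: "\<phi> (X (u n (k n x)) x) = (\<Sum>i\<le>Suc n. \<phi> (X (u n i) x) * indicator {x \<in> space P. k n x = i} x)"
    if x: "x \<in> space P" for \<phi> :: "real \<Rightarrow> real" and n x
  proof -
    have "(\<Sum>i\<le>Suc n. \<phi> (X (u n i) x) * indicator {x \<in> space P. k n x = i} x)
      = (\<Sum>i\<in>{..Suc n}. if i = k n x then \<phi> (X (u n i) x) else 0)"
      using x by (intro sum.cong) (auto simp: indicator_def)
    then show ?thesis using k_le[OF x] by (simp del: sum.atMost_Suc)
  qed
  have kT: "\<phi> (X T x) = (\<Sum>i\<le>Suc n. \<phi> (X T x) * indicator {x \<in> space P. k n x = i} x)"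
    if x: "x \<in> space P" for \<phi> :: "real \<Rightarrow> real" and n x
  proof -
    have "(\<Sum>i\<le>Suc n. \<phi> (X T x) * indicator {x \<in> space P. k n x = i} x)
      = (\<Sum>i\<in>{..Suc n}. if i = k n x then \<phi> (X T x) else 0)"
      using x by (intro sum.cong) (auto simp: indicator_def)
    then show ?thesis using k_le[OF x] by (simp del: sum.atMost_Suc)
  qed
  have Xi: "integrable P (X s)" if "0 \<le> s" "s \<le> T" for s using X that by (auto simp: martingale_def)
  have exi: "integrable P (\<lambda>x. max 0 (\<bar>X s x\<bar> - c))" if "0 \<le> s" "s \<le> T" for s c
    using Xi[OF that] by (intro Bochner_Integration.integrable_max integrable_abs Bochner_Integration.integrable_diff) auto
  define f where "f n x = X (u n (k n x)) x" for n x
  have fi: "integrable P (f n)" for n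
  proof -
    have "integrable P (\<lambda>x. \<Sum>i\<le>Suc n. X (u n i) x * indicator {x \<in> space P. k n x = i} x)"
      by (intro Bochner_Integration.integrable_sum integrable_indicator_mult Xi u KP) auto
    then show ?thesis
      using ks[of _ "\<lambda>y. y" n] by (subst Bochner_Integration.integrable_cong[OF refl]) (auto simp: f_def)
  qed
  have fI: "(\<integral>x. f n x \<partial>P) = (\<integral>x. X T x \<partial>P)" for n
  proof -
    have "(\<integral>x. f n x \<partial>P) = (\<integral>x. (\<Sum>i\<le>Suc n. X (u n i) x * indicator {x \<in> space P. k n x = i} x) \<partial>P)"
      unfolding f_def using ks[of _ "\<lambda>y. y" n] by (intro Bochner_Integration.integral_cong) auto
    also have "\<dots> = (\<Sum>i\<le>Suc n. \<integral>x. X (u n i) x * indicator {x \<in> space P. k n x = i} x \<partial>P)"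
      by (intro Bochner_Integration.integral_sum integrable_indicator_mult Xi u KP) auto
    also have "\<dots> = (\<Sum>i\<le>Suc n. \<integral>x. X T x * indicator {x \<in> space P. k n x = i} x \<partial>P)"
      by (intro sum.cong martingale_set_integral[OF X] u K) auto
    also have "\<dots> = (\<integral>x. (\<Sum>i\<le>Suc n. X T x * indicator {x \<in> space P. k n x = i} x) \<partial>P)"
      using T_pos by (intro Bochner_Integration.integral_sum[symmetric] integrable_indicator_mult Xi KP) auto
    also have "\<dots> = (\<integral>x. X T x \<partial>P)"
      using kT[of _ "\<lambda>y. y" n] by (intro Bochner_Integration.integral_cong) auto
    finally show ?thesis .
  qed
  have fe: "(\<integral>x. max 0 (\<bar>f n x\<bar> - c) \<partial>P) \<le> (\<integral>x. max 0 (\<bar>X T x\<bar> - c) \<partial>P)" if c: "0 \<le> c" for n c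
  proof -
    let ?\<phi> = "\<lambda>y. max 0 (\<bar>y\<bar> - c)"
    have "(\<integral>x. ?\<phi> (f n x) \<partial>P) = (\<integral>x. (\<Sum>i\<le>Suc n. ?\<phi> (X (u n i) x) * indicator {x \<in> space P. k n x = i} x) \<partial>P)"
      unfolding f_def using ks[of _ ?\<phi> n] by (intro Bochner_Integration.integral_cong) auto
    also have "\<dots> = (\<Sum>i\<le>Suc n. \<integral>x. ?\<phi> (X (u n i) x) * indicator {x \<in> space P. k n x = i} x \<partial>P)"
      by (intro Bochner_Integration.integral_sum integrable_indicator_mult exi u KP) auto
    also have "\<dots> \<le> (\<Sum>i\<le>Suc n. \<integral>x. ?\<phi> (X T x) * indicator {x \<in> space P. k n x = i} x \<partial>P)"
      by (intro sum_mono martingale_excess_le[OF X] u K c) auto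
    also have "\<dots> = (\<integral>x. (\<Sum>i\<le>Suc n. ?\<phi> (X T x) * indicator {x \<in> space P. k n x = i} x) \<partial>P)"
      using T_pos by (intro Bochner_Integration.integral_sum[symmetric] integrable_indicator_mult exi KP) auto
    also have "\<dots> = (\<integral>x. ?\<phi> (X T x) \<partial>P)"
      using kT[of _ ?\<phi> n] by (intro Bochner_Integration.integral_cong) auto
    finally show ?thesis .
  qed
  have lim: "AE x in P. (\<lambda>n. f n x) \<longlonglongrightarrow> at_time X \<tau> x"
    using Xc[unfolded continuous_paths_def] AE_space
  proof eventually_elim
    case (elim x)
    from continuous_on_grid_tendsto[OF elim(1) STD(2,3)[OF \<tau> elim(2)] order_refl] show ?case
      by (simp add: f_def u_def k_def)
  qed
  have UI: "\<exists>c\<ge>0. \<forall>n. (\<integral>x. max 0 (\<bar>f n x\<bar> - c) \<partial>P) \<le> e" if e: "0 < e" for e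
  proof -
    obtain c where "0 \<le> c" "(\<integral>x. max 0 (\<bar>X T x\<bar> - c) \<partial>P) \<le> e"
      using integrable_excess_small[OF Xi e, of T] T_pos by auto
    then show ?thesis using fe[of c] by (meson order_trans)
  qed
  note L = integral_tendsto_of_excess[OF fi stopped_measurable[OF ca \<tau>] lim UI]
  show "integrable P (at_time X \<tau>)" using L(1) by simp
  have "(\<lambda>n. \<integral>x. f n x \<partial>P) \<longlonglongrightarrow> (\<integral>x. at_time X \<tau> x \<partial>P)" using L(2) by simp
  then show "(\<integral>x. at_time X \<tau> x \<partial>P) = (\<integral>x. X T x \<partial>P)"
    unfolding fI by (simp add: LIMSEQ_const_iff)
qed

lemma martingale_uniformly_integrable:
  assumes X: "martingale P F T X" shows "uniformly_integrable P T X"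
  unfolding uniformly_integrable_def
proof (rule order_tendstoI)
  fix a :: ennreal assume "0 < a"
  then obtain e where e: "0 < e" "ennreal e < a"
    using ennreal_lt_0 by (metis ennreal_less_zero_iff  dense ennreal_cases ennreal_neq_top order.strict_trans  not_less_iff_gr_or_eq ennreal_top_neq_zero top.not_eq_extremum infinity_ennreal_def)
  have Xi: "integrable P (X s)" if "0 \<le> s" "s \<le> T" for s using X that by (auto simp: martingale_def)
  obtain c where c: "0 \<le> c" "(\<integral>x. max 0 (\<bar>X T x\<bar> - c) \<partial>P) \<le> e / 2"
    using integrable_excess_small[OF Xi, of T "e / 2"] T_pos e by auto
  \<comment> \<open>Where \<open>|X t| > d \<ge> 2 * c\<close>, the value \<open>|X t|\<close> is at
    most twice its excess over \<open>c\<close>. Hence the threshold \<open>2 * c\<close> and the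
    bound \<open>e / 2\<close>.\<close>
  have "(SUP t\<in>{0..T}. \<integral>\<^sup>+x. ennreal \<bar>X t x\<bar> * indicator {y. d < \<bar>X t y\<bar>} x \<partial>P) < a" if d: "d \<ge> 2 * c" for d
  proof (rule le_less_trans[OF SUP_least e(2)])
    fix t assume t: "t \<in> {0..T}"
    have i: "integrable P (\<lambda>x. 2 * max 0 (\<bar>X t x\<bar> - c))"
      using Xi[of t] t by (intro integrable_mult_right Bochner_Integration.integrable_max integrable_abs Bochner_Integration.integrable_diff) auto
    have "(\<integral>\<^sup>+x. ennreal \<bar>X t x\<bar> * indicator {y. d < \<bar>X t y\<bar>} x \<partial>P) \<le> (\<integral>\<^sup>+x. ennreal (2 * max 0 (\<bar>X t x\<bar> - c)) \<partial>P)"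
      using d c(1) by (intro nn_integral_mono) (auto simp: indicator_def intro!: ennreal_leI)
    also have "\<dots> = ennreal (\<integral>x. 2 * max 0 (\<bar>X t x\<bar> - c) \<partial>P)"
      by (intro nn_integral_eq_integral i) auto
    also have "(\<integral>x. 2 * max 0 (\<bar>X t x\<bar> - c) \<partial>P) \<le> e"
      using martingale_excess_le[OF X _ _ _ sets.top[of "F t"] c(1), of T] t c(2)
      by (simp add: space_F indicator_def cong: Bochner_Integration.integral_cong)
    finally show "(\<integral>\<^sup>+x. ennreal \<bar>X t x\<bar> * indicator {y. d < \<bar>X t y\<bar>} x \<partial>P) \<le> ennreal e"
      by (simp add: ennreal_leI)
  qed
  then show "\<forall>\<^sub>F c in at_top. (SUP t\<in>{0..T}. \<integral>\<^sup>+x. ennreal \<bar>X t x\<bar> * indicator {y. c < \<bar>X t y\<bar>} x \<partial>P) < a"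
    by (auto simp: eventually_at_top_linorder)
qed auto

text \<open>Optional stopping taken as the definition. For adapted processes with continuous paths
  it is equivalent to the martingale property, but it is stable under stopping at once and is
  checked by one expectation per stopping time, which suits a change of measure.\<close>

definition mart :: "(real \<Rightarrow> 'a \<Rightarrow> real) \<Rightarrow> bool" where
  "mart X \<longleftrightarrow> (\<forall>\<tau>\<in>ST. integrable P (at_time X \<tau>) \<and> (\<integral>x. at_time X \<tau> x \<partial>P) = (\<integral>x. X 0 x \<partial>P))"

lemma martD:
  assumes "mart X" "\<tau> \<in> ST"
  shows "integrable P (at_time X \<tau>)" "(\<integral>x. at_time X \<tau> x \<partial>P) = (\<integral>x. X 0 x \<partial>P)"
  using assms by (auto simp: mart_def)

lemma martingale_mart:
  assumes "martingale P F T X" "continuous_paths P T X" shows "mart X"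
  unfolding mart_def
  using martingale_optional_stopping[OF assms] martingale_optional_stopping(2)[OF assms const_ST[of 0]] T_pos
  by auto

lemma mart_stopped:
  assumes X: "mart X" and \<sigma>: "\<sigma> \<in> ST" shows "mart (\<lambda>t x. X (min t (\<sigma> x)) x)"
  unfolding mart_def
proof
  fix \<tau> assume \<tau>: "\<tau> \<in> ST"
  have "(\<integral>x. X (min 0 (\<sigma> x)) x \<partial>P) = (\<integral>x. X 0 x \<partial>P)"
    using STD(2)[OF \<sigma>] by (intro Bochner_Integration.integral_cong) (auto simp: min_absorb1)
  then show "integrable P (at_time (\<lambda>t x. X (min t (\<sigma> x)) x) \<tau>) \<and>
     (\<integral>x. at_time (\<lambda>t x. X (min t (\<sigma> x)) x) \<tau> x \<partial>P) = (\<integral>x. X (min 0 (\<sigma> x)) x \<partial>P)"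
    using martD[OF X min_ST[OF \<tau> \<sigma>]] by simp
qed

text \<open>Compare the expectation at \<open>\<sigma>\<close> with that at the time equal to
  \<open>\<tau>\<close> on \<open>B\<close> and to \<open>\<sigma>\<close> elsewhere: the two
  variables differ only on \<open>B\<close>.\<close>

lemma mart_set_integral:
  assumes X: "mart X" and \<tau>: "\<tau> \<in> ST" "\<sigma> \<in> ST" "\<And>x. x \<in> space P \<Longrightarrow> \<tau> x \<le> \<sigma> x"
    and B: "B \<in> sets (pre_sigma \<tau>)"
  shows "(\<integral>x. at_time X \<tau> x * indicator B x \<partial>P) = (\<integral>x. at_time X \<sigma> x * indicator B x \<partial>P)"
proof -
  let ?\<upsilon> = "\<lambda>x. if x \<in> B then \<tau> x else \<sigma> x"
  have \<upsilon>: "?\<upsilon> \<in> ST" by (rule switch_ST[OF \<tau> B])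
  have BP: "B \<in> sets P" by (rule sets_pre_sigma_P[OF \<tau>(1) B])
  note i = martD(1)[OF X \<tau>(1)] martD(1)[OF X \<tau>(2)] martD(1)[OF X \<upsilon>]
  have "0 = (\<integral>x. at_time X \<sigma> x \<partial>P) - (\<integral>x. at_time X ?\<upsilon> x \<partial>P)"
    using martD(2)[OF X \<upsilon>] martD(2)[OF X \<tau>(2)] by simp
  also have "\<dots> = (\<integral>x. at_time X \<sigma> x - at_time X ?\<upsilon> x \<partial>P)"
    using i by simp
  also have "\<dots> = (\<integral>x. at_time X \<sigma> x * indicator B x - at_time X \<tau> x * indicator B x \<partial>P)"
    by (intro Bochner_Integration.integral_cong) (auto simp: indicator_def)
  also have "\<dots> = (\<integral>x. at_time X \<sigma> x * indicator B x \<partial>P) - (\<integral>x. at_time X \<tau> x * indicator B x \<partial>P)"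
    using integrable_indicator_mult[OF i(1) BP] integrable_indicator_mult[OF i(2) BP] by simp
  finally show ?thesis by simp
qed

lemma mart_martingale:
  assumes X: "mart X" and ad: "adapted F T X" shows "martingale P F T X"
  unfolding martingale_def
proof (intro conjI ad ballI allI impI)
  show i: "integrable P (X t)" if "t \<in> {0..T}" for t
    using martD(1)[OF X const_ST[of t]] that by auto
  fix s t assume st: "0 \<le> s" "s \<le> t" "t \<le> T"
  interpret sigma_finite_subalgebra P "F s" using st by (intro finite_subalgebra_F) auto
  show "AE x in P. real_cond_exp P (F s) (X t) x = X s x"
  proof (rule real_cond_exp_charact)
    fix A assume A: "A \<in> sets (F s)"
    have "(\<integral>x. X s x * indicator A x \<partial>P) = (\<integral>x. X t x * indicator A x \<partial>P)"
      using mart_set_integral[OF X const_ST const_ST _ sets_pre_sigma_const[OF A], of t] st by auto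
    then show "(\<integral>x\<in>A. X t x \<partial>P) = (\<integral>x\<in>A. X s x \<partial>P)"
      by (simp add: set_lebesgue_integral_def mult.commute)
  qed (use st i ad in \<open>auto simp: adapted_def\<close>)
qed

text \<open>The weights to come are the value of \<open>M\<close> at \<open>\<tau>\<close>, Taylor
  coefficients at \<open>\<tau>\<close>, and functions of the stopped pair under the change of
  measure.\<close>

lemma mart_weighted:
  assumes X: "mart X" "cont_adapted X" and \<tau>: "\<tau> \<in> ST" "\<sigma> \<in> ST" "\<And>x. x \<in> space P \<Longrightarrow> \<tau> x \<le> \<sigma> x"
    and g: "g \<in> borel_measurable (pre_sigma \<tau>)" and b: "AE x in P. \<bar>g x\<bar> \<le> C"
  shows "(\<integral>x. g x * at_time X \<sigma> x \<partial>P) = (\<integral>x. g x * at_time X \<tau> x \<partial>P)"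
    and "integrable P (\<lambda>x. g x * at_time X \<sigma> x)"
proof -
  interpret S: sigma_finite_subalgebra P "pre_sigma \<tau>" by (rule finite_subalgebra_pre_sigma[OF \<tau>(1)])
  note i = martD(1)[OF X(1) \<tau>(1)] martD(1)[OF X(1) \<tau>(2)]
  have [measurable]: "g \<in> borel_measurable P" by (rule measurable_pre_sigma_P[OF \<tau>(1) g])
  have AE: "AE x in P. real_cond_exp P (pre_sigma \<tau>) (at_time X \<sigma>) x = at_time X \<tau> x"
  proof (rule S.real_cond_exp_charact[OF _ i(2,1) stopped_measurable_pre_sigma[OF X(2) \<tau>(1)]])
    fix A assume "A \<in> sets (pre_sigma \<tau>)"
    from mart_set_integral[OF X(1) \<tau> this]
    show "(\<integral>x\<in>A. at_time X \<sigma> x \<partial>P) = (\<integral>x\<in>A. at_time X \<tau> x \<partial>P)"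
      by (simp add: set_lebesgue_integral_def mult.commute)
  qed
  show gi: "integrable P (\<lambda>x. g x * at_time X \<sigma> x)"
  proof (rule Bochner_Integration.integrable_bound)
    show "integrable P (\<lambda>x. C * \<bar>at_time X \<sigma> x\<bar>)" using i(2) by auto
    show "AE x in P. norm (g x * at_time X \<sigma> x) \<le> norm (C * \<bar>at_time X \<sigma> x\<bar>)"
      using b by (rule eventually_mono) (auto simp: abs_mult intro!: mult_right_mono)
  qed (use i in measurable)
  have "(\<integral>x. g x * at_time X \<sigma> x \<partial>P) = (\<integral>x. g x * real_cond_exp P (pre_sigma \<tau>) (at_time X \<sigma>) x \<partial>P)"
    using i by (intro S.real_cond_exp_intg(2)[OF gi g, symmetric]) auto
  also have "\<dots> = (\<integral>x. g x * at_time X \<tau> x \<partial>P)"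
    using AE i by (intro integral_cong_AE) (auto elim: eventually_mono)
  finally show "(\<integral>x. g x * at_time X \<sigma> x \<partial>P) = (\<integral>x. g x * at_time X \<tau> x \<partial>P)" .
qed

end

section \<open>Reducing sequences\<close>

context usual_conditions
begin

lemma cont_adapted_diff: "cont_adapted X \<Longrightarrow> cont_adapted Y \<Longrightarrow> cont_adapted (\<lambda>t x. X t x - Y t x)"
  by (rule cont_adapted_binop) (auto intro!: continuous_intros)

lemma cont_adapted_max: "cont_adapted X \<Longrightarrow> cont_adapted Y \<Longrightarrow> cont_adapted (\<lambda>t x. max (X t x) (Y t x))"
  by (rule cont_adapted_binop) (auto intro!: continuous_intros)

lemma cont_adapted_comp:
  assumes "cont_adapted X" "continuous_on UNIV (g :: real \<Rightarrow> real)"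
  shows "cont_adapted (\<lambda>t x. g (X t x))"
proof (rule cont_adapted_binop[OF assms(1) assms(1), of "\<lambda>a _. g a"])
  show "continuous_on UNIV (\<lambda>p::real \<times> real. g (fst p))"
    by (rule continuous_on_compose2[OF assms(2)]) (auto intro!: continuous_intros)
qed

lemma cont_adapted_cont: "cont_adapted X \<Longrightarrow> AE x in P. continuous_on {0..T} (\<lambda>t. X t x)"
  by (simp add: cont_adapted_def continuous_paths_def)

lemma cont_adapted_initial:
  assumes "cont_adapted X" shows "cont_adapted (\<lambda>t. X 0)"
  unfolding cont_adapted_def adapted_def continuous_paths_def
proof
  have "X 0 \<in> borel_measurable (F 0)" using assms T_pos by (auto simp: cont_adapted_def adapted_def)
  then show "\<forall>t\<in>{0..T}. X 0 \<in> borel_measurable (F t)"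
    by (intro ballI) (rule measurable_F_mono[of 0], simp_all)
qed simp

lemma mart_cong_AE:
  assumes X: "mart X" and Y: "cont_adapted Y" and eq: "AE x in P. \<forall>t\<in>{0..T}. X t x = Y t x"
  shows "mart Y"
  unfolding mart_def
proof
  fix \<tau> assume \<tau>: "\<tau> \<in> ST"
  have *: "integrable P (at_time Y \<sigma>) \<and> (\<integral>x. at_time Y \<sigma> x \<partial>P) = (\<integral>x. X 0 x \<partial>P)" if \<sigma>: "\<sigma> \<in> ST" for \<sigma>
  proof -
    have AE: "AE x in P. at_time X \<sigma> x = at_time Y \<sigma> x"
      using eq AE_space 
    proof eventually_elim
      case (elim x)
      have "\<sigma> x \<in> {0..T}" using STD(2,3)[OF \<sigma> elim(2)] by simp
      then show ?case using elim(1) by blast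
    qed
    note m = martD[OF X \<sigma>]
    have "integrable P (at_time Y \<sigma>)"
      by (rule integrable_cong_AE_imp[OF m(1) stopped_measurable[OF Y \<sigma>] AE])
    moreover have "(\<integral>x. at_time X \<sigma> x \<partial>P) = (\<integral>x. at_time Y \<sigma> x \<partial>P)"
      by (rule integral_cong_AE[OF borel_measurable_integrable[OF m(1)] stopped_measurable[OF Y \<sigma>] AE])
    ultimately show ?thesis using m(2) by metis
  qed
  have "(\<lambda>_. 0) \<in> ST" using T_pos by (intro const_ST) auto
  from *[OF this] *[OF \<tau>]
  show "integrable P (at_time Y \<tau>) \<and> (\<integral>x. at_time Y \<tau> x \<partial>P) = (\<integral>x. Y 0 x \<partial>P)" by metis
qed

text \<open>One stopping time serves both martingales and makes the stopped pair bounded. The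
  interval is closed at \<open>\<rho> x\<close>, so the stopped processes obey the bounds; the lower
  bound 0 for \<open>A\<close> will come from monotonicity.\<close>

definition reduces :: "(real \<Rightarrow> 'a \<Rightarrow> real) \<Rightarrow> (real \<Rightarrow> 'a \<Rightarrow> real) \<Rightarrow> real \<Rightarrow> ('a \<Rightarrow> real) \<Rightarrow> bool" where
  "reduces M A K \<rho> \<longleftrightarrow> \<rho> \<in> ST \<and>
     (AE x in P. \<forall>t\<in>{0..\<rho> x}. \<bar>M t x\<bar> \<le> K \<and> A t x \<le> K) \<and>
     mart (\<lambda>t x. M (min t (\<rho> x)) x) \<and>
     mart (\<lambda>t x. (M (min t (\<rho> x)) x)\<^sup>2 - A (min t (\<rho> x)) x)"

definition localized :: "(real \<Rightarrow> 'a \<Rightarrow> real) \<Rightarrow> (real \<Rightarrow> 'a \<Rightarrow> real) \<Rightarrow> bool" where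
  "localized M A \<longleftrightarrow> (\<exists>\<rho>. (\<forall>n. \<exists>K. reduces M A K (\<rho> n)) \<and>
     (AE x in P. incseq (\<lambda>n::nat. \<rho> n x)) \<and> (AE x in P. \<forall>\<^sub>F n in sequentially. \<rho> n x = T))"

lemma reducesD:
  assumes "reduces M A K \<rho>"
  shows "\<rho> \<in> ST" "AE x in P. \<forall>t\<in>{0..\<rho> x}. \<bar>M t x\<bar> \<le> K \<and> A t x \<le> K"
    "mart (\<lambda>t x. M (min t (\<rho> x)) x)" "mart (\<lambda>t x. (M (min t (\<rho> x)) x)\<^sup>2 - A (min t (\<rho> x)) x)"
  using assms unfolding reduces_def by blast+

lemma reduces_min:
  assumes "reduces M A K \<rho>" "\<sigma> \<in> ST" shows "reduces M A K (\<lambda>x. min (\<sigma> x) (\<rho> x))"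
proof -
  note r = reducesD[OF assms(1)]
  have "AE x in P. \<forall>t\<in>{0..min (\<sigma> x) (\<rho> x)}. \<bar>M t x\<bar> \<le> K \<and> A t x \<le> K"
    using r(2) by (rule eventually_mono) auto
  then show ?thesis
    using mart_stopped[OF r(3) assms(2)] mart_stopped[OF r(4) assms(2)] min_ST[OF assms(2) r(1)]
    unfolding reduces_def min.assoc by blast
qed

text \<open>Take the minimum of both localizing sequences and of the times at which
  \<open>|M|\<close> or \<open>A\<close> reaches \<open>n\<close>. Continuous paths are bounded, so
  this is still \<open>T\<close> eventually; both processes start at 0, so the bound
  \<open>n\<close> holds up to and including the hitting time.\<close>

lemma localizedI:
  assumes M: "local_martingale P F T M" "continuous_paths P T M" "AE x in P. M 0 x = 0"
    and A: "square_char P F T M A"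
  shows "localized M A"
proof -
  let ?N = "\<lambda>t x. (M t x)\<^sup>2 - A t x"
  have Mc: "cont_adapted M" using M by (simp add: cont_adapted_def local_martingale_def)
  have Ac: "cont_adapted A" and A0: "AE x in P. A 0 x = 0" using A by (simp_all add: cont_adapted_def square_char_def)
  have absM: "cont_adapted (\<lambda>t x. \<bar>M t x\<bar>)"
    by (rule cont_adapted_comp[OF Mc]) (auto intro!: continuous_intros)
  have "cont_adapted (\<lambda>t x. (M t x)\<^sup>2)"
    by (rule cont_adapted_comp[OF Mc]) (auto intro!: continuous_intros)
  from cont_adapted_diff[OF this Ac] have Nc: "cont_adapted ?N" .
  obtain \<sigma> where \<sigma>: "\<And>n. \<sigma> n \<in> ST" "AE x in P. incseq (\<lambda>n::nat. \<sigma> n x)"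
    "AE x in P. \<forall>\<^sub>F n in sequentially. \<sigma> n x = T" "\<And>n. martingale P F T (\<lambda>t x. M (min t (\<sigma> n x)) x - M 0 x)"
    using M(1) by (auto simp: local_martingale_def)
  obtain \<sigma>' where \<sigma>': "\<And>n. \<sigma>' n \<in> ST" "AE x in P. incseq (\<lambda>n::nat. \<sigma>' n x)"
    "AE x in P. \<forall>\<^sub>F n in sequentially. \<sigma>' n x = T" "\<And>n. martingale P F T (\<lambda>t x. ?N (min t (\<sigma>' n x)) x - ?N 0 x)"
    using A unfolding square_char_def local_martingale_def by auto
  define h where "h n x = min (hit (\<lambda>t x. \<bar>M t x\<bar>) (real n) x) (hit A (real n) x)" for n x
  define \<rho> where "\<rho> n x = min (min (\<sigma> n x) (\<sigma>' n x)) (h n x)" for n x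
  have hST: "h n \<in> ST" for n unfolding h_def by (intro min_ST hit_ST absM Ac)
  have \<rho>ST: "\<rho> n \<in> ST" for n unfolding \<rho>_def by (intro min_ST \<sigma> \<sigma>' hST)
  have red: "mart (\<lambda>t x. X (min t (\<rho> n x)) x)"
    if X: "martingale P F T (\<lambda>t x. X (min t (s x)) x - X 0 x)" "cont_adapted X" "AE x in P. X 0 x = 0"
      "s \<in> ST" "\<And>x. \<rho> n x \<le> s x" for X s n
  proof -
    have c: "cont_adapted (\<lambda>t x. X (min t (s x)) x - X 0 x)"
      by (rule cont_adapted_diff[OF cont_adapted_stopped[OF X(2,4)] cont_adapted_initial[OF X(2)]])
    have "mart (\<lambda>t x. X (min t (s x)) x - X 0 x)"
      by (rule martingale_mart[OF X(1)]) (use c in \<open>simp add: cont_adapted_def\<close>)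
    from mart_stopped[OF this \<rho>ST[of n]] have "mart (\<lambda>t x. X (min t (\<rho> n x)) x - X 0 x)"
      unfolding min.assoc min_absorb1[OF X(5)] .
    moreover have "cont_adapted (\<lambda>t x. X (min t (\<rho> n x)) x)" by (rule cont_adapted_stopped[OF X(2) \<rho>ST])
    moreover have "AE x in P. \<forall>t\<in>{0..T}. X (min t (\<rho> n x)) x - X 0 x = X (min t (\<rho> n x)) x"
      using X(3) by (rule eventually_mono) simp
    ultimately show ?thesis by (rule mart_cong_AE)
  qed
  have red1: "mart (\<lambda>t x. M (min t (\<rho> n x)) x)" for n
    by (rule red[OF \<sigma>(4)[of n] Mc M(3) \<sigma>(1)[of n]]) (simp add: \<rho>_def)
  have red2: "mart (\<lambda>t x. ?N (min t (\<rho> n x)) x)" for n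
  proof (rule red[OF \<sigma>'(4)[of n] Nc _ \<sigma>'(1)[of n]])
    show "AE x in P. ?N 0 x = 0" using M(3) A0 by eventually_elim simp
  qed (simp add: \<rho>_def)
  have bd: "AE x in P. \<forall>t\<in>{0..\<rho> n x}. \<bar>M t x\<bar> \<le> real n \<and> A t x \<le> real n" for n
    using cont_adapted_cont[OF absM] cont_adapted_cont[OF Ac] M(3) A0
  proof eventually_elim
    case (elim x)
    show ?case
    proof
      fix t assume t: "t \<in> {0..\<rho> n x}"
      show "\<bar>M t x\<bar> \<le> real n \<and> A t x \<le> real n"
        using le_until_hit[of "\<lambda>t x. \<bar>M t x\<bar>" x "real n" t, OF elim(1)] le_until_hit[of A x "real n" t, OF elim(2)] elim(3,4) t
        by (simp add: \<rho>_def h_def)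
    qed
  qed
  show ?thesis
    unfolding localized_def
  proof (intro exI[of _ \<rho>] conjI allI)
    show "\<exists>K. reduces M A K (\<rho> n)" for n
      unfolding reduces_def using \<rho>ST bd red1 red2 by blast
    show "AE x in P. incseq (\<lambda>n. \<rho> n x)"
      using \<sigma>(2) \<sigma>'(2)
    proof eventually_elim
      case (elim x)
      show ?case
      proof (rule incseq_SucI)
        fix n
        show "\<rho> n x \<le> \<rho> (Suc n) x"
          unfolding \<rho>_def h_def
          by (intro min.mono incseq_SucD[OF elim(1)] incseq_SucD[OF elim(2)] hit_mono) simp_all
      qed
    qed
    show "AE x in P. \<forall>\<^sub>F n in sequentially. \<rho> n x = T"
      using \<sigma>(3) \<sigma>'(3) cont_adapted_cont[OF absM] cont_adapted_cont[OF Ac]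
    proof eventually_elim
      case (elim x)
      from elim(1,2) hit_eventually_T[of "\<lambda>t x. \<bar>M t x\<bar>" x, OF elim(3)] hit_eventually_T[of A x, OF elim(4)]
      show ?case by eventually_elim (simp add: \<rho>_def h_def)
    qed
  qed
qed

text \<open>The way back to the official notions. After the change of measure only a common reducing
  sequence is known, whereas \<open>BMO\<close> asks for a square characteristic in terms of local
  martingales.\<close>

lemma localizedD:
  assumes "localized M A" and M: "cont_adapted M" "AE x in P. M 0 x = 0" and A: "cont_adapted A" "AE x in P. A 0 x = 0"
  shows "local_martingale P F T M" "local_martingale P F T (\<lambda>t x. (M t x)\<^sup>2 - A t x)"
proof -
  let ?N = "\<lambda>t x. (M t x)\<^sup>2 - A t x"
  obtain \<rho> where \<rho>: "\<And>n. \<exists>K. reduces M A K (\<rho> n)" "AE x in P. incseq (\<lambda>n::nat. \<rho> n x)"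
    "AE x in P. \<forall>\<^sub>F n in sequentially. \<rho> n x = T"
    using assms(1) by (auto simp: localized_def)
  have \<rho>ST: "\<rho> n \<in> ST" for n using \<rho>(1)[of n] reducesD(1) by blast
  have "cont_adapted (\<lambda>t x. (M t x)\<^sup>2)"
    by (rule cont_adapted_comp[OF M(1)]) (auto intro!: continuous_intros)
  from cont_adapted_diff[OF this A(1)] have Nc: "cont_adapted ?N" .
  have N0: "AE x in P. ?N 0 x = 0" using M(2) A(2) by eventually_elim simp
  have *: "local_martingale P F T X"
    if X: "cont_adapted X" "AE x in P. X 0 x = 0" "\<And>n. mart (\<lambda>t x. X (min t (\<rho> n x)) x)" for X
    unfolding local_martingale_def
  proof (intro conjI exI[of _ \<rho>] allI \<rho>ST \<rho>(2,3))
    show "adapted F T X" using X by (simp add: cont_adapted_def)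
    fix n
    have c: "cont_adapted (\<lambda>t x. X (min t (\<rho> n x)) x - X 0 x)"
      by (rule cont_adapted_diff[OF cont_adapted_stopped[OF X(1) \<rho>ST] cont_adapted_initial[OF X(1)]])
    show "martingale P F T (\<lambda>t x. X (min t (\<rho> n x)) x - X 0 x)"
    proof (rule mart_martingale)
      show "mart (\<lambda>t x. X (min t (\<rho> n x)) x - X 0 x)"
      proof (rule mart_cong_AE[OF X(3)[of n] c])
        show "AE x in P. \<forall>t\<in>{0..T}. X (min t (\<rho> n x)) x = X (min t (\<rho> n x)) x - X 0 x"
          using X(2) by (rule eventually_mono) simp
      qed
    qed (use c in \<open>simp add: cont_adapted_def\<close>)
  qed
  show "local_martingale P F T M" using \<rho>(1) by (intro *[OF M]) (blast dest: reducesD(3))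
  show "local_martingale P F T ?N" using \<rho>(1) by (intro *[OF Nc N0]) (blast dest: reducesD(4))
qed

end

section \<open>Martingale and square characteristic up to reducing times\<close>

locale increasing_pair = usual_conditions P F T
  for P :: "'a measure" and F T +
  fixes M A :: "real \<Rightarrow> 'a \<Rightarrow> real"
  assumes M_cont: "cont_adapted M" and A_cont: "cont_adapted A"
    and M_0: "AE x in P. M 0 x = 0" and A_0: "AE x in P. A 0 x = 0"
    and A_mono: "AE x in P. mono_on {0..T} (\<lambda>t. A t x)"
begin

lemma A_nonneg: "AE x in P. \<forall>t\<in>{0..T}. 0 \<le> A t x"
  using A_mono A_0
proof eventually_elim
  case (elim x)
  show ?case using mono_onD[OF elim(1), of 0] elim(2) T_pos by auto
qed

lemma A_stopped_mono:
  assumes "\<tau> \<in> ST" "\<sigma> \<in> ST" "\<And>x. x \<in> space P \<Longrightarrow> \<tau> x \<le> \<sigma> x"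
  shows "AE x in P. at_time A \<tau> x \<le> at_time A \<sigma> x"
  using A_mono AE_space
  by eventually_elim (use STD[OF assms(1)] STD[OF assms(2)] assms(3) in \<open>auto intro: mono_onD\<close>)

lemma reduces_stopped_bounds:
  assumes r: "reduces M A K \<rho>" and \<tau>: "\<tau> \<in> ST"
  shows "AE x in P. \<bar>M (min (\<tau> x) (\<rho> x)) x\<bar> \<le> K \<and> 0 \<le> A (min (\<tau> x) (\<rho> x)) x \<and> A (min (\<tau> x) (\<rho> x)) x \<le> K"
proof -
  have \<rho>: "\<rho> \<in> ST" and b: "AE x in P. \<forall>t\<in>{0..\<rho> x}. \<bar>M t x\<bar> \<le> K \<and> A t x \<le> K"
by (fact reducesD[OF r])+
  show ?thesis using b A_nonneg AE_space
  proof eventually_elim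
    case (elim x)
    have "0 \<le> min (\<tau> x) (\<rho> x)" "min (\<tau> x) (\<rho> x) \<le> \<rho> x" "min (\<tau> x) (\<rho> x) \<le> T"
      using STD[OF \<tau>] STD[OF \<rho>] elim(3) by (auto simp: min_le_iff_disj)
    then show ?case using elim(1,2) by simp
  qed
qed

lemma reduces_A_mart:
  assumes r: "reduces M A K \<rho>" and \<tau>: "\<tau> \<in> ST"
  shows "integrable P (\<lambda>x. A (min (\<tau> x) (\<rho> x)) x)" "integrable P (\<lambda>x. (M (min (\<tau> x) (\<rho> x)) x)\<^sup>2)"
    "integrable P (\<lambda>x. M (min (\<tau> x) (\<rho> x)) x)"
proof -
  have \<rho>: "\<rho> \<in> ST" by (fact reducesD[OF r])+
  note [measurable] = stopped_measurable[OF A_cont min_ST[OF \<tau> \<rho>]] stopped_measurable[OF M_cont min_ST[OF \<tau> \<rho>]]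
  note b = reduces_stopped_bounds[OF r \<tau>]
  have a: "AE x in P. norm (A (min (\<tau> x) (\<rho> x)) x) \<le> K" "AE x in P. norm (M (min (\<tau> x) (\<rho> x)) x) \<le> K"
    using b by (auto intro: eventually_mono[OF b])
  have m: "AE x in P. norm ((M (min (\<tau> x) (\<rho> x)) x)\<^sup>2) \<le> K\<^sup>2"
    using a(2) by (rule eventually_mono) (auto simp: abs_le_square_iff[symmetric])
  show "integrable P (\<lambda>x. A (min (\<tau> x) (\<rho> x)) x)"
    by (rule integrable_const_bound[OF a(1)]) measurable
  show "integrable P (\<lambda>x. M (min (\<tau> x) (\<rho> x)) x)"
    by (rule integrable_const_bound[OF a(2)]) measurable
  show "integrable P (\<lambda>x. (M (min (\<tau> x) (\<rho> x)) x)\<^sup>2)"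
    by (rule integrable_const_bound[OF m]) measurable
qed

text \<open>Orthogonality of increments: the mixed product, weighted by the bounded value at
  \<open>\<tau>\<close>, has the mean of the square at \<open>\<tau>\<close>. The martingale
  \<open>M\<^sup>2 - A\<close> then converts squares into values of \<open>A\<close>.\<close>

lemma reduced_increment:
  assumes r: "reduces M A K \<rho>" and \<tau>: "\<tau> \<in> ST" "\<sigma> \<in> ST" "\<And>x. x \<in> space P \<Longrightarrow> \<tau> x \<le> \<sigma> x"
  shows "(\<integral>x. (M (min (\<sigma> x) (\<rho> x)) x - M (min (\<tau> x) (\<rho> x)) x)\<^sup>2 \<partial>P)
      = (\<integral>x. A (min (\<sigma> x) (\<rho> x)) x - A (min (\<tau> x) (\<rho> x)) x \<partial>P)"
    and "integrable P (\<lambda>x. (M (min (\<sigma> x) (\<rho> x)) x - M (min (\<tau> x) (\<rho> x)) x)\<^sup>2)"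
proof -
  let ?m = "\<lambda>\<tau> x. M (min (\<tau> x) (\<rho> x)) x" and ?a = "\<lambda>\<tau> x. A (min (\<tau> x) (\<rho> x)) x"
  let ?X = "\<lambda>t x. M (min t (\<rho> x)) x"
  have \<rho>: "\<rho> \<in> ST" and mX: "mart ?X" and mN: "mart (\<lambda>t x. (?X t x)\<^sup>2 - A (min t (\<rho> x)) x)"
by (fact reducesD[OF r])+
  have Xc: "cont_adapted ?X" by (rule cont_adapted_stopped[OF M_cont \<rho>])
  note I\<tau> = reduces_A_mart[OF r \<tau>(1)] and I\<sigma> = reduces_A_mart[OF r \<tau>(2)]
  have b: "AE x in P. \<bar>?m \<tau> x\<bar> \<le> K" using reduces_stopped_bounds[OF r \<tau>(1)] by (rule eventually_mono) simp
  note w = mart_weighted[OF mX Xc \<tau> stopped_measurable_pre_sigma[OF Xc \<tau>(1)] b]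
  have e: "(?m \<sigma> x - ?m \<tau> x)\<^sup>2 = (?m \<sigma> x)\<^sup>2 + (?m \<tau> x)\<^sup>2 - 2 * (?m \<tau> x * ?m \<sigma> x)" for x
    by (simp add: power2_eq_square algebra_simps)
  show "integrable P (\<lambda>x. (?m \<sigma> x - ?m \<tau> x)\<^sup>2)"
    unfolding e using I\<tau> I\<sigma> w by (intro Bochner_Integration.integrable_diff Bochner_Integration.integrable_add integrable_mult_right) auto
  have "(\<integral>x. (?m \<sigma> x - ?m \<tau> x)\<^sup>2 \<partial>P) = (\<integral>x. (?m \<sigma> x)\<^sup>2 \<partial>P) + (\<integral>x. (?m \<tau> x)\<^sup>2 \<partial>P) - 2 * (\<integral>x. ?m \<tau> x * ?m \<sigma> x \<partial>P)"
    unfolding e using I\<tau> I\<sigma> w by simp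
  also have "(\<integral>x. ?m \<tau> x * ?m \<sigma> x \<partial>P) = (\<integral>x. (?m \<tau> x)\<^sup>2 \<partial>P)"
    using w(1) by (simp add: power2_eq_square)
  finally have *: "(\<integral>x. (?m \<sigma> x - ?m \<tau> x)\<^sup>2 \<partial>P) = (\<integral>x. (?m \<sigma> x)\<^sup>2 \<partial>P) - (\<integral>x. (?m \<tau> x)\<^sup>2 \<partial>P)" by simp
  have "(\<integral>x. (?m \<sigma> x)\<^sup>2 - ?a \<sigma> x \<partial>P) = (\<integral>x. (?m \<tau> x)\<^sup>2 - ?a \<tau> x \<partial>P)"
    using martD(2)[OF mN \<tau>(1)] martD(2)[OF mN \<tau>(2)] by simp
  with * show "(\<integral>x. (?m \<sigma> x - ?m \<tau> x)\<^sup>2 \<partial>P) = (\<integral>x. ?a \<sigma> x - ?a \<tau> x \<partial>P)"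
    using I\<tau> I\<sigma> by simp
qed

text \<open>\<open>C\<close> bounds the square of the BMO norm. Integrals over events replace
  conditional expectations, so that the bound can be tested through switched stopping times.\<close>

definition bmo :: "real \<Rightarrow> bool" where
  "bmo C \<longleftrightarrow> 0 \<le> C \<and> (\<forall>\<tau>\<in>ST. \<forall>B\<in>sets (pre_sigma \<tau>).
     (\<integral>\<^sup>+x. ennreal (A T x - at_time A \<tau> x) * indicator B x \<partial>P) \<le> ennreal (C * prob B))"

lemma A_measurable_T [measurable]: "A T \<in> borel_measurable P" "M T \<in> borel_measurable P"
  using stopped_measurable[OF A_cont const_ST[of T]] stopped_measurable[OF M_cont const_ST[of T]] T_pos by auto

text \<open>Off \<open>B\<close> the stopping time is moved to \<open>T\<close>, where the increment
  vanishes; the factor \<open>prob (before \<tau>)\<close> then shrinks to at most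
  \<open>prob B\<close>.\<close>

lemma bmoI:
  assumes "0 \<le> C" and le: "\<And>\<tau>. \<tau> \<in> ST \<Longrightarrow>
    (\<integral>\<^sup>+x. ennreal (A T x - at_time A \<tau> x) \<partial>P) \<le> ennreal (C * prob (before \<tau>))"
  shows "bmo C"
  unfolding bmo_def
proof (intro conjI ballI assms(1))
  fix \<tau> B assume \<tau>: "\<tau> \<in> ST" and B: "B \<in> sets (pre_sigma \<tau>)"
  let ?\<upsilon> = "\<lambda>x. if x \<in> B then \<tau> x else T"
  have \<upsilon>: "?\<upsilon> \<in> ST" using T_pos STD[OF \<tau>] by (intro switch_ST[OF \<tau> const_ST _ B]) auto
  have BP[measurable]: "B \<in> sets P" by (rule sets_pre_sigma_P[OF \<tau> B])
  have "(\<integral>\<^sup>+x. ennreal (A T x - at_time A \<tau> x) * indicator B x \<partial>P) = (\<integral>\<^sup>+x. ennreal (A T x - at_time A ?\<upsilon> x) \<partial>P)"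
    by (intro nn_integral_cong) (auto simp: indicator_def)
  also have "\<dots> \<le> ennreal (C * prob (before ?\<upsilon>))" by (rule le[OF \<upsilon>])
  also have "\<dots> \<le> ennreal (C * prob B)"
    using assms(1) by (intro ennreal_leI mult_left_mono finite_measure_mono BP) (auto split: if_splits)
  finally show "(\<integral>\<^sup>+x. ennreal (A T x - at_time A \<tau> x) * indicator B x \<partial>P) \<le> ennreal (C * prob B)" .
qed

lemma bmoD:
  assumes "bmo C" "\<tau> \<in> ST"
  shows "(\<integral>\<^sup>+x. ennreal (A T x - at_time A \<tau> x) \<partial>P) \<le> ennreal (C * prob (before \<tau>))"
proof -
  have "(\<integral>\<^sup>+x. ennreal (A T x - at_time A \<tau> x) \<partial>P)
    = (\<integral>\<^sup>+x. ennreal (A T x - at_time A \<tau> x) * indicator (before \<tau>) x \<partial>P)"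
  proof (rule nn_integral_cong)
    fix x assume "x \<in> space P"
    then show "ennreal (A T x - at_time A \<tau> x)
      = ennreal (A T x - at_time A \<tau> x) * indicator (before \<tau>) x"
      using STD(3)[OF assms(2), of x] by (cases "\<tau> x = T") auto
  qed
  also have "\<dots> \<le> ennreal (C * prob (before \<tau>))"
    using assms sets_pre_sigma_less_T[OF assms(2)] by (auto simp: bmo_def)
  finally show ?thesis .
qed

end

section \<open>Exponential moments\<close>

text \<open>Fatou's lemma for sequences that become constant pointwise; it carries bounds along a
  reducing sequence to the full process, and bounds for truncated moments to the untruncated
  ones.\<close>

lemma nn_integral_eventually_le:
  fixes f :: "nat \<Rightarrow> 'a \<Rightarrow> ennreal"
  assumes [measurable]: "\<And>n. f n \<in> borel_measurable N"
    and ev: "AE x in N. \<forall>\<^sub>F n in sequentially. f n x = g x"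
    and le: "\<And>n. (\<integral>\<^sup>+x. f n x \<partial>N) \<le> c"
  shows "(\<integral>\<^sup>+x. g x \<partial>N) \<le> c"
proof -
  have "(\<integral>\<^sup>+x. g x \<partial>N) = (\<integral>\<^sup>+x. liminf (\<lambda>n. f n x) \<partial>N)"
  proof (rule nn_integral_cong_AE)
    show "AE x in N. g x = liminf (\<lambda>n. f n x)"
      using ev by (rule eventually_mono) (metis lim_imp_Liminf sequentially_bot tendsto_eventually)
  qed
  also have "\<dots> \<le> liminf (\<lambda>n. \<integral>\<^sup>+x. f n x \<partial>N)"
    by (rule nn_integral_liminf) measurable
  also have "\<dots> \<le> limsup (\<lambda>n. \<integral>\<^sup>+x. f n x \<partial>N)"
    by (rule Liminf_le_Limsup) simp
  also have "\<dots> \<le> c"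
    using le by (intro Limsup_bounded always_eventually allI)
  finally show ?thesis .
qed

locale localized_pair = increasing_pair P F T M A
  for P :: "'a measure" and F T M A +
  assumes loc: "localized M A"
begin

lemma T_ST: "(\<lambda>_. T) \<in> ST"
  using T_pos by (intro const_ST) auto

lemma less_T_sets: "\<tau> \<in> ST \<Longrightarrow> before \<tau> \<in> sets P"
  using sets_pre_sigma_P[OF _ sets_pre_sigma_less_T] .

lemma reducing_sequence:
  "\<exists>\<rho> K. (\<forall>n::nat. reduces M A (K n) (\<rho> n)) \<and> (AE x in P. \<forall>\<^sub>F n in sequentially. \<rho> n x = T)"
  using loc unfolding localized_def by metis

lemma increment_le_of_reduced:
  assumes \<tau>: "\<tau> \<in> ST"
    and le: "\<And>K \<rho>. reduces M A K \<rho> \<Longrightarrow> (\<integral>x. A (min T (\<rho> x)) x - A (min (\<tau> x) (\<rho> x)) x \<partial>P) \<le> c"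
  shows "(\<integral>\<^sup>+x. ennreal (A T x - at_time A \<tau> x) \<partial>P) \<le> ennreal c"
proof -
  obtain \<rho> :: "nat \<Rightarrow> 'a \<Rightarrow> real" and K where \<rho>: "\<And>n. reduces M A (K n) (\<rho> n)" "AE x in P. \<forall>\<^sub>F n in sequentially. \<rho> n x = T"
    using reducing_sequence by blast
  let ?a = "\<lambda>\<tau> n x. A (min (\<tau> x) (\<rho> n x)) x"
  have meas: "?a \<upsilon> n \<in> borel_measurable P" if "\<upsilon> \<in> ST" for \<upsilon> n
    by (rule stopped_measurable[OF A_cont min_ST[OF that reducesD(1)[OF \<rho>(1)]]])
  note [measurable] = meas[OF \<tau>] meas[OF T_ST]
  show ?thesis
  proof (rule nn_integral_eventually_le[where f = "\<lambda>n x. ennreal (?a (\<lambda>_. T) n x - ?a \<tau> n x)"])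
    show "AE x in P. \<forall>\<^sub>F n in sequentially. ennreal (?a (\<lambda>_. T) n x - ?a \<tau> n x) = ennreal (A T x - at_time A \<tau> x)"
      using \<rho>(2) AE_space
    proof eventually_elim
      case (elim x)
      from elim(1) show ?case
        by (rule eventually_mono) (use STD(3)[OF \<tau> elim(2)] in simp)
    qed
    fix n
    have \<rho>n: "\<rho> n \<in> ST" by (rule reducesD(1)[OF \<rho>(1)])
    have "(\<integral>\<^sup>+x. ennreal (?a (\<lambda>_. T) n x - ?a \<tau> n x) \<partial>P) = ennreal (\<integral>x. ?a (\<lambda>_. T) n x - ?a \<tau> n x \<partial>P)"
    proof (rule nn_integral_eq_integral)
      show "integrable P (\<lambda>x. ?a (\<lambda>_. T) n x - ?a \<tau> n x)"
        using reduces_A_mart(1)[OF \<rho>(1)[of n] \<tau>] reduces_A_mart(1)[OF \<rho>(1)[of n] T_ST] by simp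
      have "AE x in P. ?a \<tau> n x \<le> ?a (\<lambda>_. T) n x"
        by (rule A_stopped_mono[OF min_ST[OF \<tau> \<rho>n] min_ST[OF T_ST \<rho>n]]) (rule min.mono[OF STD(3)[OF \<tau>] order_refl])
      then show "AE x in P. 0 \<le> ?a (\<lambda>_. T) n x - ?a \<tau> n x" by (rule eventually_mono) simp
    qed
    also have "\<dots> \<le> ennreal c" by (rule ennreal_leI[OF le[OF \<rho>(1)]])
    finally show "(\<integral>\<^sup>+x. ennreal (?a (\<lambda>_. T) n x - ?a \<tau> n x) \<partial>P) \<le> ennreal c" .
  qed measurable
qed

text \<open>The isometry up to reducing times, followed by Fatou. The resulting bound on
  \<open>M\<close> no longer shows which version of the square characteristic it came from.\<close>

lemma square_increment_le:
  assumes C: "bmo C" and \<tau>: "\<tau> \<in> ST" "\<sigma> \<in> ST" "\<And>x. x \<in> space P \<Longrightarrow> \<tau> x \<le> \<sigma> x"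
  shows "(\<integral>\<^sup>+x. ennreal ((at_time M \<sigma> x - at_time M \<tau> x)\<^sup>2) \<partial>P) \<le> ennreal (C * prob (before \<tau>))"
proof -
  obtain \<rho> :: "nat \<Rightarrow> 'a \<Rightarrow> real" and K where \<rho>: "\<And>n. reduces M A (K n) (\<rho> n)" "AE x in P. \<forall>\<^sub>F n in sequentially. \<rho> n x = T"
    using reducing_sequence by blast
  let ?m = "\<lambda>\<tau> n x. M (min (\<tau> x) (\<rho> n x)) x" and ?a = "\<lambda>\<tau> n x. A (min (\<tau> x) (\<rho> n x)) x"
  have meas: "?m \<upsilon> n \<in> borel_measurable P" if "\<upsilon> \<in> ST" for \<upsilon> n
    by (rule stopped_measurable[OF M_cont min_ST[OF that reducesD(1)[OF \<rho>(1)]]])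
  note [measurable] = meas[OF \<tau>(1)] meas[OF \<tau>(2)]
  show ?thesis
  proof (rule nn_integral_eventually_le[where f = "\<lambda>n x. ennreal ((?m \<sigma> n x - ?m \<tau> n x)\<^sup>2)"])
    show "AE x in P. \<forall>\<^sub>F n in sequentially. ennreal ((?m \<sigma> n x - ?m \<tau> n x)\<^sup>2)
        = ennreal ((at_time M \<sigma> x - at_time M \<tau> x)\<^sup>2)"
      using \<rho>(2) AE_space
    proof eventually_elim
      case (elim x)
      from elim(1) show ?case
        by (rule eventually_mono) (use STD(3)[OF \<tau>(1) elim(2)] STD(3)[OF \<tau>(2) elim(2)] in simp)
    qed
    fix n
    have \<rho>n: "\<rho> n \<in> ST" by (rule reducesD(1)[OF \<rho>(1)])
    have "(\<integral>\<^sup>+x. ennreal ((?m \<sigma> n x - ?m \<tau> n x)\<^sup>2) \<partial>P) = ennreal (\<integral>x. (?m \<sigma> n x - ?m \<tau> n x)\<^sup>2 \<partial>P)"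
      by (rule nn_integral_eq_integral[OF reduced_increment(2)[OF \<rho>(1) \<tau>]]) auto
    also have "\<dots> = ennreal (\<integral>x. ?a \<sigma> n x - ?a \<tau> n x \<partial>P)"
      by (simp only: reduced_increment(1)[OF \<rho>(1) \<tau>])
    also have "\<dots> = (\<integral>\<^sup>+x. ennreal (?a \<sigma> n x - ?a \<tau> n x) \<partial>P)"
    proof (rule nn_integral_eq_integral[symmetric])
      show "integrable P (\<lambda>x. ?a \<sigma> n x - ?a \<tau> n x)"
        by (rule Bochner_Integration.integrable_diff[OF reduces_A_mart(1)[OF \<rho>(1) \<tau>(2)] reduces_A_mart(1)[OF \<rho>(1) \<tau>(1)]])
      have "AE x in P. ?a \<tau> n x \<le> ?a \<sigma> n x"
        by (rule A_stopped_mono[OF min_ST[OF \<tau>(1) \<rho>n] min_ST[OF \<tau>(2) \<rho>n]]) (rule min.mono[OF \<tau>(3) order_refl])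
      then show "AE x in P. 0 \<le> ?a \<sigma> n x - ?a \<tau> n x" by (rule eventually_mono) simp
    qed
    also have "\<dots> \<le> (\<integral>\<^sup>+x. ennreal (A T x - at_time A \<tau> x) \<partial>P)"
    proof (rule nn_integral_mono_AE)
      have "AE x in P. at_time A \<tau> x \<le> A T x"
        by (rule A_stopped_mono[OF \<tau>(1) T_ST STD(3)[OF \<tau>(1)]])
      moreover have "AE x in P. ?a \<sigma> n x \<le> A T x"
        by (rule A_stopped_mono[OF min_ST[OF \<tau>(2) \<rho>n] T_ST STD(3)[OF min_ST[OF \<tau>(2) \<rho>n]]])
      ultimately show "AE x in P. ennreal (?a \<sigma> n x - ?a \<tau> n x) \<le> ennreal (A T x - at_time A \<tau> x)"
        using AE_space
      proof eventually_elim
        case (elim x)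
        show ?case
        \<comment> \<open>If the reducing time precedes \<open>\<tau>\<close>, the stopped increment
          is zero; otherwise it starts at \<open>\<tau>\<close> and is at most the increment up to
          \<open>T\<close>.\<close>
        proof (cases "\<tau> x \<le> \<rho> n x")
          case True
          then show ?thesis using elim by (intro ennreal_leI) (simp add: min_absorb1)
        next
          case False
          then have "min (\<tau> x) (\<rho> n x) = \<rho> n x" "min (\<sigma> x) (\<rho> n x) = \<rho> n x" using \<tau>(3)[OF elim(3)] by auto
          then show ?thesis by simp
        qed
      qed
    qed
    also have "\<dots> \<le> ennreal (C * prob (before \<tau>))" by (rule bmoD[OF C \<tau>(1)])
    finally show "(\<integral>\<^sup>+x. ennreal ((?m \<sigma> n x - ?m \<tau> n x)\<^sup>2) \<partial>P) \<le> ennreal (C * prob (before \<tau>))" .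
  qed measurable
qed

end

section \<open>The logarithm of the stochastic exponential\<close>

locale exp_pair = localized_pair P F T M A
  for P :: "'a measure" and F T M A +
  assumes Z_mart: "mart (stoch_exp M A)"
begin

definition L :: "real \<Rightarrow> 'a \<Rightarrow> real" where "L t x = M t x - A t x / 2"

lemma stoch_exp_eq: "stoch_exp M A t x = exp (L t x)"
  by (simp add: stoch_exp_def L_def)

lemma L_cont: "cont_adapted L"
proof -
  have "cont_adapted (\<lambda>t x. A t x / 2)"
    by (rule cont_adapted_comp[OF A_cont]) (auto intro!: continuous_intros)
  from cont_adapted_diff[OF M_cont this] show ?thesis unfolding L_def[abs_def] .
qed

lemma exp_L_cont: "cont_adapted (\<lambda>t x. exp (L t x))"
  by (rule cont_adapted_comp[OF L_cont]) (auto intro!: continuous_intros)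

lemma exp_L_mart: "mart (\<lambda>t x. exp (L t x))"
  using Z_mart unfolding stoch_exp_eq[abs_def] .

lemma L_stopped_measurable: "\<tau> \<in> ST \<Longrightarrow> at_time L \<tau> \<in> borel_measurable P"
  by (rule stopped_measurable[OF L_cont])

lemma L_T_measurable [measurable]: "L T \<in> borel_measurable P"
  using L_stopped_measurable[OF const_ST[of T]] T_pos by simp

text \<open>The martingale part is handled by \<open>|d| \<le> 1/2 + d\<^sup>2 / 2\<close>. Where
  \<open>\<tau> = T\<close> nothing moves, so the summand \<open>1/2\<close> costs only half of
  \<open>prob (before \<tau>)\<close>. In total the constant is \<open>C + 1/2\<close>, rounded up
  to \<open>C + 1\<close>.\<close>

lemma L_increment_le:
  assumes C: "bmo C" and \<tau>: "\<tau> \<in> ST" "\<sigma> \<in> ST" "\<And>x. x \<in> space P \<Longrightarrow> \<tau> x \<le> \<sigma> x"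
  shows "(\<integral>\<^sup>+x. ennreal \<bar>at_time L \<sigma> x - at_time L \<tau> x\<bar> \<partial>P) \<le> ennreal ((C + 1) * prob (before \<tau>))"
proof -
  let ?B = "before \<tau>" and ?p = "prob (before \<tau>)"
  let ?S = "\<lambda>x. ennreal ((at_time M \<sigma> x - at_time M \<tau> x)\<^sup>2)" and ?D = "\<lambda>x. ennreal (A T x - at_time A \<tau> x)"
  note [measurable] = stopped_measurable[OF M_cont \<tau>(1)] stopped_measurable[OF M_cont \<tau>(2)]
    stopped_measurable[OF A_cont \<tau>(1)] less_T_sets[OF \<tau>(1)]
  have C0: "0 \<le> C" using C by (simp add: bmo_def)
  have "(\<integral>\<^sup>+x. ennreal \<bar>at_time L \<sigma> x - at_time L \<tau> x\<bar> \<partial>P)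
     \<le> (\<integral>\<^sup>+x. ennreal (1/2) * indicator ?B x + ennreal (1/2) * ?S x + ennreal (1/2) * ?D x \<partial>P)"
  proof (rule nn_integral_mono_AE)
    have a: "AE x in P. at_time A \<tau> x \<le> at_time A \<sigma> x" by (rule A_stopped_mono[OF \<tau>])
    have b: "AE x in P. at_time A \<sigma> x \<le> A T x" by (rule A_stopped_mono[OF \<tau>(2) T_ST STD(3)[OF \<tau>(2)]])
    show "AE x in P. ennreal \<bar>at_time L \<sigma> x - at_time L \<tau> x\<bar>
       \<le> ennreal (1/2) * indicator ?B x + ennreal (1/2) * ?S x + ennreal (1/2) * ?D x"
      using a b AE_space
    proof eventually_elim
      case (elim x)
      show ?case
      proof (cases "\<tau> x < T")
        case True
        define d where "d = at_time M \<sigma> x - at_time M \<tau> x"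
        have "0 \<le> (\<bar>d\<bar> - 1)\<^sup>2" by simp
        then have "\<bar>d\<bar> \<le> 1/2 + d\<^sup>2 / 2" by (simp add: power2_eq_square algebra_simps abs_mult_self_eq)
        moreover have "\<bar>at_time L \<sigma> x - at_time L \<tau> x\<bar> \<le> \<bar>d\<bar> + (at_time A \<sigma> x - at_time A \<tau> x) / 2"
          using elim(1) by (simp add: L_def d_def abs_if field_simps)
        ultimately have "\<bar>at_time L \<sigma> x - at_time L \<tau> x\<bar> \<le> 1/2 + 1/2 * d\<^sup>2 + 1/2 * (A T x - at_time A \<tau> x)"
          using elim(2) by (simp add: field_simps)
        then have "ennreal \<bar>at_time L \<sigma> x - at_time L \<tau> x\<bar> \<le> ennreal (1/2 + 1/2 * d\<^sup>2 + 1/2 * (A T x - at_time A \<tau> x))"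
          by (rule ennreal_leI)
        also have "\<dots> = ennreal (1/2) + ennreal (1/2) * ennreal (d\<^sup>2) + ennreal (1/2) * ?D x"
          using elim(1,2) by (simp add: ennreal_plus[symmetric] ennreal_mult[symmetric] del: ennreal_plus ennreal_half)
        finally show ?thesis using True elim(3) by (simp add: d_def)
      next
        case False
        then have "\<sigma> x = T" "\<tau> x = T" using STD(3)[OF \<tau>(1) elim(3)] STD(3)[OF \<tau>(2) elim(3)] \<tau>(3)[OF elim(3)] by auto
        then show ?thesis by simp
      qed
    qed
  qed
  also have "\<dots> = ennreal (1/2) * emeasure P ?B + ennreal (1/2) * (\<integral>\<^sup>+x. ?S x \<partial>P) + ennreal (1/2) * (\<integral>\<^sup>+x. ?D x \<partial>P)"
    by (simp add: nn_integral_add nn_integral_cmult)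
  also have "\<dots> \<le> ennreal (1/2) * ennreal ?p + ennreal (1/2) * ennreal (C * ?p) + ennreal (1/2) * ennreal (C * ?p)"
    by (intro add_mono mult_left_mono square_increment_le[OF C \<tau>] bmoD[OF C \<tau>(1)]) (auto simp: emeasure_eq_measure)
  also have "\<dots> = ennreal (1/2 * ?p + 1/2 * (C * ?p) + 1/2 * (C * ?p))"
    using C0 by (simp add: ennreal_plus[symmetric] ennreal_mult[symmetric] del: ennreal_plus ennreal_half)
  also have "\<dots> \<le> ennreal ((C + 1) * ?p)"
    by (intro ennreal_leI) (simp add: algebra_simps)
  finally show ?thesis .
qed

lemma L_increment_prob:
  assumes C: "bmo C" and \<tau>: "\<tau> \<in> ST" "\<sigma> \<in> ST" "\<And>x. x \<in> space P \<Longrightarrow> \<tau> x \<le> \<sigma> x" and K: "0 < K"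
  shows "K * prob {x \<in> space P. K \<le> \<bar>at_time L \<sigma> x - at_time L \<tau> x\<bar>} \<le> (C + 1) * prob (before \<tau>)"
proof -
  note [measurable] = L_stopped_measurable[OF \<tau>(1)] L_stopped_measurable[OF \<tau>(2)]
  let ?S = "{x \<in> space P. K \<le> \<bar>at_time L \<sigma> x - at_time L \<tau> x\<bar>}"
  have C0: "0 \<le> C" using C by (simp add: bmo_def)
  have "ennreal (K * prob ?S) = (\<integral>\<^sup>+x. ennreal K * indicator ?S x \<partial>P)"
    using K by (subst nn_integral_cmult_indicator) (auto simp: emeasure_eq_measure ennreal_mult)
  also have "\<dots> \<le> (\<integral>\<^sup>+x. ennreal \<bar>at_time L \<sigma> x - at_time L \<tau> x\<bar> \<partial>P)"
    by (intro nn_integral_mono) (auto simp: indicator_def intro!: ennreal_leI)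
  also have "\<dots> \<le> ennreal ((C + 1) * prob (before \<tau>))" by (rule L_increment_le[OF C \<tau>])
  finally show ?thesis using C0 by (subst (asm) ennreal_le_iff) auto
qed

text \<open>With extended nonnegative weights no integrability has to be checked. This admits
  unbounded weights such as \<open>exp (- L)\<close> at \<open>\<tau>\<close>, which
  \<open>mart_weighted\<close> does not cover.\<close>

lemma exp_L_weighted:
  assumes \<tau>: "\<tau> \<in> ST" and g: "g \<in> borel_measurable (pre_sigma \<tau>)"
  shows "(\<integral>\<^sup>+x. g x * ennreal (exp (L T x)) \<partial>P) = (\<integral>\<^sup>+x. g x * ennreal (exp (at_time L \<tau> x)) \<partial>P)"
proof -
  interpret S: sigma_finite_subalgebra P "pre_sigma \<tau>" by (rule finite_subalgebra_pre_sigma[OF \<tau>])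
  have [measurable]: "g \<in> borel_measurable P" by (rule measurable_pre_sigma_P[OF \<tau> g])
  have m: "(\<lambda>x. ennreal (exp (at_time L \<tau> x))) \<in> borel_measurable (pre_sigma \<tau>)"
    using stopped_measurable_pre_sigma[OF exp_L_cont \<tau>] by measurable
  have [measurable]: "(\<lambda>x. ennreal (exp (at_time L \<tau> x))) \<in> borel_measurable P"
    by (rule measurable_pre_sigma_P[OF \<tau> m])
  have "AE x in P. ennreal (exp (at_time L \<tau> x)) = nn_cond_exp P (pre_sigma \<tau>) (\<lambda>x. ennreal (exp (L T x))) x"
  proof (rule S.nn_cond_exp_charact[OF _ _ m])
    fix B assume B: "B \<in> sets (pre_sigma \<tau>)"
    have BP: "B \<in> sets P" by (rule sets_pre_sigma_P[OF \<tau> B])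
    have i: "integrable P (\<lambda>x. exp (at_time L \<upsilon> x) * indicator B x)" if "\<upsilon> \<in> ST" for \<upsilon>
      by (rule integrable_indicator_mult[OF martD(1)[OF exp_L_mart that] BP])
    have n: "(\<integral>\<^sup>+x\<in>B. ennreal (exp (at_time L \<upsilon> x)) \<partial>P) = ennreal (\<integral>x. exp (at_time L \<upsilon> x) * indicator B x \<partial>P)"
      if "\<upsilon> \<in> ST" for \<upsilon>
    proof -
      have "(\<integral>\<^sup>+x\<in>B. ennreal (exp (at_time L \<upsilon> x)) \<partial>P) = (\<integral>\<^sup>+x. ennreal (exp (at_time L \<upsilon> x) * indicator B x) \<partial>P)"
        by (intro nn_integral_cong) (auto simp: indicator_def)
      also have "\<dots> = ennreal (\<integral>x. exp (at_time L \<upsilon> x) * indicator B x \<partial>P)"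
        by (rule nn_integral_eq_integral[OF i[OF that]]) auto
      finally show ?thesis .
    qed
    show "(\<integral>\<^sup>+x\<in>B. ennreal (exp (L T x)) \<partial>P) = (\<integral>\<^sup>+x\<in>B. ennreal (exp (at_time L \<tau> x)) \<partial>P)"
      unfolding n[OF \<tau>] n[OF T_ST] using mart_set_integral[OF exp_L_mart \<tau> T_ST STD(3)[OF \<tau>] B] by simp
  qed measurable
  then have "(\<integral>\<^sup>+x. g x * ennreal (exp (at_time L \<tau> x)) \<partial>P)
     = (\<integral>\<^sup>+x. g x * nn_cond_exp P (pre_sigma \<tau>) (\<lambda>x. ennreal (exp (L T x))) x \<partial>P)"
    by (intro nn_integral_cong_AE) (rule eventually_mono, assumption, simp)
  also have "\<dots> = (\<integral>\<^sup>+x. g x * ennreal (exp (L T x)) \<partial>P)"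
    by (rule S.nn_cond_exp_intg[OF g]) measurable
  finally show ?thesis by simp
qed

text \<open>Weight by the reciprocal of the density at \<open>\<tau>\<close>: the factor that the
  density gains after \<open>\<tau>\<close> has conditional mean one.\<close>

lemma exp_L_ratio:
  assumes \<tau>: "\<tau> \<in> ST" and B: "B \<in> sets (pre_sigma \<tau>)"
  shows "(\<integral>\<^sup>+x. ennreal (exp (L T x - at_time L \<tau> x)) * indicator B x \<partial>P) = ennreal (prob B)"
proof -
  have g: "(\<lambda>x. ennreal (exp (- at_time L \<tau> x)) * indicator B x) \<in> borel_measurable (pre_sigma \<tau>)"
    using stopped_measurable_pre_sigma[OF L_cont \<tau>] B by measurable
  have e: "ennreal (exp (- a)) * b * ennreal (exp c) = ennreal (exp (c - a)) * b" for a c b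
  proof -
    have "ennreal (exp (c - a)) = ennreal (exp (- a)) * ennreal (exp c)"
      by (simp add: ennreal_mult[symmetric] exp_add[symmetric])
    then show ?thesis by (simp add: ac_simps)
  qed
  show ?thesis
    using exp_L_weighted[OF \<tau> g] unfolding e
    by (simp add: sets_pre_sigma_P[OF \<tau> B] emeasure_eq_measure)
qed

text \<open>For \<open>q > 1\<close> this is \<open>(R\<^sub>q)\<close>, and for \<open>q < 0\<close> it is \<open>(A\<^sub>p)\<close> with \<open>q = -1/(p - 1)\<close>.\<close>

definition expo :: "real \<Rightarrow> real \<Rightarrow> bool" where
  "expo q D \<longleftrightarrow> 0 \<le> D \<and> (\<forall>\<tau>\<in>ST. \<forall>B\<in>sets (pre_sigma \<tau>).
     (\<integral>\<^sup>+x. ennreal (exp (q * (L T x - at_time L \<tau> x))) * indicator B x \<partial>P) \<le> ennreal (D * prob B))"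

text \<open>Where \<open>\<tau> = T\<close> the integrand is 1, which is why the constant must be at
  least 1. Elsewhere \<open>B\<close> is absorbed into the switched stopping time.\<close>

lemma expoI:
  assumes D: "1 \<le> D" and le: "\<And>\<tau>. \<tau> \<in> ST \<Longrightarrow>
    (\<integral>\<^sup>+x. ennreal (exp (q * (L T x - at_time L \<tau> x))) * indicator (before \<tau>) x \<partial>P)
      \<le> ennreal (D * prob (before \<tau>))"
  shows "expo q D"
  unfolding expo_def
proof (intro conjI ballI)
  show "0 \<le> D" using D by simp
  fix \<tau> B assume \<tau>: "\<tau> \<in> ST" and B: "B \<in> sets (pre_sigma \<tau>)"
  let ?\<upsilon> = "\<lambda>x. if x \<in> B then \<tau> x else T"
  let ?B1 = "before ?\<upsilon>" and ?B2 = "B - before \<tau>"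
  have \<upsilon>: "?\<upsilon> \<in> ST" by (rule switch_ST[OF \<tau> T_ST STD(3)[OF \<tau>] B])
  have BP[measurable]: "B \<in> sets P" by (rule sets_pre_sigma_P[OF \<tau> B])
  have s: "B \<subseteq> space P" using sets.sets_into_space[OF BP] .
  have [measurable]: "?B1 \<in> sets P" "?B2 \<in> sets P" using less_T_sets[OF \<upsilon>] less_T_sets[OF \<tau>] by auto
  note [measurable] = L_stopped_measurable[OF \<upsilon>]
  have "(\<integral>\<^sup>+x. ennreal (exp (q * (L T x - at_time L \<tau> x))) * indicator B x \<partial>P)
     = (\<integral>\<^sup>+x. ennreal (exp (q * (L T x - at_time L ?\<upsilon> x))) * indicator ?B1 x + indicator ?B2 x \<partial>P)"
  proof (rule nn_integral_cong)
    fix x assume x: "x \<in> space P"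
    show "ennreal (exp (q * (L T x - at_time L \<tau> x))) * indicator B x
       = ennreal (exp (q * (L T x - at_time L ?\<upsilon> x))) * indicator ?B1 x + indicator ?B2 x"
      using x STD(3)[OF \<tau> x] by (cases "x \<in> B"; cases "\<tau> x = T") auto
  qed
  also have "\<dots> = (\<integral>\<^sup>+x. ennreal (exp (q * (L T x - at_time L ?\<upsilon> x))) * indicator ?B1 x \<partial>P) + emeasure P ?B2"
    by (subst nn_integral_add) (auto simp: nn_integral_indicator)
  also have "\<dots> \<le> ennreal (D * prob ?B1) + ennreal (D * prob ?B2)"
    using le[OF \<upsilon>] mult_right_mono[OF D, of "prob ?B2"] by (intro add_mono) (auto simp: emeasure_eq_measure intro!: ennreal_leI)
  also have "\<dots> = ennreal (D * (prob ?B1 + prob ?B2))"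
    using D by (simp add: ennreal_plus[symmetric] distrib_left del: ennreal_plus)
  also have "prob ?B1 + prob ?B2 = prob (?B1 \<union> ?B2)"
    using s by (intro finite_measure_Union[symmetric]) (auto split: if_splits)
  also have "?B1 \<union> ?B2 = B" using s by (auto split: if_splits)
  finally show "(\<integral>\<^sup>+x. ennreal (exp (q * (L T x - at_time L \<tau> x))) * indicator B x \<partial>P) \<le> ennreal (D * prob B)" .
qed

section \<open>Exit times and the restart argument\<close>

definition exit_time :: "real \<Rightarrow> real \<Rightarrow> ('a \<Rightarrow> real) \<Rightarrow> 'a \<Rightarrow> real" where
  "exit_time e K \<tau> = hit (\<lambda>t x. e * (L t x - L (min t (\<tau> x)) x)) K"

text \<open>The observed process vanishes up to \<open>\<tau>\<close>, so a positive level cannot be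
  hit before \<open>\<tau>\<close>. Continuity excludes overshoot: the increment of \<open>L\<close>
  at an exit before \<open>T\<close> is known exactly. The sign \<open>e\<close> selects the
  direction.\<close>

lemma exit_time:
  assumes \<tau>: "\<tau> \<in> ST" and K: "0 < K"
  shows "exit_time e K \<tau> \<in> ST" "\<And>x. x \<in> space P \<Longrightarrow> \<tau> x \<le> exit_time e K \<tau> x"
    and "AE x in P. exit_time e K \<tau> x < T \<longrightarrow> e * (L (exit_time e K \<tau> x) x - at_time L \<tau> x) = K"
    and "AE x in P. \<not> exit_time e K \<tau> x < T \<longrightarrow> e * (L T x - at_time L \<tau> x) \<le> K"
proof -
  let ?Y = "\<lambda>t x. e * (L t x - L (min t (\<tau> x)) x)"
  have Yc: "cont_adapted ?Y"
    by (rule cont_adapted_comp[OF cont_adapted_diff[OF L_cont cont_adapted_stopped[OF L_cont \<tau>]]])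
       (auto intro!: continuous_intros)
  show "exit_time e K \<tau> \<in> ST" unfolding exit_time_def by (rule hit_ST[OF Yc])
  show le: "\<tau> x \<le> exit_time e K \<tau> x" if "x \<in> space P" for x
    unfolding exit_time_def hit_def using STD(2,3)[OF \<tau> that] K T_pos
    by (intro cInf_greatest) (auto simp: not_le[symmetric] min_def split: if_splits)
  show "AE x in P. exit_time e K \<tau> x < T \<longrightarrow> e * (L (exit_time e K \<tau> x) x - at_time L \<tau> x) = K"
    using cont_adapted_cont[OF Yc] AE_space
  proof eventually_elim
    case (elim x)
    show ?case
    proof
      assume h: "exit_time e K \<tau> x < T"
      have "?Y 0 x \<le> K" using STD(2)[OF \<tau> elim(2)] K by (simp add: min_absorb1)
      from hit_eq[of ?Y x K, OF elim(1) this] h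
      have "?Y (exit_time e K \<tau> x) x = K" by (simp add: exit_time_def)
      then show "e * (L (exit_time e K \<tau> x) x - at_time L \<tau> x) = K" using le[OF elim(2)] by (simp add: min_absorb2)
    qed
  qed
  show "AE x in P. \<not> exit_time e K \<tau> x < T \<longrightarrow> e * (L T x - at_time L \<tau> x) \<le> K"
    using cont_adapted_cont[OF Yc] AE_space
  proof eventually_elim
    case (elim x)
    show ?case
    proof
      assume h: "\<not> exit_time e K \<tau> x < T"
      have "?Y 0 x \<le> K" using STD(2)[OF \<tau> elim(2)] K by (simp add: min_absorb1)
      from le_until_hit[of ?Y x K T, OF elim(1) this] h T_pos
      have "?Y T x \<le> K" by (simp add: exit_time_def)
      then show "e * (L T x - at_time L \<tau> x) \<le> K" using STD(3)[OF \<tau> elim(2)] by (simp add: min_absorb2)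
    qed
  qed
qed

text \<open>
  A truncation at \<open>N\<close> makes some constant trivially valid for all stopping times; restarting at the exit
  time turns a valid constant \<open>d\<close> into \<open>g + g \<kappa> d\<close>, and the fixed point \<open>c\<close> of this contraction does not
  depend on \<open>N\<close>.
\<close>

lemma exp_moment:
  assumes e: "e = 1 \<or> e = -1" and a: "a = 0 \<or> a = (1::real)" and K: "0 < K" and \<kappa>: "0 \<le> \<kappa>" "\<kappa> < 1"
    and exit: "\<And>\<tau>. \<tau> \<in> ST \<Longrightarrow>
      exp (a * e * K) * prob (before (exit_time e K \<tau>)) \<le> \<kappa> * prob (before \<tau>)"
  shows "\<exists>r>0. \<exists>D. expo (a + r * e) D"
proof -
  \<comment> \<open>Any \<open>g\<close> with \<open>1 < g\<close> and
    \<open>g * \<kappa> < 1\<close> would serve. The rate \<open>r\<close> is tuned so that covering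
    the distance \<open>K\<close> costs exactly the factor \<open>g\<close>, and \<open>c\<close>
    solves \<open>c = g + g * \<kappa> * c\<close>.\<close>
  define g where "g = 2 / (1 + \<kappa>)"
  define r where "r = ln g / K"
  define c where "c = g / (1 - g * \<kappa>)"
  have g: "1 < g" "g * \<kappa> < 1" using \<kappa> by (auto simp: g_def field_simps)
  have r: "0 < r" and rK: "exp (r * K) = g" using g K by (auto simp: r_def)
  have gk0: "0 \<le> g * \<kappa>" using g \<kappa> by simp
  have c: "1 \<le> c" "g + g * \<kappa> * c = c" using g gk0 by (auto simp: c_def field_simps)
  define \<Delta> where "\<Delta> \<tau> x = L T x - at_time L \<tau> x" for \<tau> x
  define p where "p \<tau> = prob (before \<tau>)" for \<tau>
  define I where "I \<tau> x = (indicator (before \<tau>) x :: ennreal)" for \<tau> x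
  have \<Delta>_meas: "\<Delta> \<tau> \<in> borel_measurable P" if "\<tau> \<in> ST" for \<tau>
    using L_stopped_measurable[OF that] unfolding \<Delta>_def[abs_def] by measurable
  have I_meas: "I \<tau> \<in> borel_measurable P" if "\<tau> \<in> ST" for \<tau>
    using less_T_sets[OF that] unfolding I_def[abs_def] by measurable
  have p0: "0 \<le> p \<tau>" for \<tau> by (simp add: p_def)
  \<comment> \<open>\<open>a\<close> selects the weight: none for 0, the density ratio after
    \<open>\<tau>\<close> for 1. In both cases the total weight of \<open>before \<tau>\<close> is
    its probability.\<close>
  have I_int: "(\<integral>\<^sup>+x. ennreal (exp (a * \<Delta> \<tau> x)) * I \<tau> x \<partial>P) = ennreal (p \<tau>)" if "\<tau> \<in> ST" for \<tau>
    using a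
  proof
    assume "a = 0"
    then show ?thesis using less_T_sets[OF that] by (simp add: I_def p_def emeasure_eq_measure)
  next
    assume "a = 1"
    then show ?thesis using exp_L_ratio[OF that sets_pre_sigma_less_T[OF that]] by (simp add: I_def p_def \<Delta>_def)
  qed
  have bound: "(\<integral>\<^sup>+x. ennreal (exp (a * \<Delta> \<tau> x + r * min (e * \<Delta> \<tau> x) N)) * I \<tau> x \<partial>P) \<le> ennreal (c * p \<tau>)"
    if N: "0 \<le> N" and \<tau>: "\<tau> \<in> ST" for N \<tau>
  proof -
    define V where "V \<tau> = (\<integral>\<^sup>+x. ennreal (exp (a * \<Delta> \<tau> x + r * min (e * \<Delta> \<tau> x) N)) * I \<tau> x \<partial>P)" for \<tau>
    have base: "V \<tau> \<le> ennreal (exp (r * N) * p \<tau>)" if \<tau>: "\<tau> \<in> ST" for \<tau>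
    proof -
      note [measurable] = \<Delta>_meas[OF \<tau>] I_meas[OF \<tau>]
      have "V \<tau> \<le> (\<integral>\<^sup>+x. ennreal (exp (r * N)) * (ennreal (exp (a * \<Delta> \<tau> x)) * I \<tau> x) \<partial>P)"
        unfolding V_def
      proof (rule nn_integral_mono)
        fix x
        have "exp (a * \<Delta> \<tau> x + r * min (e * \<Delta> \<tau> x) N) \<le> exp (r * N + a * \<Delta> \<tau> x)"
          using r by (simp add: mult_left_mono)
        then have "ennreal (exp (a * \<Delta> \<tau> x + r * min (e * \<Delta> \<tau> x) N)) \<le> ennreal (exp (r * N)) * ennreal (exp (a * \<Delta> \<tau> x))"
          by (simp add: exp_add ennreal_mult[symmetric] ennreal_leI)
        from mult_right_mono[OF this, of "I \<tau> x"]
        show "ennreal (exp (a * \<Delta> \<tau> x + r * min (e * \<Delta> \<tau> x) N)) * I \<tau> x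
          \<le> ennreal (exp (r * N)) * (ennreal (exp (a * \<Delta> \<tau> x)) * I \<tau> x)" by (simp add: ac_simps)
      qed
      also have "\<dots> = ennreal (exp (r * N)) * ennreal (p \<tau>)"
        using I_int[OF \<tau>] by (subst nn_integral_cmult) auto
      finally show ?thesis by (simp add: ennreal_mult p0)
    qed
    have step: "V \<tau> \<le> ennreal ((g + g * \<kappa> * d) * p \<tau>)"
      if d: "0 \<le> d" "\<And>\<tau>. \<tau> \<in> ST \<Longrightarrow> V \<tau> \<le> ennreal (d * p \<tau>)" and \<tau>: "\<tau> \<in> ST" for d \<tau>
    proof -
      let ?U = "exit_time e K \<tau>"
      note U = exit_time[OF \<tau> K, where e = e]
      note [measurable] = \<Delta>_meas[OF \<tau>] I_meas[OF \<tau>] \<Delta>_meas[OF U(1)] I_meas[OF U(1)]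
      have "V \<tau> \<le> (\<integral>\<^sup>+x. ennreal g * (ennreal (exp (a * \<Delta> \<tau> x)) * I \<tau> x)
          + ennreal (exp (a * e * K) * g) * (ennreal (exp (a * \<Delta> ?U x + r * min (e * \<Delta> ?U x) N)) * I ?U x) \<partial>P)"
        unfolding V_def
      proof (rule nn_integral_mono_AE)
        show "AE x in P. ennreal (exp (a * \<Delta> \<tau> x + r * min (e * \<Delta> \<tau> x) N)) * I \<tau> x
          \<le> ennreal g * (ennreal (exp (a * \<Delta> \<tau> x)) * I \<tau> x)
          + ennreal (exp (a * e * K) * g) * (ennreal (exp (a * \<Delta> ?U x + r * min (e * \<Delta> ?U x) N)) * I ?U x)"
          using U(3,4) AE_space
        proof eventually_elim
          case (elim x)
          show ?case
          proof (cases "?U x < T")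
            case True
            then have eq: "e * (at_time L ?U x - at_time L \<tau> x) = K" using elim(1) by blast
            have "at_time L ?U x - at_time L \<tau> x = e * K" using e eq by auto
            then have D: "\<Delta> \<tau> x = e * K + \<Delta> ?U x" by (simp add: \<Delta>_def)
            have De: "e * \<Delta> \<tau> x = K + e * \<Delta> ?U x" unfolding D using e by auto
            \<comment> \<open>Since \<open>K > 0\<close>,
              \<open>min (K + y) N \<le> K + min y N\<close>; so the restarted quantity is again
              truncated at the same \<open>N\<close>.\<close>
            have "r * min (e * \<Delta> \<tau> x) N \<le> r * (K + min (e * \<Delta> ?U x) N)"
              unfolding De using r K by (intro mult_left_mono) auto
            then have "exp (a * \<Delta> \<tau> x + r * min (e * \<Delta> \<tau> x) N)
                \<le> exp (a * e * K + r * K + (a * \<Delta> ?U x + r * min (e * \<Delta> ?U x) N))"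
              unfolding exp_le_cancel_iff D by (simp add: algebra_simps)
            also have "\<dots> = exp (a * e * K) * g * exp (a * \<Delta> ?U x + r * min (e * \<Delta> ?U x) N)"
              unfolding exp_add[of "a * e * K + r * K"] exp_add[of "a * e * K" "r * K"] rK ..
            finally have "ennreal (exp (a * \<Delta> \<tau> x + r * min (e * \<Delta> \<tau> x) N))
                \<le> ennreal (exp (a * e * K) * g) * ennreal (exp (a * \<Delta> ?U x + r * min (e * \<Delta> ?U x) N))"
              using g by (simp add: ennreal_mult[symmetric] ennreal_leI)
            moreover have "I ?U x = 1" "I \<tau> x = 1"
              using True elim(3) U(2)[OF elim(3)] by (auto simp: I_def)
            ultimately show ?thesis by (simp add: add_increasing)
          next
            case False
            then have "e * \<Delta> \<tau> x \<le> K" using elim(2) by (simp add: \<Delta>_def)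
            then have "r * min (e * \<Delta> \<tau> x) N \<le> r * K"
              using r by (intro mult_left_mono) auto
            then have "exp (a * \<Delta> \<tau> x + r * min (e * \<Delta> \<tau> x) N) \<le> exp (r * K + a * \<Delta> \<tau> x)" by simp
            also have "\<dots> = g * exp (a * \<Delta> \<tau> x)" unfolding exp_add rK ..
            finally have "ennreal (exp (a * \<Delta> \<tau> x + r * min (e * \<Delta> \<tau> x) N)) \<le> ennreal g * ennreal (exp (a * \<Delta> \<tau> x))"
              using g by (simp add: ennreal_mult[symmetric] ennreal_leI)
            from mult_right_mono[OF this, of "I \<tau> x"] show ?thesis by (simp add: add_increasing2 ac_simps)
          qed
        qed
      qed
      also have "\<dots> = ennreal g * ennreal (p \<tau>) + ennreal (exp (a * e * K) * g) * V ?U"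
        unfolding V_def I_int[OF \<tau>, symmetric] by (subst nn_integral_add) (auto simp: nn_integral_cmult)
      also have "\<dots> \<le> ennreal g * ennreal (p \<tau>) + ennreal (exp (a * e * K) * g) * ennreal (d * p ?U)"
        by (intro add_left_mono mult_left_mono d(2) U(1)) auto
      also have "\<dots> = ennreal (g * p \<tau> + g * d * (exp (a * e * K) * p ?U))"
        using g d p0 by (simp add: ennreal_plus[symmetric] ennreal_mult[symmetric] ac_simps del: ennreal_plus)
      also have "\<dots> \<le> ennreal (g * p \<tau> + g * d * (\<kappa> * p \<tau>))"
        using exit[OF \<tau>] g d(1) by (intro ennreal_leI add_left_mono mult_left_mono) (auto simp: p_def)
      also have "g * p \<tau> + g * d * (\<kappa> * p \<tau>) = (g + g * \<kappa> * d) * p \<tau>" by (simp add: algebra_simps)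
      finally show ?thesis .
    qed
    \<comment> \<open>Adding \<open>c\<close> keeps \<open>d0 - c\<close> nonnegative, so that all
      iterated constants are nonnegative, as \<open>step\<close> demands.\<close>
    define d0 where "d0 = exp (r * N) + c"
    have d0: "0 \<le> d0 - c" by (simp add: d0_def)
    have iter: "V \<tau> \<le> ennreal ((c + (g * \<kappa>) ^ n * (d0 - c)) * p \<tau>)" if "\<tau> \<in> ST" for n \<tau>
      using that
    proof (induction n arbitrary: \<tau>)
      case 0
      have "exp (r * N) * p \<tau> \<le> d0 * p \<tau>" using c p0[of \<tau>] by (intro mult_right_mono) (auto simp: d0_def)
      then show ?case using base[OF 0] by (simp add: ennreal_leI order_trans)
    next
      case (Suc n)
      have nn: "0 \<le> c + (g * \<kappa>) ^ n * (d0 - c)" using c gk0 d0 by (intro add_nonneg_nonneg mult_nonneg_nonneg) auto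
      have "g + g * \<kappa> * (c + (g * \<kappa>) ^ n * (d0 - c)) = (g + g * \<kappa> * c) + (g * \<kappa>) ^ Suc n * (d0 - c)"
        by (simp add: algebra_simps)
      also have "\<dots> = c + (g * \<kappa>) ^ Suc n * (d0 - c)" by (simp only: c(2))
      finally show ?case using step[OF nn Suc.IH Suc.prems] by simp
    qed
    have "(\<lambda>n. ennreal ((c + (g * \<kappa>) ^ n * (d0 - c)) * p \<tau>)) \<longlonglongrightarrow> ennreal ((c + 0 * (d0 - c)) * p \<tau>)"
      using g gk0 by (intro tendsto_ennrealI tendsto_intros LIMSEQ_realpow_zero) auto
    then have "V \<tau> \<le> ennreal ((c + 0 * (d0 - c)) * p \<tau>)"
      by (rule LIMSEQ_le_const) (use iter[OF \<tau>] in auto)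
    then show ?thesis by (simp add: V_def)
  qed
  have "expo (a + r * e) c"
  proof (rule expoI[OF c(1)])
    fix \<tau> assume \<tau>: "\<tau> \<in> ST"
    note [measurable] = \<Delta>_meas[OF \<tau>] I_meas[OF \<tau>]
    have "(\<integral>\<^sup>+x. ennreal (exp ((a + r * e) * \<Delta> \<tau> x)) * I \<tau> x \<partial>P) \<le> ennreal (c * p \<tau>)"
    proof (rule nn_integral_eventually_le[where f = "\<lambda>n x. ennreal (exp (a * \<Delta> \<tau> x + r * min (e * \<Delta> \<tau> x) (real n))) * I \<tau> x"])
      show "AE x in P. \<forall>\<^sub>F n in sequentially. ennreal (exp (a * \<Delta> \<tau> x + r * min (e * \<Delta> \<tau> x) (real n))) * I \<tau> x
         = ennreal (exp ((a + r * e) * \<Delta> \<tau> x)) * I \<tau> x"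
      proof (rule AE_I2)
        fix x
        obtain n0 where n0: "e * \<Delta> \<tau> x \<le> real n0" using real_arch_simple by blast
        show "\<forall>\<^sub>F n in sequentially. ennreal (exp (a * \<Delta> \<tau> x + r * min (e * \<Delta> \<tau> x) (real n))) * I \<tau> x
         = ennreal (exp ((a + r * e) * \<Delta> \<tau> x)) * I \<tau> x"
          using eventually_ge_at_top[of n0]
        proof eventually_elim
          case (elim n)
          then have "min (e * \<Delta> \<tau> x) (real n) = e * \<Delta> \<tau> x" using n0 by auto
          then show ?case by (simp add: algebra_simps)
        qed
      qed
      show "(\<integral>\<^sup>+x. ennreal (exp (a * \<Delta> \<tau> x + r * min (e * \<Delta> \<tau> x) (real n))) * I \<tau> x \<partial>P) \<le> ennreal (c * p \<tau>)" for n
        by (rule bound[OF _ \<tau>]) simp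
    qed measurable
    then show "(\<integral>\<^sup>+x. ennreal (exp ((a + r * e) * (L T x - at_time L \<tau> x))) * indicator (before \<tau>) x \<partial>P)
      \<le> ennreal (c * prob (before \<tau>))"
      by (simp add: \<Delta>_def I_def p_def)
  qed
  then show ?thesis using r by blast
qed

text \<open>At an exit before \<open>T\<close> the increment of \<open>L\<close> has absolute value
  exactly \<open>K\<close>, so Markov's inequality at the exit time applies.\<close>

lemma exit_prob:
  assumes C: "bmo C" and \<tau>: "\<tau> \<in> ST" and e: "e = 1 \<or> e = -1" and K: "0 < K"
  shows "K * prob (before (exit_time e K \<tau>)) \<le> (C + 1) * prob (before \<tau>)"
proof -
  let ?U = "exit_time e K \<tau>"
  note U = exit_time[OF \<tau> K, where e = e]
  note [measurable] = L_stopped_measurable[OF \<tau>] L_stopped_measurable[OF U(1)] less_T_sets[OF U(1)]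
  have "prob (before ?U) \<le> prob {x \<in> space P. K \<le> \<bar>at_time L ?U x - at_time L \<tau> x\<bar>}"
  proof (rule finite_measure_mono_AE)
    show "AE x in P. x \<in> before ?U \<longrightarrow> x \<in> {x \<in> space P. K \<le> \<bar>at_time L ?U x - at_time L \<tau> x\<bar>}"
      using U(3) by (rule eventually_mono) (use e in auto)
  qed measurable
  from mult_left_mono[OF this, of K] K L_increment_prob[OF C \<tau> U(1,2) K] show ?thesis by linarith
qed

text \<open>For \<open>a = 0\<close> the exit carries no extra weight, and the distance
  \<open>2 * (C + 1)\<close> makes its conditional probability at most one half.\<close>

lemma bmo_imp_negative_moment:
  assumes C: "bmo C" shows "\<exists>q<0. \<exists>D. expo q D"
proof -
  have C0: "0 \<le> C" using C by (simp add: bmo_def)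
  have "\<exists>r>0. \<exists>D. expo (0 + r * (-1)) D"
  proof (rule exp_moment[where K = "2 * (C + 1)" and \<kappa> = "1/2"])
    fix \<tau> assume \<tau>: "\<tau> \<in> ST"
    have "2 * (C + 1) * prob {x \<in> space P. exit_time (-1) (2 * (C + 1)) \<tau> x < T} \<le> (C + 1) * prob (before \<tau>)"
      using C0 by (intro exit_prob[OF C \<tau>]) auto
    then have "(C + 1) * (2 * prob {x \<in> space P. exit_time (-1) (2 * (C + 1)) \<tau> x < T}) \<le> (C + 1) * prob (before \<tau>)"
      by (simp only: ac_simps)
    then show "exp (0 * -1 * (2 * (C + 1))) * prob {x \<in> space P. exit_time (-1) (2 * (C + 1)) \<tau> x < T}
      \<le> 1/2 * prob (before \<tau>)"
      using C0 by (subst (asm) mult_le_cancel_left_pos) auto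
  qed (use C0 in auto)
  then obtain r D where "0 < r" "expo (0 + r * (-1)) D" by blast
  then show ?thesis by (intro exI[of _ "0 + r * (-1)"] conjI exI[of _ D]) auto
qed

text \<open>An upward exit by \<open>K\<close> carries the weight \<open>exp K\<close>, which a
  Markov bound of order \<open>1 / K\<close> cannot beat. Instead a fixed share of the weight is
  kept from exiting. Exits by \<open>ln 4\<close> have at most a quarter of the probability of
  \<open>before \<tau>\<close>, and \<open>2 * (C + 1) \<le> |\<Delta>|\<close> at most a half. On
  the remaining quarter the density ratio is at least \<open>\<delta>\<close>, so exits carry at
  most the share \<open>1 - \<delta> / 4\<close>.\<close>

lemma bmo_imp_reverse_moment:
  assumes C: "bmo C" shows "\<exists>q>1. \<exists>D. expo q D"
proof -
  have C0: "0 \<le> C" using C by (simp add: bmo_def)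
  define \<delta> where "\<delta> = exp (- (2 * (C + 1)))"
  have \<delta>: "0 < \<delta>" "\<delta> \<le> 1" using C0 by (auto simp: \<delta>_def)
  have "\<exists>r>0. \<exists>D. expo (1 + r * 1) D"
  proof (rule exp_moment[where K = "ln 4" and \<kappa> = "1 - \<delta> / 4"])
    fix \<tau> assume \<tau>: "\<tau> \<in> ST"
    have l4: "0 < ln (4::real)" by simp
    let ?U = "exit_time 1 (ln 4) \<tau>" and ?\<Delta> = "\<lambda>x. L T x - at_time L \<tau> x"
    note U = exit_time[OF \<tau> l4, where e = 1]
    let ?B = "before \<tau>" and ?BU = "before ?U" 
    let ?G = "{x \<in> space P. 2 * (C + 1) \<le> \<bar>?\<Delta> x\<bar>}" and ?S = "?B - ?BU - {x \<in> space P. 2 * (C + 1) \<le> \<bar>?\<Delta> x\<bar>}"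
    note [measurable] = L_stopped_measurable[OF \<tau>] L_stopped_measurable[OF U(1)] less_T_sets[OF U(1)] less_T_sets[OF \<tau>]
    have sub: "?BU \<subseteq> ?B" using U(2) by (auto intro: le_less_trans)
    \<comment> \<open>At the exit the density has grown by exactly the factor 4, and its growth
      afterwards has conditional mean one.\<close>
    have ratio: "(\<integral>\<^sup>+x. ennreal (exp (?\<Delta> x)) * indicator ?BU x \<partial>P) = ennreal (4 * prob ?BU)"
    proof -
      have "(\<integral>\<^sup>+x. ennreal (exp (?\<Delta> x)) * indicator ?BU x \<partial>P)
         = (\<integral>\<^sup>+x. 4 * (ennreal (exp (L T x - at_time L ?U x)) * indicator ?BU x) \<partial>P)"
      proof (rule nn_integral_cong_AE)
        show "AE x in P. ennreal (exp (?\<Delta> x)) * indicator ?BU x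
          = 4 * (ennreal (exp (L T x - at_time L ?U x)) * indicator ?BU x)"
          using U(3)
        proof eventually_elim
          case (elim x)
          show ?case
          proof (cases "?U x < T")
            case True
            then have "?\<Delta> x = ln 4 + (L T x - at_time L ?U x)" using elim by simp
            moreover have "exp (ln 4 + w) = 4 * exp w" for w :: real by (simp add: exp_add)
            ultimately have "exp (?\<Delta> x) = 4 * exp (L T x - at_time L ?U x)" by (simp only:)
            then show ?thesis by (simp add: ennreal_mult indicator_def)
          qed simp
        qed
      qed
      also have "\<dots> = 4 * ennreal (prob ?BU)"
        using exp_L_ratio[OF U(1) sets_pre_sigma_less_T[OF U(1)]] by (subst nn_integral_cmult) auto
      finally show ?thesis by (simp add: ennreal_mult)
    qed
    have "ennreal (4 * prob ?BU + \<delta> * prob ?S)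
      = (\<integral>\<^sup>+x. ennreal (exp (?\<Delta> x)) * indicator ?BU x \<partial>P) + (\<integral>\<^sup>+x. ennreal \<delta> * indicator ?S x \<partial>P)"
      unfolding ratio using \<delta> by (subst nn_integral_cmult_indicator) (auto simp: emeasure_eq_measure ennreal_mult)
    also have "\<dots> = (\<integral>\<^sup>+x. ennreal (exp (?\<Delta> x)) * indicator ?BU x + ennreal \<delta> * indicator ?S x \<partial>P)"
      by (subst nn_integral_add) auto
    also have "\<dots> \<le> (\<integral>\<^sup>+x. ennreal (exp (?\<Delta> x)) * indicator ?B x \<partial>P)"
    proof (rule nn_integral_mono)
      fix x assume x: "x \<in> space P"
      show "ennreal (exp (?\<Delta> x)) * indicator ?BU x + ennreal \<delta> * indicator ?S x \<le> ennreal (exp (?\<Delta> x)) * indicator ?B x"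
      proof (cases "x \<in> ?S")
        case True
        then have "\<delta> \<le> exp (?\<Delta> x)" by (auto simp: \<delta>_def)
        then show ?thesis using True by (auto simp: ennreal_leI)
      next
        case False
        then show ?thesis using sub by (auto simp: indicator_def)
      qed
    qed
    also have "\<dots> = ennreal (prob ?B)" by (rule exp_L_ratio[OF \<tau> sets_pre_sigma_less_T[OF \<tau>]])
    finally have 1: "4 * prob ?BU + \<delta> * prob ?S \<le> prob ?B" by simp
    have "2 * (C + 1) * prob ?G \<le> (C + 1) * prob ?B"
      using L_increment_prob[OF C \<tau> T_ST STD(3)[OF \<tau>], of "2 * (C + 1)"] C0 by auto
    then have "(C + 1) * (2 * prob ?G) \<le> (C + 1) * prob ?B" by (simp only: ac_simps)
    then have 2: "2 * prob ?G \<le> prob ?B" using C0 by (subst (asm) mult_le_cancel_left_pos) auto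
    have "prob ?B \<le> prob (?BU \<union> ?G \<union> ?S)" by (intro finite_measure_mono) auto
    also have "\<dots> \<le> prob (?BU \<union> ?G) + prob ?S" by (rule measure_Un_le) auto
    also have "prob (?BU \<union> ?G) \<le> prob ?BU + prob ?G" by (rule measure_Un_le) auto
    finally have 3: "prob ?B \<le> prob ?BU + prob ?G + prob ?S" by simp
    have "0 \<le> \<delta> * prob ?S" using \<delta> by simp
    then have "4 * prob ?BU \<le> prob ?B" using 1 by linarith
    with 2 3 have "prob ?B / 4 \<le> prob ?S" by linarith
    then have "\<delta> * (prob ?B / 4) \<le> \<delta> * prob ?S" using \<delta> by (intro mult_left_mono) auto
    with 1 have "4 * prob ?BU \<le> prob ?B - \<delta> * (prob ?B / 4)" by linarith
    then show "exp (1 * 1 * ln 4) * prob ?BU \<le> (1 - \<delta> / 4) * prob ?B" by (simp add: left_diff_distrib)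
  qed (use \<delta> in auto)
  then obtain r D where "0 < r" "expo (1 + r * 1) D" by blast
  then show ?thesis by (intro exI[of _ "1 + r * 1"] conjI exI[of _ D]) auto
qed

text \<open>Up to a reducing time \<open>\<rho>\<close> the martingale part has mean zero, so the
  mean decrease of \<open>L\<close> is half the mean increase of \<open>A\<close>. The hypothesis
  concerns \<open>L T\<close> rather than \<open>L\<close> at \<open>\<rho>\<close>; the missing
  piece \<open>v\<close> is dominated by \<open>exp v - 1\<close>, which has mean zero on events
  known at \<open>\<rho>\<close>.\<close>

lemma negative_moment_imp_bmo:
  assumes q: "q < 0" and E: "expo q D"
  shows "bmo (2 * D / (- q))"
proof (rule bmoI)
  have D0: "0 \<le> D" using E by (simp add: expo_def)
  then show "0 \<le> 2 * D / (- q)" using q by (simp add: divide_nonneg_neg)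
  fix \<tau> assume \<tau>: "\<tau> \<in> ST"
  let ?p = "prob (before \<tau>)"
  define r where "r = - q"
  have r: "0 < r" using q by (simp add: r_def)
  have "(\<integral>\<^sup>+x. ennreal (A T x - at_time A \<tau> x) \<partial>P) \<le> ennreal (2 * D / r * ?p)"
  proof (rule increment_le_of_reduced[OF \<tau>])
    fix K \<rho> assume red: "reduces M A K \<rho>"
    let ?a = "\<lambda>\<tau> x. A (min (\<tau> x) (\<rho> x)) x" and ?m = "\<lambda>\<tau> x. M (min (\<tau> x) (\<rho> x)) x"
    have \<rho>: "\<rho> \<in> ST" by (rule reducesD(1)[OF red])
    let ?B = "{x \<in> space P. \<tau> x < \<rho> x}"
    have B: "?B \<in> sets (pre_sigma \<tau>)" "?B \<in> sets (pre_sigma \<rho>)"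
      by (rule sets_pre_sigma_less[OF \<tau> \<rho>], rule sets_pre_sigma_less_min[OF \<tau> \<rho>])
    have BP[measurable]: "?B \<in> sets P" by (rule sets_pre_sigma_P[OF \<tau> B(1)])
    note [measurable] = L_stopped_measurable[OF \<tau>] L_stopped_measurable[OF \<rho>]
    let ?e = "\<lambda>x. exp (q * (L T x - at_time L \<tau> x)) * indicator ?B x"
    let ?z = "\<lambda>x. exp (L T x - at_time L \<rho> x) * indicator ?B x"
    have ee: "ennreal (exp u) * indicator ?B x = ennreal (exp u * indicator ?B x)" for u x
      by (auto simp: indicator_def)
    have e_le: "(\<integral>\<^sup>+x. ennreal (?e x) \<partial>P) \<le> ennreal (D * prob ?B)"
    proof -
      have "(\<integral>\<^sup>+x. ennreal (exp (q * (L T x - at_time L \<tau> x))) * indicator ?B x \<partial>P) \<le> ennreal (D * prob ?B)"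
        using E \<tau> B(1) unfolding expo_def by blast
      then show ?thesis unfolding ee .
    qed
    have z_eq: "(\<integral>\<^sup>+x. ennreal (?z x) \<partial>P) = ennreal (prob ?B)"
      using exp_L_ratio[OF \<rho> B(2)] unfolding ee .
    have ei: "integrable P ?e"
      using e_le by (intro integrableI_nonneg) (auto intro: le_less_trans)
    have zi: "integrable P ?z"
      using z_eq by (intro integrableI_nonneg) auto
    have eI: "(\<integral>x. ?e x \<partial>P) \<le> D * prob ?B"
    proof -
      have "(\<integral>\<^sup>+x. ennreal (?e x) \<partial>P) = ennreal (\<integral>x. ?e x \<partial>P)" by (rule nn_integral_eq_integral[OF ei]) auto
      then show ?thesis using e_le D0 by (simp add: ennreal_le_iff)
    qed
    have zI: "(\<integral>x. ?z x \<partial>P) = prob ?B"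
    proof -
      have "(\<integral>\<^sup>+x. ennreal (?z x) \<partial>P) = ennreal (\<integral>x. ?z x \<partial>P)" by (rule nn_integral_eq_integral[OF zi]) auto
      moreover have "0 \<le> (\<integral>x. ?z x \<partial>P)" by (rule Bochner_Integration.integral_nonneg) auto
      ultimately show ?thesis using z_eq by (simp add: ennreal_inj)
    qed
    note I\<tau> = reduces_A_mart[OF red \<tau>] and IT = reduces_A_mart[OF red T_ST]
    have mI: "(\<integral>x. ?m (\<lambda>_. T) x \<partial>P) = (\<integral>x. ?m \<tau> x \<partial>P)"
      using martD(2)[OF reducesD(3)[OF red] \<tau>] martD(2)[OF reducesD(3)[OF red] T_ST] by simp
    have bi: "integrable P (indicator ?B :: 'a \<Rightarrow> real)" by (simp add: emeasure_eq_measure)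
    have "r * ((\<integral>x. ?a (\<lambda>_. T) x - ?a \<tau> x \<partial>P) / 2)
       = (\<integral>x. r * ((?a (\<lambda>_. T) x - ?a \<tau> x) / 2 - (?m (\<lambda>_. T) x - ?m \<tau> x)) \<partial>P)"
      using I\<tau> IT mI by simp
    also have "\<dots> \<le> (\<integral>x. ?e x - indicator ?B x + r * (?z x - indicator ?B x) \<partial>P)"
    proof (rule integral_mono)
      show "integrable P (\<lambda>x. r * ((?a (\<lambda>_. T) x - ?a \<tau> x) / 2 - (?m (\<lambda>_. T) x - ?m \<tau> x)))"
        using I\<tau> IT by auto
      show "integrable P (\<lambda>x. ?e x - indicator ?B x + r * (?z x - indicator ?B x))"
        using ei zi bi by auto
      fix x assume x: "x \<in> space P"
      show "r * ((?a (\<lambda>_. T) x - ?a \<tau> x) / 2 - (?m (\<lambda>_. T) x - ?m \<tau> x))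
         \<le> ?e x - indicator ?B x + r * (?z x - indicator ?B x)"
      proof (cases "\<tau> x < \<rho> x")
        case True
        have t: "min T (\<rho> x) = \<rho> x" "min (\<tau> x) (\<rho> x) = \<tau> x" using True STD(3)[OF \<rho> x] by auto
        define u v where "u = at_time L \<rho> x - at_time L \<tau> x" and "v = L T x - at_time L \<rho> x"
        define w where "w = exp (q * (u + v))"
        define y where "y = exp v"
        \<comment> \<open>The tangent inequality \<open>1 + t \<le> exp t\<close> serves twice, for
          \<open>v\<close> and for \<open>q * (u + v)\<close>; combining both with
          \<open>r = - q\<close> cancels \<open>v\<close> on the left.\<close>
        have "v \<le> y - 1" unfolding y_def using exp_ge_add_one_self[of v] by linarith
        then have "r * v \<le> r * (y - 1)" using r by (intro mult_left_mono) auto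
        moreover have "1 + q * (u + v) \<le> w" unfolding w_def by (rule exp_ge_add_one_self)
        ultimately have "r * (- u) \<le> w - 1 + r * (y - 1)" by (simp add: r_def algebra_simps)
        then have fin: "r * (- u) \<le> exp (q * (u + v)) - 1 + r * (exp v - 1)" by (simp only: w_def y_def)
        have inc: "(?a (\<lambda>_. T) x - ?a \<tau> x) / 2 - (?m (\<lambda>_. T) x - ?m \<tau> x) = - u"
          unfolding t by (simp add: u_def L_def field_simps)
        have uv: "L T x - at_time L \<tau> x = u + v" by (simp add: u_def v_def)
        have "indicator ?B x = (1::real)" using True x by simp
        then show ?thesis using fin unfolding inc uv v_def[symmetric] by simp
      next
        case False
        then have "min T (\<rho> x) = \<rho> x" "min (\<tau> x) (\<rho> x) = \<rho> x" using STD(3)[OF \<rho> x] by auto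
        then show ?thesis using False by simp
      qed
    qed
    also have "\<dots> = (\<integral>x. ?e x \<partial>P) - prob ?B + r * ((\<integral>x. ?z x \<partial>P) - prob ?B)"
      using ei zi bi by simp
    also have "\<dots> \<le> D * prob ?B" unfolding zI by (rule order_trans[OF _ eI]) simp
    also have "\<dots> \<le> D * ?p"
      using D0 less_T_sets[OF \<tau>] STD(3)[OF \<rho>] by (intro mult_left_mono finite_measure_mono) (auto intro: less_le_trans)
    finally show "(\<integral>x. A (min T (\<rho> x)) x - ?a \<tau> x \<partial>P) \<le> 2 * D / r * ?p"
      using r by (simp add: field_simps)
  qed
  then show "(\<integral>\<^sup>+x. ennreal (A T x - at_time A \<tau> x) \<partial>P) \<le> ennreal (2 * D / (- q) * ?p)"
    by (simp only: r_def)
qed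

end

section \<open>Change of measure\<close>

text \<open>Lagrange's form of the remainder, with the crude bound \<open>exp t \<le> 3\<close> for
  \<open>|t| \<le> 1\<close>.\<close>

lemma exp_taylor_bounds:
  fixes x :: real
  assumes "\<bar>x\<bar> \<le> 1"
  shows "\<bar>exp x - 1\<bar> \<le> 3 * \<bar>x\<bar>" "\<bar>exp x - 1 - x\<bar> \<le> 3 / 2 * x\<^sup>2" "\<bar>exp x - 1 - x - x\<^sup>2 / 2\<bar> \<le> \<bar>x\<bar> * x\<^sup>2 / 2"
proof -
  have e: "exp t \<le> 3" if "\<bar>t\<bar> \<le> \<bar>x\<bar>" for t
  proof -
    have "exp t \<le> exp 1" using that assms by simp
    then show ?thesis using exp_le by linarith
  qed
  obtain t where t: "\<bar>t\<bar> \<le> \<bar>x\<bar>" "exp x = (\<Sum>m<1. x ^ m / fact m) + exp t / fact 1 * x ^ 1"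
    using Maclaurin_exp_le by blast
  have "\<bar>exp x - 1\<bar> = exp t * \<bar>x\<bar>" using t(2) by (simp add: abs_mult)
  then show "\<bar>exp x - 1\<bar> \<le> 3 * \<bar>x\<bar>" using e[OF t(1)] by (simp add: mult_right_mono)
  obtain t where t: "\<bar>t\<bar> \<le> \<bar>x\<bar>" "exp x = (\<Sum>m<2. x ^ m / fact m) + exp t / fact 2 * x ^ 2"
    using Maclaurin_exp_le by blast
  have "\<bar>exp x - 1 - x\<bar> = exp t * (x\<^sup>2 / 2)" using t(2) by (simp add: abs_mult eval_nat_numeral)
  also have "\<dots> \<le> 3 * (x\<^sup>2 / 2)" by (rule mult_right_mono[OF e[OF t(1)]]) simp
  finally show "\<bar>exp x - 1 - x\<bar> \<le> 3 / 2 * x\<^sup>2" by simp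
  obtain t where t: "\<bar>t\<bar> \<le> \<bar>x\<bar>" "exp x = (\<Sum>m<3. x ^ m / fact m) + exp t / fact 3 * x ^ 3"
    using Maclaurin_exp_le by blast
  have "\<bar>exp x - 1 - x - x\<^sup>2 / 2\<bar> = exp t * (\<bar>x\<bar> * x\<^sup>2 / 6)" using t(2) by (simp add: abs_mult eval_nat_numeral)
  also have "\<dots> \<le> 3 * (\<bar>x\<bar> * x\<^sup>2 / 6)" by (rule mult_right_mono[OF e[OF t(1)]]) simp
  finally show "\<bar>exp x - 1 - x - x\<^sup>2 / 2\<bar> \<le> \<bar>x\<bar> * x\<^sup>2 / 2" by simp
qed

text \<open>
  Remainders of an expansion of Ito type: \<open>h\<close> and \<open>k\<close> stand for increments of \<open>M\<close> and \<open>\<langle>M\<rangle>\<close>, so that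
  \<open>h\<close> and \<open>h\<^sup>2 - k\<close> have conditional expectation zero up to a martingale increment.
\<close>

lemma exp_increment_bounds:
  fixes h k e :: real
  assumes h: "\<bar>h\<bar> \<le> e" and k: "0 \<le> k" "k \<le> e" and e: "e \<le> 1 / 2"
  shows "\<bar>exp (h - k / 2) - 1 - h - (h\<^sup>2 - k) / 2\<bar> \<le> 3 * e * (h\<^sup>2 + k)"
    "\<bar>exp (h - k / 2) * (k - h) + h + (h\<^sup>2 - k)\<bar> \<le> 8 * e * (h\<^sup>2 + k)"
    "\<bar>exp (h - k / 2) * ((k - h)\<^sup>2 - k) - (h\<^sup>2 - k)\<bar> \<le> 12 * e * (h\<^sup>2 + k)"
proof -
  define x where "x = h - k / 2"
  define S where "S = h\<^sup>2 + k"
  have e0: "0 \<le> e" using h by linarith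
  have S0: "0 \<le> S" and kS: "k \<le> S" using k by (auto simp: S_def)
  have x: "\<bar>x\<bar> \<le> 3 / 2 * e" using h k unfolding x_def by linarith
  then have x1: "\<bar>x\<bar> \<le> 1" using e by linarith
  have kk: "k\<^sup>2 \<le> k / 2" "k\<^sup>2 \<le> e * k"
    using k e mult_right_mono[of k "1/2" k] mult_right_mono[of k e k] by (auto simp: power2_eq_square)
  have hk: "\<bar>h * k\<bar> \<le> e * k" using h k by (simp add: abs_mult mult_right_mono)
  have "x\<^sup>2 + (h + k / 2)\<^sup>2 = 2 * h\<^sup>2 + k\<^sup>2 / 2" by (simp add: x_def power2_eq_square field_simps)
  then have "x\<^sup>2 \<le> 2 * h\<^sup>2 + k\<^sup>2 / 2" using zero_le_power2[of "h + k / 2"] by (metis le_add_same_cancel1)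
  also have "\<dots> \<le> 2 * S" using kk(1) k unfolding S_def by (simp add: field_simps)
  finally have x2: "x\<^sup>2 \<le> 2 * S" .
  have ekS: "e * k \<le> e * S" using e0 kS by (rule mult_left_mono[rotated])
  note T = exp_taylor_bounds[OF x1]
  have x3: "\<bar>x\<bar> * x\<^sup>2 \<le> 3 * (e * S)"
    using mult_mono[OF x x2] e0 by (simp add: ac_simps)
  have "exp x - 1 - h - (h\<^sup>2 - k) / 2 = (exp x - 1 - x - x\<^sup>2 / 2) + (k\<^sup>2 / 8 - h * k / 2)"
    by (simp add: x_def power2_eq_square field_simps)
  moreover have "\<bar>k\<^sup>2 / 8 - h * k / 2\<bar> \<le> e * S" using kk hk ekS zero_le_power2[of k] by linarith
  ultimately have "\<bar>exp x - 1 - h - (h\<^sup>2 - k) / 2\<bar> \<le> 3 * (e * S)" using T(3) x3 by linarith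
  then show "\<bar>exp (h - k / 2) - 1 - h - (h\<^sup>2 - k) / 2\<bar> \<le> 3 * e * (h\<^sup>2 + k)" by (simp add: x_def S_def mult.assoc)
  have eq2: "exp x * (k - h) + h + (h\<^sup>2 - k) = (exp x - 1 - x) * (k - h) + (3 / 2 * (h * k) - k\<^sup>2 / 2)"
    by (simp add: x_def power2_eq_square field_simps)
  have "\<bar>(exp x - 1 - x) * (k - h)\<bar> \<le> (3 / 2 * x\<^sup>2) * (2 * e)"
    unfolding abs_mult using h k by (intro mult_mono T(2)) auto
  also have "\<dots> \<le> 6 * (e * S)" using mult_left_mono[OF x2 e0] by (simp add: ac_simps)
  finally have "\<bar>exp x * (k - h) + h + (h\<^sup>2 - k)\<bar> \<le> 8 * (e * S)"
    unfolding eq2 using kk hk ekS zero_le_power2[of k] by linarith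
  then show "\<bar>exp (h - k / 2) * (k - h) + h + (h\<^sup>2 - k)\<bar> \<le> 8 * e * (h\<^sup>2 + k)" by (simp add: x_def S_def mult.assoc)
  have eq3: "exp x * ((k - h)\<^sup>2 - k) - (h\<^sup>2 - k) = (exp x - 1) * ((k - h)\<^sup>2 - k) + (k\<^sup>2 - 2 * (h * k))"
    by (simp add: power2_eq_square field_simps)
  have "0 \<le> (k + h)\<^sup>2" "0 \<le> (k - h)\<^sup>2" by simp_all
  then have "\<bar>(k - h)\<^sup>2 - k\<bar> \<le> 2 * S"
    using kk k unfolding S_def by (simp add: power2_eq_square abs_le_iff field_simps)
  then have "\<bar>(exp x - 1) * ((k - h)\<^sup>2 - k)\<bar> \<le> (9 / 2 * e) * (2 * S)"
    unfolding abs_mult using T(1) x e0 by (intro mult_mono) auto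
  also have "\<dots> = 9 * (e * S)" by simp
  finally have "\<bar>exp x * ((k - h)\<^sup>2 - k) - (h\<^sup>2 - k)\<bar> \<le> 12 * (e * S)"
    unfolding eq3 using kk hk ekS zero_le_power2[of k] by linarith
  then show "\<bar>exp (h - k / 2) * ((k - h)\<^sup>2 - k) - (h\<^sup>2 - k)\<bar> \<le> 12 * e * (h\<^sup>2 + k)" by (simp add: x_def S_def mult.assoc)
qed

section \<open>An Ito formula in expectation for bounded pairs\<close>

locale bounded_pair = increasing_pair P F T X Y
  for P :: "'a measure" and F T X Y +
  fixes K :: real
  assumes red: "reduces X Y K (\<lambda>_. T)"
begin

lemma T_in_ST: "(\<lambda>_. T) \<in> ST"
  by (rule reducesD(1)[OF red])

lemma stopped_bounds:
  assumes \<tau>: "\<tau> \<in> ST"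
  shows "AE x in P. \<bar>at_time X \<tau> x\<bar> \<le> K \<and> 0 \<le> at_time Y \<tau> x \<and> at_time Y \<tau> x \<le> K"
  using reduces_stopped_bounds[OF red \<tau>] AE_space
  by eventually_elim (use STD(3)[OF \<tau>] in \<open>simp add: min_absorb1\<close>)

lemma X_mart: "mart X"
  by (rule mart_cong_AE[OF reducesD(3)[OF red] M_cont]) (simp add: min_absorb1)

lemma N_mart: "mart (\<lambda>t x. (X t x)\<^sup>2 - Y t x)" and N_cont: "cont_adapted (\<lambda>t x. (X t x)\<^sup>2 - Y t x)"
proof -
  have "cont_adapted (\<lambda>t x. (X t x)\<^sup>2)"
    by (rule cont_adapted_comp[OF M_cont]) (auto intro!: continuous_intros)
  from cont_adapted_diff[OF this A_cont] show c: "cont_adapted (\<lambda>t x. (X t x)\<^sup>2 - Y t x)" .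
  show "mart (\<lambda>t x. (X t x)\<^sup>2 - Y t x)"
    by (rule mart_cong_AE[OF reducesD(4)[OF red] c]) (simp add: min_absorb1)
qed

lemma increment:
  assumes \<tau>: "\<tau> \<in> ST" "\<sigma> \<in> ST" "\<And>x. x \<in> space P \<Longrightarrow> \<tau> x \<le> \<sigma> x"
  shows "(\<integral>x. (at_time X \<sigma> x - at_time X \<tau> x)\<^sup>2 \<partial>P) = (\<integral>x. at_time Y \<sigma> x - at_time Y \<tau> x \<partial>P)"
    and "integrable P (\<lambda>x. (at_time X \<sigma> x - at_time X \<tau> x)\<^sup>2)"
    and "integrable P (at_time Y \<tau>)"
proof -
  have t: "min (\<tau> x) T = \<tau> x" "min (\<sigma> x) T = \<sigma> x" if "x \<in> space P" for x
    using STD(3)[OF \<tau>(1) that] STD(3)[OF \<tau>(2) that] by (auto simp: min_absorb1)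
  note r = reduced_increment[OF red \<tau>]
  have "(\<integral>x. (at_time X \<sigma> x - at_time X \<tau> x)\<^sup>2 \<partial>P) = (\<integral>x. (X (min (\<sigma> x) T) x - X (min (\<tau> x) T) x)\<^sup>2 \<partial>P)"
    by (rule Bochner_Integration.integral_cong) (simp_all add: t)
  also have "\<dots> = (\<integral>x. Y (min (\<sigma> x) T) x - Y (min (\<tau> x) T) x \<partial>P)" by (rule r(1))
  also have "\<dots> = (\<integral>x. at_time Y \<sigma> x - at_time Y \<tau> x \<partial>P)"
    by (rule Bochner_Integration.integral_cong) (simp_all add: t)
  finally show "(\<integral>x. (at_time X \<sigma> x - at_time X \<tau> x)\<^sup>2 \<partial>P) = (\<integral>x. at_time Y \<sigma> x - at_time Y \<tau> x \<partial>P)" .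
  show "integrable P (\<lambda>x. (at_time X \<sigma> x - at_time X \<tau> x)\<^sup>2)"
    using r(2) by (subst Bochner_Integration.integrable_cong[OF refl]) (simp_all add: t)
  show "integrable P (at_time Y \<tau>)"
    using reduces_A_mart(1)[OF red \<tau>(1)] by (subst Bochner_Integration.integrable_cong[OF refl]) (simp_all add: t)
qed

definition osc :: "('a \<Rightarrow> real) \<Rightarrow> real \<Rightarrow> 'a \<Rightarrow> real" where
  "osc \<tau> t x = max \<bar>X t x - X (min t (\<tau> x)) x\<bar> \<bar>Y t x - Y (min t (\<tau> x)) x\<bar>"

text \<open>A partition of \<open>[0,T]\<close> that follows the path: a stage ends once
  \<open>X\<close> or \<open>Y\<close> has moved by \<open>e\<close> since the stage began, or at
  \<open>T\<close>. Increments are thus at most \<open>e\<close> almost surely, and the Taylor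
  remainder can be bounded uniformly.\<close>

primrec stage :: "real \<Rightarrow> nat \<Rightarrow> 'a \<Rightarrow> real" where
  "stage e 0 = (\<lambda>_. 0)"
| "stage e (Suc n) = hit (osc (stage e n)) e"

lemma osc_cont:
  assumes \<tau>: "\<tau> \<in> ST" shows "cont_adapted (osc \<tau>)"
proof -
  have "cont_adapted (\<lambda>t x. \<bar>Z t x - Z (min t (\<tau> x)) x\<bar>)" if "cont_adapted Z" for Z
    by (rule cont_adapted_comp[OF cont_adapted_diff[OF that cont_adapted_stopped[OF that \<tau>]]])
       (auto intro!: continuous_intros)
  from cont_adapted_max[OF this[OF M_cont] this[OF A_cont]] show ?thesis unfolding osc_def[abs_def] .
qed

lemma stage_ST: "stage e n \<in> ST"
proof (induction n)
  case 0
  show ?case using T_pos by (simp add: const_ST)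
next
  case (Suc n)
  then show ?case by (simp add: hit_ST osc_cont)
qed

lemma stage_mono: assumes "0 < e" "x \<in> space P" shows "stage e n x \<le> stage e (Suc n) x"
proof -
  have "osc (stage e n) t x < e" if "t < stage e n x" for t
    using that assms(1) by (simp add: osc_def min_absorb1)
  then have "stage e n x \<le> t" if "e \<le> osc (stage e n) t x" for t
    using that by (meson not_less)
  then show ?thesis
    using STD(3)[OF stage_ST assms(2), of e n] unfolding stage.simps hit_def
    by (intro cInf_greatest) blast+
qed

lemma stage_osc_le:
  assumes e: "0 < e"
  shows "AE x in P. \<bar>at_time X (stage e (Suc n)) x - at_time X (stage e n) x\<bar> \<le> e
    \<and> \<bar>at_time Y (stage e (Suc n)) x - at_time Y (stage e n) x\<bar> \<le> e"
  using cont_adapted_cont[OF osc_cont[OF stage_ST[of e n]]] AE_space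
proof eventually_elim
  case (elim x)
  have "osc (stage e n) 0 x \<le> e" using STD(2)[OF stage_ST elim(2), of e n] e by (simp add: osc_def min_absorb1)
  from le_until_hit[of "osc (stage e n)" x e, OF elim(1) this hit_bounds(1) order_refl]
  have "osc (stage e n) (stage e (Suc n) x) x \<le> e" by simp
  then show ?case using stage_mono[OF e elim(2), of n] by (simp add: osc_def min_absorb2 del: stage.simps)
qed

text \<open>Infinitely many proper stages would converge to a point of \<open>[0,T]\<close>, where
  continuity makes the moves between consecutive stages tend to 0, although each of them is at least
  \<open>e\<close>.\<close>

lemma stage_eventually_T:
  assumes e: "0 < e"
  shows "AE x in P. \<forall>\<^sub>F n in sequentially. stage e n x = T"
proof -
  have oc: "AE x in P. \<forall>n. continuous_on {0..T} (\<lambda>t. osc (stage e n) t x)"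
    by (intro AE_all_countable[THEN iffD2] allI cont_adapted_cont osc_cont stage_ST)
  show ?thesis
    using oc cont_adapted_cont[OF M_cont] cont_adapted_cont[OF A_cont] AE_space
  proof eventually_elim
    case (elim x)
    let ?p = "\<lambda>n. stage e n x"
    have mono: "incseq ?p"
      by (rule incseq_SucI) (rule stage_mono[OF e elim(4)])
    have le: "0 \<le> ?p n" "?p n \<le> T" for n using STD(2,3)[OF stage_ST elim(4), of e n] by auto
    show ?case
    proof (cases "\<exists>n. ?p n = T")
      case True
      then obtain n where n: "?p n = T" by blast
      have "?p m = T" if "n \<le> m" for m using incseqD[OF mono that] n le(2)[of m] by simp
      then show ?thesis by (auto simp: eventually_sequentially)
    next
      case False
      have lt: "?p n < T" for n using False le(2)[of n] by (metis le_less)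
      obtain l where l: "?p \<longlonglongrightarrow> l" using incseq_convergent[OF mono, of T] le(2) by blast
      have l01: "l \<in> {0..T}" using LIMSEQ_le_const[OF l, of 0] LIMSEQ_le_const2[OF l, of T] le by auto
      have conv: "(\<lambda>n. \<bar>W (?p (Suc n)) x - W (?p n) x\<bar>) \<longlonglongrightarrow> 0" if W: "continuous_on {0..T} (\<lambda>t. W t x)" for W :: "real \<Rightarrow> 'a \<Rightarrow> real"
      proof -
        have w: "(\<lambda>n. W (?p n) x) \<longlonglongrightarrow> W l x"
          by (rule continuous_on_tendsto_compose[OF W l l01]) (use le in auto)
        show ?thesis using tendsto_rabs[OF tendsto_diff[OF LIMSEQ_Suc[OF w] w]] by simp
      qed
      have "(\<lambda>n. max \<bar>X (?p (Suc n)) x - X (?p n) x\<bar> \<bar>Y (?p (Suc n)) x - Y (?p n) x\<bar>) \<longlonglongrightarrow> max 0 0"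
        by (rule tendsto_max[OF conv[of X, OF elim(2)] conv[of Y, OF elim(3)]])
      moreover have "e \<le> max \<bar>X (?p (Suc n)) x - X (?p n) x\<bar> \<bar>Y (?p (Suc n)) x - Y (?p n) x\<bar>" for n
      proof -
        have "hit (osc (stage e n)) e x < T" using lt[of "Suc n"] by simp
        from hit_less_T[of "osc (stage e n)" x, OF elim(1)[rule_format] this]
        have "e \<le> osc (stage e n) (?p (Suc n)) x" by simp
        then show ?thesis using stage_mono[OF e elim(4), of n] by (simp add: osc_def min_absorb2 del: stage.simps)
      qed
      ultimately have "e \<le> max 0 0" by (intro LIMSEQ_le_const) auto
      then show ?thesis using e by simp
    qed
  qed
qed

lemma K_nonneg: "0 \<le> K"
proof -
  have "AE x in P. 0 \<le> K" using stopped_bounds[OF T_in_ST] by (rule eventually_mono) linarith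
  then show ?thesis by simp
qed

text \<open>The stopped pair lives in the compact rectangle \<open>{-K..K} \<times> {0..K}\<close>,
  so one bound serves all stopping times.\<close>

lemma stopped_function:
  assumes g: "continuous_on UNIV (\<lambda>p. g (fst p) (snd p) :: real)" and \<tau>: "\<tau> \<in> ST"
  shows "(\<lambda>x. g (at_time X \<tau> x) (at_time Y \<tau> x)) \<in> borel_measurable (pre_sigma \<tau>)"
    "(\<lambda>x. g (at_time X \<tau> x) (at_time Y \<tau> x)) \<in> borel_measurable P"
    "\<exists>B. \<forall>\<tau>\<in>ST. AE x in P. \<bar>g (at_time X \<tau> x) (at_time Y \<tau> x)\<bar> \<le> B"
proof -
  show m: "(\<lambda>x. g (at_time X \<tau> x) (at_time Y \<tau> x)) \<in> borel_measurable (pre_sigma \<tau>)"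
    by (rule borel_measurable_continuous_Pair[OF stopped_measurable_pre_sigma[OF M_cont \<tau>]
          stopped_measurable_pre_sigma[OF A_cont \<tau>] g])
  then show "(\<lambda>x. g (at_time X \<tau> x) (at_time Y \<tau> x)) \<in> borel_measurable P"
    by (rule measurable_pre_sigma_P[OF \<tau>])
  have "compact ((\<lambda>p. g (fst p) (snd p)) ` ({-K..K} \<times> {0..K}))"
    by (intro compact_continuous_image continuous_on_subset[OF g] compact_Times) auto
  then obtain B where B: "\<And>y. y \<in> (\<lambda>p. g (fst p) (snd p)) ` ({-K..K} \<times> {0..K}) \<Longrightarrow> \<bar>y\<bar> \<le> B"
    using compact_imp_bounded bounded_iff real_norm_def by metis
  have "AE x in P. \<bar>g (at_time X \<sigma> x) (at_time Y \<sigma> x)\<bar> \<le> B" if "\<sigma> \<in> ST" for \<sigma>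
    using stopped_bounds[OF that]
  proof eventually_elim
    case (elim x)
    then have "(at_time X \<sigma> x, at_time Y \<sigma> x) \<in> {-K..K} \<times> {0..K}" by auto
    from imageI[OF this, of "\<lambda>p. g (fst p) (snd p)"] show ?case by (intro B) simp
  qed
  then show "\<exists>B. \<forall>\<tau>\<in>ST. AE x in P. \<bar>g (at_time X \<tau> x) (at_time Y \<tau> x)\<bar> \<le> B" by blast
qed

lemma stopped_function_integrable:
  assumes g: "continuous_on UNIV (\<lambda>p. g (fst p) (snd p) :: real)" and \<tau>: "\<tau> \<in> ST"
  shows "integrable P (\<lambda>x. g (at_time X \<tau> x) (at_time Y \<tau> x))"
proof -
  obtain B where "AE x in P. \<bar>g (at_time X \<tau> x) (at_time Y \<tau> x)\<bar> \<le> B" using stopped_function(3)[OF g \<tau>] \<tau> by blast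
  then show ?thesis by (intro integrable_const_bound[of _ B] stopped_function(2)[OF g \<tau>]) simp
qed

text \<open>With \<open>h\<close> and \<open>k\<close> the increments of \<open>X\<close> and
  \<open>Y\<close>, \<open>h\<^sup>2 - k\<close> is the increment of the martingale
  \<open>X\<^sup>2 - Y\<close> minus \<open>2 * h\<close> times \<open>X\<close> at
  \<open>\<tau>\<close>; this correction explains \<open>g1\<close>. The leading terms therefore
  integrate to zero. The remainder is left, and since \<open>h\<^sup>2\<close> and \<open>k\<close>
  have equal means, it gives the factor 2.\<close>

lemma ito_step:
  fixes f D1 D2 :: "real \<Rightarrow> real \<Rightarrow> real"
  assumes f: "continuous_on UNIV (\<lambda>p. f (fst p) (snd p))"
    and D1: "continuous_on UNIV (\<lambda>p. D1 (fst p) (snd p))" and D2: "continuous_on UNIV (\<lambda>p. D2 (fst p) (snd p))"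
    and c: "0 \<le> c"
    and taylor: "\<And>m a h k. \<bar>m\<bar> \<le> K \<Longrightarrow> 0 \<le> a \<Longrightarrow> a \<le> K \<Longrightarrow> \<bar>h\<bar> \<le> e \<Longrightarrow> 0 \<le> k \<Longrightarrow> k \<le> e \<Longrightarrow>
      \<bar>f (m + h) (a + k) - f m a - D1 m a * h - D2 m a * (h\<^sup>2 - k)\<bar> \<le> c * (h\<^sup>2 + k)"
    and \<tau>: "\<tau> \<in> ST" "\<sigma> \<in> ST" "\<And>x. x \<in> space P \<Longrightarrow> \<tau> x \<le> \<sigma> x"
    and small: "AE x in P. \<bar>at_time X \<sigma> x - at_time X \<tau> x\<bar> \<le> e \<and> \<bar>at_time Y \<sigma> x - at_time Y \<tau> x\<bar> \<le> e"
  shows "\<bar>(\<integral>x. f (at_time X \<sigma> x) (at_time Y \<sigma> x) \<partial>P) - (\<integral>x. f (at_time X \<tau> x) (at_time Y \<tau> x) \<partial>P)\<bar>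
    \<le> 2 * c * ((\<integral>x. at_time Y \<sigma> x \<partial>P) - (\<integral>x. at_time Y \<tau> x \<partial>P))"
proof -
  let ?N = "\<lambda>t x. (X t x)\<^sup>2 - Y t x"
  let ?f = "\<lambda>\<tau> x. f (at_time X \<tau> x) (at_time Y \<tau> x)"
  define g1 where "g1 x = D1 (at_time X \<tau> x) (at_time Y \<tau> x) - 2 * D2 (at_time X \<tau> x) (at_time Y \<tau> x) * at_time X \<tau> x" for x
  define g2 where "g2 x = D2 (at_time X \<tau> x) (at_time Y \<tau> x)" for x
  have c1: "continuous_on UNIV (\<lambda>p. D1 (fst p) (snd p) - 2 * D2 (fst p) (snd p) * fst p)"
    by (intro continuous_intros D1 D2)
  obtain B1 where B1: "AE x in P. \<bar>g1 x\<bar> \<le> B1"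
    using stopped_function(3)[of "\<lambda>m a. D1 m a - 2 * D2 m a * m", OF c1 \<tau>(1)] \<tau>(1) unfolding g1_def by blast
  obtain B2 where B2: "AE x in P. \<bar>g2 x\<bar> \<le> B2"
    using stopped_function(3)[OF D2 \<tau>(1)] \<tau>(1) unfolding g2_def by blast
  have g1: "g1 \<in> borel_measurable (pre_sigma \<tau>)"
    using stopped_function(1)[of "\<lambda>m a. D1 m a - 2 * D2 m a * m", OF c1 \<tau>(1)] unfolding g1_def[abs_def] .
  have g2: "g2 \<in> borel_measurable (pre_sigma \<tau>)"
    using stopped_function(1)[OF D2 \<tau>(1)] unfolding g2_def[abs_def] .
  have wX: "(\<integral>x. g1 x * at_time X \<sigma> x \<partial>P) = (\<integral>x. g1 x * at_time X \<tau> x \<partial>P)" "integrable P (\<lambda>x. g1 x * at_time X \<sigma> x)"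
    by (rule mart_weighted[OF X_mart M_cont \<tau> g1 B1], assumption)+
  have wX': "integrable P (\<lambda>x. g1 x * at_time X \<tau> x)"
    by (rule mart_weighted(2)[OF X_mart M_cont \<tau>(1) \<tau>(1) order_refl g1 B1])
  have wN: "(\<integral>x. g2 x * at_time ?N \<sigma> x \<partial>P) = (\<integral>x. g2 x * at_time ?N \<tau> x \<partial>P)" "integrable P (\<lambda>x. g2 x * at_time ?N \<sigma> x)"
    by (rule mart_weighted[OF N_mart N_cont \<tau> g2 B2], assumption)+
  have wN': "integrable P (\<lambda>x. g2 x * at_time ?N \<tau> x)"
    by (rule mart_weighted(2)[OF N_mart N_cont \<tau>(1) \<tau>(1) order_refl g2 B2])
  note fi = stopped_function_integrable[OF f \<tau>(1)] stopped_function_integrable[OF f \<tau>(2)]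
  define R where "R x = ?f \<sigma> x - ?f \<tau> x - (g1 x * at_time X \<sigma> x - g1 x * at_time X \<tau> x)
     - (g2 x * at_time ?N \<sigma> x - g2 x * at_time ?N \<tau> x)" for x
  have Ri: "integrable P R" and RI: "(\<integral>x. R x \<partial>P) = (\<integral>x. ?f \<sigma> x \<partial>P) - (\<integral>x. ?f \<tau> x \<partial>P)"
    unfolding R_def[abs_def] using fi wX wX' wN wN' by simp_all
  have Yi: "integrable P (at_time Y \<tau>)" "integrable P (at_time Y \<sigma>)"
    by (rule increment(3)[OF \<tau>(1) \<tau>(1) order_refl], rule increment(3)[OF \<tau>(2) \<tau>(2) order_refl])
  have Xi: "integrable P (\<lambda>x. (at_time X \<sigma> x - at_time X \<tau> x)\<^sup>2)" by (rule increment(2)[OF \<tau>])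
  have "\<bar>\<integral>x. R x \<partial>P\<bar> \<le> (\<integral>x. c * ((at_time X \<sigma> x - at_time X \<tau> x)\<^sup>2 + (at_time Y \<sigma> x - at_time Y \<tau> x)) \<partial>P)"
  proof (rule order_trans[OF integral_abs_bound integral_mono_AE])
    show "integrable P (\<lambda>x. c * ((at_time X \<sigma> x - at_time X \<tau> x)\<^sup>2 + (at_time Y \<sigma> x - at_time Y \<tau> x)))"
      using Yi Xi by simp
    have mono: "AE x in P. at_time Y \<tau> x \<le> at_time Y \<sigma> x" by (rule A_stopped_mono[OF \<tau>])
    show "AE x in P. \<bar>R x\<bar> \<le> c * ((at_time X \<sigma> x - at_time X \<tau> x)\<^sup>2 + (at_time Y \<sigma> x - at_time Y \<tau> x))"
      using small stopped_bounds[OF \<tau>(1)] mono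
    proof eventually_elim
      case (elim x)
      define h k where "h = at_time X \<sigma> x - at_time X \<tau> x" and "k = at_time Y \<sigma> x - at_time Y \<tau> x"
      have s: "at_time X \<sigma> x = at_time X \<tau> x + h" "at_time Y \<sigma> x = at_time Y \<tau> x + k" by (simp_all add: h_def k_def)
      have "R x = f (at_time X \<tau> x + h) (at_time Y \<tau> x + k) - f (at_time X \<tau> x) (at_time Y \<tau> x)
        - D1 (at_time X \<tau> x) (at_time Y \<tau> x) * h - D2 (at_time X \<tau> x) (at_time Y \<tau> x) * (h\<^sup>2 - k)"
        unfolding R_def s g1_def g2_def by (simp add: power2_eq_square algebra_simps)
      also have "\<bar>\<dots>\<bar> \<le> c * (h\<^sup>2 + k)"
        using elim by (intro taylor) (auto simp: h_def k_def)
      finally show ?case by (simp add: h_def k_def)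
    qed
  qed (use Ri in simp)
  also have "\<dots> = 2 * c * ((\<integral>x. at_time Y \<sigma> x \<partial>P) - (\<integral>x. at_time Y \<tau> x \<partial>P))"
    using Yi Xi increment(1)[OF \<tau>] by simp
  finally show ?thesis unfolding RI .
qed

text \<open>Opposite coefficients of \<open>h\<^sup>2\<close> and \<open>k\<close> encode the
  equation \<open>f_a + f_mm / 2 = 0\<close>, that is, absence of drift. Summing the step over the
  stages telescopes to at most \<open>2 * C * K * e\<close>, and \<open>e\<close> is
  arbitrary.\<close>

lemma ito:
  fixes f D1 D2 :: "real \<Rightarrow> real \<Rightarrow> real"
  assumes f: "continuous_on UNIV (\<lambda>p. f (fst p) (snd p))"
    and D1: "continuous_on UNIV (\<lambda>p. D1 (fst p) (snd p))" and D2: "continuous_on UNIV (\<lambda>p. D2 (fst p) (snd p))"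
    and C: "0 \<le> C"
    and taylor: "\<And>m a h k e. \<bar>m\<bar> \<le> K \<Longrightarrow> 0 \<le> a \<Longrightarrow> a \<le> K \<Longrightarrow> \<bar>h\<bar> \<le> e \<Longrightarrow> 0 \<le> k \<Longrightarrow> k \<le> e \<Longrightarrow> e \<le> 1 / 2 \<Longrightarrow>
      \<bar>f (m + h) (a + k) - f m a - D1 m a * h - D2 m a * (h\<^sup>2 - k)\<bar> \<le> C * e * (h\<^sup>2 + k)"
  shows "(\<integral>x. f (X T x) (Y T x) \<partial>P) = f 0 0"
proof -
  let ?E = "\<lambda>\<tau>. \<integral>x. f (at_time X \<tau> x) (at_time Y \<tau> x) \<partial>P"
  have main: "\<bar>(\<integral>x. f (X T x) (Y T x) \<partial>P) - f 0 0\<bar> \<le> 2 * C * K * e" if e: "0 < e" "e \<le> 1 / 2" for e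
  proof -
    have st: "\<bar>?E (stage e (Suc n)) - ?E (stage e n)\<bar>
       \<le> 2 * (C * e) * ((\<integral>x. at_time Y (stage e (Suc n)) x \<partial>P) - (\<integral>x. at_time Y (stage e n) x \<partial>P))" for n
      by (rule ito_step[OF f D1 D2 _ taylor stage_ST stage_ST stage_mono[OF e(1)] stage_osc_le[OF e(1)]]) (use C e in auto)
    have f0: "?E (stage e 0) = f 0 0" and Y0: "(\<integral>x. at_time Y (stage e 0) x \<partial>P) = 0"
    proof -
      have "?E (stage e 0) = (\<integral>x. f 0 0 \<partial>P)"
      proof (rule integral_cong_AE)
        show "AE x in P. f (at_time X (stage e 0) x) (at_time Y (stage e 0) x) = f 0 0"
          using M_0 A_0 by eventually_elim simp
      qed (use stopped_function(2)[OF f stage_ST[of e 0]] in simp_all)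
      also have "\<dots> = f 0 0" by (simp add: prob_space)
      finally show "?E (stage e 0) = f 0 0" .
      have "(\<integral>x. at_time Y (stage e 0) x \<partial>P) = (\<integral>x. 0 \<partial>P)"
        using A_0 by (intro integral_cong_AE stopped_measurable[OF A_cont stage_ST]) auto
      also have "\<dots> = 0" by simp
      finally show "(\<integral>x. at_time Y (stage e 0) x \<partial>P) = 0" .
    qed
    have tel: "\<bar>?E (stage e n) - f 0 0\<bar> \<le> 2 * (C * e) * (\<integral>x. at_time Y (stage e n) x \<partial>P)" for n
    proof (induction n)
      case 0
      show ?case unfolding f0 Y0 by simp
    next
      case (Suc n)
      have "2 * (C * e) * (\<integral>x. at_time Y (stage e (Suc n)) x \<partial>P)
         = 2 * (C * e) * ((\<integral>x. at_time Y (stage e (Suc n)) x \<partial>P) - (\<integral>x. at_time Y (stage e n) x \<partial>P))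
           + 2 * (C * e) * (\<integral>x. at_time Y (stage e n) x \<partial>P)"
        by (simp add: right_diff_distrib)
      then show ?case using st[of n] Suc.IH by linarith
    qed
    have YK: "(\<integral>x. at_time Y \<tau> x \<partial>P) \<le> K" if "\<tau> \<in> ST" for \<tau>
    proof -
      have "(\<integral>x. at_time Y \<tau> x \<partial>P) \<le> (\<integral>x. K \<partial>P)"
      proof (rule integral_mono_AE[OF increment(3)[OF that that order_refl]])
        show "AE x in P. at_time Y \<tau> x \<le> K" using stopped_bounds[OF that] by (rule eventually_mono) simp
      qed simp
      then show ?thesis by (simp add: prob_space)
    qed
    have bd: "\<bar>?E (stage e n) - f 0 0\<bar> \<le> 2 * C * K * e" for n
    proof -
      have "2 * (C * e) * (\<integral>x. at_time Y (stage e n) x \<partial>P) \<le> 2 * (C * e) * K"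
        using C e by (intro mult_left_mono YK stage_ST) auto
      then show ?thesis using tel[of n] by (simp add: ac_simps)
    qed
    obtain B where B: "\<And>\<tau>. \<tau> \<in> ST \<Longrightarrow> AE x in P. \<bar>f (at_time X \<tau> x) (at_time Y \<tau> x)\<bar> \<le> B"
      using stopped_function(3)[OF f T_in_ST] by blast
    have "(\<lambda>n. ?E (stage e n)) \<longlonglongrightarrow> (\<integral>x. f (X T x) (Y T x) \<partial>P)"
    proof (rule integral_dominated_convergence[where w = "\<lambda>_. B"])
      show "(\<lambda>x. f (X T x) (Y T x)) \<in> borel_measurable P" by (rule stopped_function(2)[OF f T_in_ST])
      show "(\<lambda>x. f (at_time X (stage e n) x) (at_time Y (stage e n) x)) \<in> borel_measurable P" for n
        by (rule stopped_function(2)[OF f stage_ST])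
      show "AE x in P. norm (f (at_time X (stage e n) x) (at_time Y (stage e n) x)) \<le> B" for n
        using B[OF stage_ST] by simp
      show "AE x in P. (\<lambda>n. f (at_time X (stage e n) x) (at_time Y (stage e n) x)) \<longlonglongrightarrow> f (X T x) (Y T x)"
        using stage_eventually_T[OF e(1)]
      proof eventually_elim
        case (elim x)
        show ?case by (rule tendsto_eventually) (use elim in eventually_elim, simp)
      qed
    qed simp
    from tendsto_rabs[OF tendsto_diff[OF this tendsto_const[of "f 0 0"]]] show ?thesis
      by (rule LIMSEQ_le_const2) (use bd in auto)
  qed
  have "\<bar>(\<integral>x. f (X T x) (Y T x) \<partial>P) - f 0 0\<bar> \<le> 0 + d" if "0 < d" for d
  proof -
    define e where "e = min (1 / 2) (d / (2 * C * K + 1))"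
    have CK: "0 \<le> 2 * C * K" using C K_nonneg by simp
    have e: "e \<le> 1 / 2" "e \<le> d / (2 * C * K + 1)"
      unfolding e_def by (rule min.cobounded1, rule min.cobounded2)
    have e0: "0 < e" using that CK by (simp add: e_def)
    have "2 * C * K * e \<le> (2 * C * K + 1) * e" using e0 by (simp add: distrib_right)
    also have "\<dots> \<le> d" using e(2) pos_le_divide_eq[of "2 * C * K + 1" e d] CK by (simp only: mult.commute)
    finally show ?thesis using main[OF e0 e(1)] by linarith
  qed
  then have "\<bar>(\<integral>x. f (X T x) (Y T x) \<partial>P) - f 0 0\<bar> \<le> 0" by (rule field_le_epsilon)
  then show ?thesis by simp
qed

text \<open>The factor \<open>exp (X T - Y T / 2)\<close> is the density, so the claims say that
  \<open>Y - X\<close> and \<open>(Y - X)\<^sup>2 - Y\<close> have mean zero at \<open>T\<close>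
  under the new measure.\<close>

lemma ito_exponential:
  shows "(\<integral>x. exp (X T x - Y T x / 2) * (Y T x - X T x) \<partial>P) = 0"
    and "(\<integral>x. exp (X T x - Y T x / 2) * ((Y T x - X T x)\<^sup>2 - Y T x) \<partial>P) = 0"
proof -
  have z: "exp (m - a / 2) \<le> exp K" if "\<bar>m\<bar> \<le> K" "0 \<le> a" for m a :: real using that by simp
  have "(\<integral>x. exp (X T x - Y T x / 2) * (Y T x - X T x) \<partial>P) = exp (0 - 0 / 2) * (0 - 0)"
  \<comment> \<open>\<open>D1\<close> is the derivative of \<open>f\<close> in \<open>m\<close> and
    \<open>D2\<close> minus its derivative in \<open>a\<close>. In \<open>C\<close> the increment
    bound 3 is weighted by \<open>|a - m| \<le> 2 * K\<close>, the bound 8 by 1, and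
    \<open>exp K\<close> bounds the density.\<close>
  proof (rule ito[where f = "\<lambda>m a. exp (m - a / 2) * (a - m)"
        and ?D1.0 = "\<lambda>m a. exp (m - a / 2) * (a - m - 1)" and ?D2.0 = "\<lambda>m a. exp (m - a / 2) * ((a - m) / 2 - 1)"
        and C = "exp K * (2 * K * 3 + 8)"])
    show "0 \<le> exp K * (2 * K * 3 + 8)" using K_nonneg by simp
    fix m a h k e :: real
    assume A: "\<bar>m\<bar> \<le> K" "0 \<le> a" "a \<le> K" "\<bar>h\<bar> \<le> e" "0 \<le> k" "k \<le> e" "e \<le> 1 / 2"
    note b = exp_increment_bounds[OF A(4-7)]
    define y E S where "y = a - m" and "E = exp (h - k / 2)" and "S = h\<^sup>2 + k"
    have y: "\<bar>y\<bar> \<le> 2 * K" using A by (simp add: y_def)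
    have ex: "exp (m + h - (a + k) / 2) = exp (m - a / 2) * E" by (simp add: E_def exp_add[symmetric] field_simps)
    show "\<bar>exp (m + h - (a + k) / 2) * (a + k - (m + h)) - exp (m - a / 2) * (a - m) - exp (m - a / 2) * (a - m - 1) * h
       - exp (m - a / 2) * ((a - m) / 2 - 1) * (h\<^sup>2 - k)\<bar> \<le> exp K * (2 * K * 3 + 8) * e * (h\<^sup>2 + k)"
      (is "\<bar>?R\<bar> \<le> _")
    proof -
      have "?R = exp (m - a / 2) * (y * (E - 1 - h - (h\<^sup>2 - k) / 2) + (E * (k - h) + h + (h\<^sup>2 - k)))"
        unfolding ex y_def by (simp add: algebra_simps)
      also have "\<bar>\<dots>\<bar> \<le> exp K * (2 * K * (3 * e * S) + 8 * e * S)"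
        unfolding abs_mult abs_exp_cancel
      proof (intro mult_mono z A)
        have "\<bar>y * (E - 1 - h - (h\<^sup>2 - k) / 2)\<bar> \<le> 2 * K * (3 * e * S)"
          unfolding abs_mult using b(1) y K_nonneg unfolding E_def[symmetric] S_def[symmetric] by (intro mult_mono) auto
        moreover have "\<bar>E * (k - h) + h + (h\<^sup>2 - k)\<bar> \<le> 8 * e * S"
          using b(2) unfolding E_def[symmetric] S_def[symmetric] .
        ultimately show "\<bar>y * (E - 1 - h - (h\<^sup>2 - k) / 2) + (E * (k - h) + h + (h\<^sup>2 - k))\<bar> \<le> 2 * K * (3 * e * S) + 8 * e * S"
          by linarith
      qed auto
      also have "\<dots> = exp K * (2 * K * 3 + 8) * e * (h\<^sup>2 + k)" by (simp add: S_def algebra_simps)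
      finally show ?thesis .
    qed
  qed (auto intro!: continuous_intros)
  then show "(\<integral>x. exp (X T x - Y T x / 2) * (Y T x - X T x) \<partial>P) = 0" by simp
  have "(\<integral>x. exp (X T x - Y T x / 2) * ((Y T x - X T x)\<^sup>2 - Y T x) \<partial>P) = exp (0 - 0 / 2) * ((0 - 0)\<^sup>2 - 0)"
  proof (rule ito[where f = "\<lambda>m a. exp (m - a / 2) * ((a - m)\<^sup>2 - a)"
        and ?D1.0 = "\<lambda>m a. exp (m - a / 2) * ((a - m)\<^sup>2 - a - 2 * (a - m))"
        and ?D2.0 = "\<lambda>m a. exp (m - a / 2) * (((a - m)\<^sup>2 - a) / 2 - 2 * (a - m) + 1)"
        and C = "exp K * (((2 * K)\<^sup>2 + K) * 3 + 2 * (2 * K) * 8 + 12)"])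
    show "0 \<le> exp K * (((2 * K)\<^sup>2 + K) * 3 + 2 * (2 * K) * 8 + 12)" using K_nonneg by simp
    fix m a h k e :: real
    assume A: "\<bar>m\<bar> \<le> K" "0 \<le> a" "a \<le> K" "\<bar>h\<bar> \<le> e" "0 \<le> k" "k \<le> e" "e \<le> 1 / 2"
    note b = exp_increment_bounds[OF A(4-7)]
    define y E S where "y = a - m" and "E = exp (h - k / 2)" and "S = h\<^sup>2 + k"
    have y: "\<bar>y\<bar> \<le> 2 * K" using A by (simp add: y_def)
    have "y\<^sup>2 \<le> (2 * K)\<^sup>2" using y K_nonneg by (metis abs_le_square_iff abs_of_nonneg mult_nonneg_nonneg zero_le_numeral)
    then have ya: "\<bar>y\<^sup>2 - a\<bar> \<le> (2 * K)\<^sup>2 + K" using A zero_le_power2[of y] by linarith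
    have ex: "exp (m + h - (a + k) / 2) = exp (m - a / 2) * E" by (simp add: E_def exp_add[symmetric] field_simps)
    show "\<bar>exp (m + h - (a + k) / 2) * ((a + k - (m + h))\<^sup>2 - (a + k)) - exp (m - a / 2) * ((a - m)\<^sup>2 - a)
       - exp (m - a / 2) * ((a - m)\<^sup>2 - a - 2 * (a - m)) * h
       - exp (m - a / 2) * (((a - m)\<^sup>2 - a) / 2 - 2 * (a - m) + 1) * (h\<^sup>2 - k)\<bar>
      \<le> exp K * (((2 * K)\<^sup>2 + K) * 3 + 2 * (2 * K) * 8 + 12) * e * (h\<^sup>2 + k)"
      (is "\<bar>?R\<bar> \<le> _")
    proof -
      have "?R = exp (m - a / 2) * (((y\<^sup>2 - a) * (E - 1 - h - (h\<^sup>2 - k) / 2) + 2 * y * (E * (k - h) + h + (h\<^sup>2 - k)))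
           + (E * ((k - h)\<^sup>2 - k) - (h\<^sup>2 - k)))"
      proof -
        \<comment> \<open>A regrouping whose brackets are the three errors of
          \<open>exp_increment_bounds\<close>; \<open>q\<close> stands for \<open>k - h\<close> and
          \<open>d\<close> for \<open>h\<^sup>2 - k\<close>.\<close>
        have id: "z * E * ((y + q)\<^sup>2 - (a + k)) - z * (y\<^sup>2 - a) - z * (y\<^sup>2 - a - 2 * y) * h
            - z * ((y\<^sup>2 - a) / 2 - 2 * y + 1) * d
          = z * (((y\<^sup>2 - a) * (E - 1 - h - d / 2) + 2 * y * (E * q + h + d)) + (E * (q\<^sup>2 - k) - d))" for z q d
          by (simp add: algebra_simps power2_eq_square add_divide_distrib diff_divide_distrib)
        have "a + k - (m + h) = y + (k - h)" by (simp add: y_def)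
        then show ?thesis using id[of "exp (m - a / 2)" "k - h" "h\<^sup>2 - k"] unfolding ex y_def by (simp only:)
      qed
      also have "\<bar>\<dots>\<bar> \<le> exp K * ((((2 * K)\<^sup>2 + K) * (3 * e * S) + 2 * (2 * K) * (8 * e * S)) + 12 * e * S)"
        unfolding abs_mult abs_exp_cancel
      proof (intro mult_mono z A)
        have "\<bar>(y\<^sup>2 - a) * (E - 1 - h - (h\<^sup>2 - k) / 2)\<bar> \<le> ((2 * K)\<^sup>2 + K) * (3 * e * S)"
          unfolding abs_mult using b(1) ya K_nonneg unfolding E_def[symmetric] S_def[symmetric] by (intro mult_mono) auto
        moreover have "\<bar>2 * y * (E * (k - h) + h + (h\<^sup>2 - k))\<bar> \<le> 2 * (2 * K) * (8 * e * S)"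
          unfolding abs_mult using b(2) y K_nonneg unfolding E_def[symmetric] S_def[symmetric] by (intro mult_mono) auto
        moreover have "\<bar>E * ((k - h)\<^sup>2 - k) - (h\<^sup>2 - k)\<bar> \<le> 12 * e * S"
          using b(3) unfolding E_def[symmetric] S_def[symmetric] .
        ultimately show "\<bar>((y\<^sup>2 - a) * (E - 1 - h - (h\<^sup>2 - k) / 2) + 2 * y * (E * (k - h) + h + (h\<^sup>2 - k)))
           + (E * ((k - h)\<^sup>2 - k) - (h\<^sup>2 - k))\<bar>
           \<le> (((2 * K)\<^sup>2 + K) * (3 * e * S) + 2 * (2 * K) * (8 * e * S)) + 12 * e * S"
          by linarith
      qed auto
      also have "\<dots> = exp K * (((2 * K)\<^sup>2 + K) * 3 + 2 * (2 * K) * 8 + 12) * e * (h\<^sup>2 + k)"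
        by (simp add: S_def algebra_simps)
      finally show ?thesis .
    qed
  qed (auto intro!: continuous_intros)
  then show "(\<integral>x. exp (X T x - Y T x / 2) * ((Y T x - X T x)\<^sup>2 - Y T x) \<partial>P) = 0" by simp
qed

end

context increasing_pair
begin

lemma bounded_pair_stopped:
  assumes r: "reduces M A K \<sigma>"
  shows "bounded_pair P F T (\<lambda>t x. M (min t (\<sigma> x)) x) (\<lambda>t x. A (min t (\<sigma> x)) x) K"
proof -
  note \<sigma> = reducesD[OF r]
  let ?X = "\<lambda>t x. M (min t (\<sigma> x)) x" and ?Y = "\<lambda>t x. A (min t (\<sigma> x)) x"
  have Xc: "cont_adapted ?X" by (rule cont_adapted_stopped[OF M_cont \<sigma>(1)])
  have Yc: "cont_adapted ?Y" by (rule cont_adapted_stopped[OF A_cont \<sigma>(1)])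
  have TST: "(\<lambda>_. T) \<in> ST" using T_pos by (intro const_ST) auto
  have t: "min (min t T) (\<sigma> x) = min t (\<sigma> x)" if "x \<in> space P" for t x
    using STD(3)[OF \<sigma>(1) that] by auto
  show ?thesis
  proof (intro bounded_pair.intro increasing_pair.intro increasing_pair_axioms.intro bounded_pair_axioms.intro)
    show "usual_conditions P F T" by (rule usual_conditions_axioms)
    show "cont_adapted ?X" "cont_adapted ?Y" by (rule Xc, rule Yc)
    show "AE x in P. ?X 0 x = 0"
      using M_0 AE_space by eventually_elim (use STD(2)[OF \<sigma>(1)] in \<open>simp add: min_absorb1\<close>)
    show "AE x in P. ?Y 0 x = 0"
      using A_0 AE_space by eventually_elim (use STD(2)[OF \<sigma>(1)] in \<open>simp add: min_absorb1\<close>)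
    show "AE x in P. mono_on {0..T} (\<lambda>t. ?Y t x)"
      using A_mono AE_space
    proof eventually_elim
      case (elim x)
      show ?case
      proof (rule mono_onI)
        fix s t assume "s \<in> {0..T}" "t \<in> {0..T}" "s \<le> t"
        then show "?Y s x \<le> ?Y t x"
          using STD(2,3)[OF \<sigma>(1) elim(2)] by (intro mono_onD[OF elim(1)]) (auto simp: min_le_iff_disj)
      qed
    qed
    show "reduces ?X ?Y K (\<lambda>_. T)"
      unfolding reduces_def
    proof (intro conjI TST)
      show "AE x in P. \<forall>t\<in>{0..T}. \<bar>?X t x\<bar> \<le> K \<and> ?Y t x \<le> K"
        using \<sigma>(2) AE_space
      proof eventually_elim
        case (elim x)
        show ?case
        proof
          fix t assume "t \<in> {0..T}"
          then have "min t (\<sigma> x) \<in> {0..\<sigma> x}" using STD(2)[OF \<sigma>(1) elim(2)] by auto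
          then show "\<bar>?X t x\<bar> \<le> K \<and> ?Y t x \<le> K" using elim(1) by blast
        qed
      qed
      have Xc': "cont_adapted (\<lambda>t x. ?X (min t T) x)" by (rule cont_adapted_stopped[OF Xc TST])
      have Yc': "cont_adapted (\<lambda>t x. ?Y (min t T) x)" by (rule cont_adapted_stopped[OF Yc TST])
      have "cont_adapted (\<lambda>t x. (?X (min t T) x)\<^sup>2)"
        by (rule cont_adapted_comp[OF Xc']) (auto intro!: continuous_intros)
      from cont_adapted_diff[OF this Yc'] have Nc': "cont_adapted (\<lambda>t x. (?X (min t T) x)\<^sup>2 - ?Y (min t T) x)" .
      show "mart (\<lambda>t x. ?X (min t T) x)"
        by (rule mart_cong_AE[OF \<sigma>(3) Xc']) (use AE_space in eventually_elim, simp add: t)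
      show "mart (\<lambda>t x. (?X (min t T) x)\<^sup>2 - ?Y (min t T) x)"
        by (rule mart_cong_AE[OF \<sigma>(4) Nc']) (use AE_space in eventually_elim, simp add: t)
    qed
  qed
qed

lemma stopped_ito:
  assumes r: "reduces M A K \<sigma>"
  shows "(\<integral>x. exp (at_time M \<sigma> x - at_time A \<sigma> x / 2) * (at_time A \<sigma> x - at_time M \<sigma> x) \<partial>P) = 0"
    and "(\<integral>x. exp (at_time M \<sigma> x - at_time A \<sigma> x / 2) * ((at_time A \<sigma> x - at_time M \<sigma> x)\<^sup>2 - at_time A \<sigma> x) \<partial>P) = 0"
    and "continuous_on UNIV (\<lambda>p. g (fst p) (snd p) :: real) \<Longrightarrow>
      \<exists>B. AE x in P. \<bar>g (at_time M \<sigma> x) (at_time A \<sigma> x)\<bar> \<le> B"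
proof -
  interpret B: bounded_pair P F T "\<lambda>t x. M (min t (\<sigma> x)) x" "\<lambda>t x. A (min t (\<sigma> x)) x" K
    by (rule bounded_pair_stopped[OF r])
  have t: "min T (\<sigma> x) = \<sigma> x" if "x \<in> space P" for x using STD(3)[OF reducesD(1)[OF r] that] by simp
  have "(\<integral>x. exp (at_time M \<sigma> x - at_time A \<sigma> x / 2) * (at_time A \<sigma> x - at_time M \<sigma> x) \<partial>P)
    = (\<integral>x. exp (M (min T (\<sigma> x)) x - A (min T (\<sigma> x)) x / 2) * (A (min T (\<sigma> x)) x - M (min T (\<sigma> x)) x) \<partial>P)"
    by (rule Bochner_Integration.integral_cong) (simp_all add: t)
  then show "(\<integral>x. exp (at_time M \<sigma> x - at_time A \<sigma> x / 2) * (at_time A \<sigma> x - at_time M \<sigma> x) \<partial>P) = 0"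
    using B.ito_exponential(1) by simp
  have "(\<integral>x. exp (at_time M \<sigma> x - at_time A \<sigma> x / 2) * ((at_time A \<sigma> x - at_time M \<sigma> x)\<^sup>2 - at_time A \<sigma> x) \<partial>P)
    = (\<integral>x. exp (M (min T (\<sigma> x)) x - A (min T (\<sigma> x)) x / 2)
        * ((A (min T (\<sigma> x)) x - M (min T (\<sigma> x)) x)\<^sup>2 - A (min T (\<sigma> x)) x) \<partial>P)"
    by (rule Bochner_Integration.integral_cong) (simp_all add: t)
  then show "(\<integral>x. exp (at_time M \<sigma> x - at_time A \<sigma> x / 2) * ((at_time A \<sigma> x - at_time M \<sigma> x)\<^sup>2 - at_time A \<sigma> x) \<partial>P) = 0"
    using B.ito_exponential(2) by simp
  assume g: "continuous_on UNIV (\<lambda>p. g (fst p) (snd p) :: real)"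
  obtain D where D: "\<forall>\<tau>\<in>ST. AE x in P. \<bar>g (M (min (\<tau> x) (\<sigma> x)) x) (A (min (\<tau> x) (\<sigma> x)) x)\<bar> \<le> D"
    using B.stopped_function(3)[OF g B.T_in_ST] by blast
  have "AE x in P. \<bar>g (at_time M \<sigma> x) (at_time A \<sigma> x)\<bar> \<le> D"
    using bspec[OF D B.T_in_ST] AE_space by eventually_elim (simp add: t)
  then show "\<exists>B. AE x in P. \<bar>g (at_time M \<sigma> x) (at_time A \<sigma> x)\<bar> \<le> B" by blast
qed

end

section \<open>The equivalent measure and Girsanov's theorem\<close>

context exp_pair
begin

definition Q :: "'a measure" where
  "Q = density P (\<lambda>x. ennreal (stoch_exp M A T x))"

lemma Q_eq: "Q = density P (\<lambda>x. ennreal (exp (L T x)))"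
  by (simp add: Q_def stoch_exp_eq)

lemma space_Q [simp]: "space Q = space P" and sets_Q [simp, measurable_cong]: "sets Q = sets P"
  by (simp_all add: Q_def)

lemma measurable_Q [simp]: "measurable Q N = measurable P N"
  by (rule measurable_cong_sets) simp_all

text \<open>The density is an exponential, hence strictly positive. Equality of null sets is what
  transfers completeness and almost sure path properties to \<open>Q\<close>.\<close>

lemma AE_Q: "(AE x in Q. R x) \<longleftrightarrow> (AE x in P. R x)"
  unfolding Q_eq by (subst AE_density) auto

lemma null_sets_Q: "null_sets Q = null_sets P"
proof -
  have "N \<in> null_sets Q \<longleftrightarrow> N \<in> null_sets P" for N
  proof (cases "N \<in> sets P")
    case True
    then show ?thesis using Measure_Space.AE_iff_null_sets[of N P] Measure_Space.AE_iff_null_sets[of N Q] unfolding sets_Q AE_Q by blast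
  qed (auto simp: null_sets_def)
  then show ?thesis by blast
qed

lemma nn_integral_Q: "f \<in> borel_measurable P \<Longrightarrow> (\<integral>\<^sup>+x. f x \<partial>Q) = (\<integral>\<^sup>+x. ennreal (exp (L T x)) * f x \<partial>P)"
  unfolding Q_eq by (subst nn_integral_density) auto

lemma initial_ST: "(\<lambda>_. 0) \<in> ST"
  using T_pos by (intro const_ST) auto

lemma L_0: "AE x in P. L 0 x = 0"
  using M_0 A_0 by eventually_elim (simp add: L_def)

lemma prob_space_Q: "prob_space Q"
proof
  have "emeasure Q (space Q) = (\<integral>\<^sup>+x. ennreal (exp (L T x)) \<partial>P)"
    using nn_integral_Q[of "\<lambda>_. 1"] by simp
  also have "\<dots> = (\<integral>\<^sup>+x. ennreal (exp (L T x - L 0 x)) * indicator (space P) x \<partial>P)"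
  proof (rule nn_integral_cong_AE)
    show "AE x in P. ennreal (exp (L T x)) = ennreal (exp (L T x - L 0 x)) * indicator (space P) x"
      using L_0 AE_space by eventually_elim simp
  qed
  also have "\<dots> = ennreal (prob (space P))"
    using exp_L_ratio[OF initial_ST sets.top] by (simp add: space_pre_sigma)
  finally show "emeasure Q (space Q) = 1" by (simp add: prob_space)
qed

lemma usual_conditions_Q: "usual_conditions Q F T"
proof (intro usual_conditions.intro usual_conditions_axioms.intro complete_measure.intro prob_space_Q T_pos)
  show "filtration (space Q) F" unfolding space_Q by (rule filtration_axioms)
  show "sets (F T) \<subseteq> sets Q" using sets_F_subset by simp
  show "null_sets Q \<subseteq> sets (F 0)" unfolding null_sets_Q by (rule null_sets_subset)
  show "sets (F t) = (\<Inter>s\<in>{t<..T}. sets (F s))" if "0 \<le> t" "t < T" for t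
    by (rule right_continuous[OF that])
  show "B \<in> sets Q" if "B \<subseteq> N" "N \<in> null_sets Q" for B N
    using that complete[of B N] unfolding null_sets_Q by simp
qed

lemma ST_Q [simp]: "stopping_times Q F T = ST"
  by (simp add: stopping_times_def)

lemma cont_adapted_Q: "usual_conditions.cont_adapted Q F T X \<longleftrightarrow> cont_adapted X"
  using usual_conditions.cont_adapted_def[OF usual_conditions_Q, of X]
  by (simp add: cont_adapted_def continuous_paths_def AE_Q)

text \<open>The integrand is bounded and known at \<open>\<sigma>\<close>, so the density at
  \<open>T\<close> may be replaced by its value at \<open>\<sigma>\<close>. What remains is a
  function of the stopped pair, to which the Ito formula applies.\<close>

lemma stopped_Q:
  assumes g: "continuous_on UNIV (\<lambda>p. g (fst p) (snd p) :: real)" and r: "reduces M A K \<sigma>"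
  shows "integrable Q (\<lambda>x. g (at_time M \<sigma> x) (at_time A \<sigma> x))"
    and "(\<integral>x. g (at_time M \<sigma> x) (at_time A \<sigma> x) \<partial>Q)
      = (\<integral>x. exp (at_time M \<sigma> x - at_time A \<sigma> x / 2) * g (at_time M \<sigma> x) (at_time A \<sigma> x) \<partial>P)"
proof -
  let ?g = "\<lambda>x. g (at_time M \<sigma> x) (at_time A \<sigma> x)"
  note \<sigma> = reducesD(1)[OF r]
  obtain B where B: "AE x in P. \<bar>?g x\<bar> \<le> B" using stopped_ito(3)[OF r g] by blast
  have m: "?g \<in> borel_measurable (pre_sigma \<sigma>)"
    by (rule borel_measurable_continuous_Pair[OF stopped_measurable_pre_sigma[OF M_cont \<sigma>]
          stopped_measurable_pre_sigma[OF A_cont \<sigma>] g])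
  have mP[measurable]: "?g \<in> borel_measurable P" by (rule measurable_pre_sigma_P[OF \<sigma> m])
  note w = mart_weighted[OF exp_L_mart exp_L_cont \<sigma> T_ST STD(3)[OF \<sigma>] m B]
  show "integrable Q ?g"
    unfolding Q_eq using w(2) by (subst integrable_density) (auto simp: mult.commute)
  have "(\<integral>x. ?g x \<partial>Q) = (\<integral>x. ?g x * exp (L T x) \<partial>P)"
    unfolding Q_eq by (subst integral_density) (auto simp: mult.commute)
  also have "\<dots> = (\<integral>x. ?g x * exp (at_time L \<sigma> x) \<partial>P)" by (rule w(1))
  also have "\<dots> = (\<integral>x. exp (at_time M \<sigma> x - at_time A \<sigma> x / 2) * ?g x \<partial>P)"
    by (rule Bochner_Integration.integral_cong) (simp_all add: L_def mult.commute)
  finally show "(\<integral>x. ?g x \<partial>Q) = (\<integral>x. exp (at_time M \<sigma> x - at_time A \<sigma> x / 2) * ?g x \<partial>P)" .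
qed

text \<open>Minima of a stopping time with a reducing time are again reducing, so one vanishing
  expectation per reducing time settles all stopping times.\<close>

lemma mart_Q:
  assumes g: "continuous_on UNIV (\<lambda>p. g (fst p) (snd p) :: real)" and r: "reduces M A K \<rho>"
    and z: "\<And>\<sigma>. reduces M A K \<sigma> \<Longrightarrow>
      (\<integral>x. exp (at_time M \<sigma> x - at_time A \<sigma> x / 2) * g (at_time M \<sigma> x) (at_time A \<sigma> x) \<partial>P) = 0"
  shows "usual_conditions.mart Q F T (\<lambda>t x. g (M (min t (\<rho> x)) x) (A (min t (\<rho> x)) x))"
proof -
  let ?X = "\<lambda>t x. g (M (min t (\<rho> x)) x) (A (min t (\<rho> x)) x)"
  have *: "integrable Q (at_time ?X \<tau>) \<and> (\<integral>x. at_time ?X \<tau> x \<partial>Q) = 0" if "\<tau> \<in> ST" for \<tau>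
  proof -
    have r': "reduces M A K (\<lambda>x. min (\<tau> x) (\<rho> x))" by (rule reduces_min[OF r that])
    show ?thesis using stopped_Q[OF g r'] z[OF r'] by simp
  qed
  show ?thesis
    unfolding usual_conditions.mart_def[OF usual_conditions_Q] ST_Q using * *[OF initial_ST] by simp
qed

text \<open>Re-establishing the whole locale makes every earlier result available under
  \<open>Q\<close>. Reducing times stay reducing with bound \<open>2 * K\<close>, because
  \<open>|A - M| \<le> 2 * K\<close> there. The new stochastic exponential is
  \<open>exp (- L)\<close>, the reciprocal density, whose \<open>Q\<close>-mean at
  \<open>\<tau>\<close> is the \<open>P\<close>-mean of the density ratio after
  \<open>\<tau>\<close>, hence 1.\<close>

lemma girsanov: "exp_pair Q F T (\<lambda>t x. A t x - M t x) A"
proof -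
  interpret U: usual_conditions Q F T by (rule usual_conditions_Q)
  let ?M = "\<lambda>t x. A t x - M t x"
  have Mc: "cont_adapted ?M" by (rule cont_adapted_diff[OF A_cont M_cont])
  show ?thesis
  proof (intro exp_pair.intro exp_pair_axioms.intro localized_pair.intro localized_pair_axioms.intro
      increasing_pair.intro increasing_pair_axioms.intro usual_conditions_Q)
    show "U.cont_adapted ?M" "U.cont_adapted A" unfolding cont_adapted_Q by (rule Mc, rule A_cont)
    show "AE x in Q. ?M 0 x = 0" unfolding AE_Q using M_0 A_0 by eventually_elim simp
    show "AE x in Q. A 0 x = 0" "AE x in Q. mono_on {0..T} (\<lambda>t. A t x)"
      unfolding AE_Q by (rule A_0, rule A_mono)
    have red: "U.reduces ?M A (2 * K) \<rho>" if r: "reduces M A K \<rho>" for \<rho> K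
      unfolding U.reduces_def ST_Q
    proof (intro conjI)
      show \<rho>: "\<rho> \<in> ST" by (rule reducesD(1)[OF r])
      show "AE x in Q. \<forall>t\<in>{0..\<rho> x}. \<bar>?M t x\<bar> \<le> 2 * K \<and> A t x \<le> 2 * K"
        unfolding AE_Q using reducesD(2)[OF r] A_nonneg AE_space
      proof eventually_elim
        case (elim x)
        show ?case
        proof
          fix t assume t: "t \<in> {0..\<rho> x}"
          then have "t \<in> {0..T}" using STD(3)[OF \<rho> elim(3)] by auto
          then have "0 \<le> A t x" using elim(2) by blast
          moreover have "\<bar>M t x\<bar> \<le> K" "A t x \<le> K" using elim(1) t by blast+
          ultimately show "\<bar>?M t x\<bar> \<le> 2 * K \<and> A t x \<le> 2 * K" by linarith
        qed
      qed
      show "U.mart (\<lambda>t x. ?M (min t (\<rho> x)) x)"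
        by (rule mart_Q[where g = "\<lambda>m a. a - m", OF _ r stopped_ito(1)]) (auto intro!: continuous_intros)
      show "U.mart (\<lambda>t x. (?M (min t (\<rho> x)) x)\<^sup>2 - A (min t (\<rho> x)) x)"
        by (rule mart_Q[where g = "\<lambda>m a. (a - m)\<^sup>2 - a", OF _ r stopped_ito(2)]) (auto intro!: continuous_intros)
    qed
    show "U.localized ?M A"
      using loc red unfolding U.localized_def localized_def AE_Q by meson
    have *: "integrable Q (\<lambda>x. exp (- at_time L \<tau> x)) \<and> (\<integral>x. exp (- at_time L \<tau> x) \<partial>Q) = 1" if \<tau>: "\<tau> \<in> ST" for \<tau>
    proof -
      note [measurable] = L_stopped_measurable[OF \<tau>]
      have nn: "(\<integral>\<^sup>+x. ennreal (exp (- at_time L \<tau> x)) \<partial>Q) = 1"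
      proof -
        have "(\<integral>\<^sup>+x. ennreal (exp (- at_time L \<tau> x)) \<partial>Q)
          = (\<integral>\<^sup>+x. ennreal (exp (L T x - at_time L \<tau> x)) * indicator (space P) x \<partial>P)"
          by (subst nn_integral_Q) (auto simp: ennreal_mult[symmetric] exp_add[symmetric] intro!: nn_integral_cong)
        then show ?thesis
          using exp_L_ratio[OF \<tau> sets.top] by (simp add: space_pre_sigma prob_space)
      qed
      have i: "integrable Q (\<lambda>x. exp (- at_time L \<tau> x))"
        using nn by (intro integrableI_nonneg) auto
      have "(\<integral>\<^sup>+x. ennreal (exp (- at_time L \<tau> x)) \<partial>Q) = ennreal (\<integral>x. exp (- at_time L \<tau> x) \<partial>Q)"
        by (rule nn_integral_eq_integral[OF i]) auto
      then show ?thesis using nn i by (simp add: ennreal_eq_1)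
    qed
    have eq: "stoch_exp ?M A = (\<lambda>t x. exp (- L t x))"
      by (intro ext) (simp add: stoch_exp_def L_def field_simps)
    show "U.mart (stoch_exp ?M A)"
      unfolding U.mart_def ST_Q eq using * *[OF initial_ST] by simp
  qed
qed

end

section \<open>Conditional expectations and the equivalences\<close>

context usual_conditions
begin

lemma nn_cond_exp_le_iff:
  assumes \<tau>: "\<tau> \<in> ST" and f[measurable]: "f \<in> borel_measurable P" and C: "0 \<le> C"
  shows "(AE x in P. nn_cond_exp P (pre_sigma \<tau>) f x \<le> ennreal C) \<longleftrightarrow>
    (\<forall>B\<in>sets (pre_sigma \<tau>). (\<integral>\<^sup>+x. f x * indicator B x \<partial>P) \<le> ennreal (C * prob B))"
proof -
  interpret S: sigma_finite_subalgebra P "pre_sigma \<tau>" by (rule finite_subalgebra_pre_sigma[OF \<tau>])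
  let ?e = "nn_cond_exp P (pre_sigma \<tau>) f"
  have int: "(\<integral>\<^sup>+x. f x * indicator B x \<partial>P) = (\<integral>\<^sup>+x. ?e x * indicator B x \<partial>P)" if "B \<in> sets (pre_sigma \<tau>)" for B
    using S.nn_cond_exp_intg[of "indicator B" f] that by (simp add: mult.commute)
  have const: "(\<integral>\<^sup>+x. ennreal C * indicator B x \<partial>P) = ennreal (C * prob B)" if "B \<in> sets P" for B
    using that C by (simp add: nn_integral_cmult_indicator emeasure_eq_measure ennreal_mult)
  show ?thesis
  proof
    assume le: "AE x in P. ?e x \<le> ennreal C"
    show "\<forall>B\<in>sets (pre_sigma \<tau>). (\<integral>\<^sup>+x. f x * indicator B x \<partial>P) \<le> ennreal (C * prob B)"
    proof
      fix B assume B: "B \<in> sets (pre_sigma \<tau>)"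
      have "(\<integral>\<^sup>+x. ?e x * indicator B x \<partial>P) \<le> (\<integral>\<^sup>+x. ennreal C * indicator B x \<partial>P)"
        by (rule nn_integral_mono_AE) (use le in eventually_elim, simp add: mult_right_mono)
      then show "(\<integral>\<^sup>+x. f x * indicator B x \<partial>P) \<le> ennreal (C * prob B)"
        using const[OF sets_pre_sigma_P[OF \<tau> B]] int[OF B] by simp
    qed
  next
    assume le: "\<forall>B\<in>sets (pre_sigma \<tau>). (\<integral>\<^sup>+x. f x * indicator B x \<partial>P) \<le> ennreal (C * prob B)"
    \<comment> \<open>Test on the event where the conditional expectation exceeds \<open>C\<close>.
      The finite amount \<open>C * prob ?B\<close> cancels, and the excess integrates to
      zero.\<close>
    let ?B = "{x \<in> space (pre_sigma \<tau>). ennreal C < ?e x}"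
    have B: "?B \<in> sets (pre_sigma \<tau>)" by measurable
    have BP[measurable]: "?B \<in> sets P" by (rule sets_pre_sigma_P[OF \<tau> B])
    have "(\<integral>\<^sup>+x. ennreal C * indicator ?B x + (?e x - ennreal C) * indicator ?B x \<partial>P)
        = (\<integral>\<^sup>+x. ?e x * indicator ?B x \<partial>P)"
      by (intro nn_integral_cong) (auto simp: indicator_def add_diff_eq_iff_ennreal)
    also have "\<dots> \<le> ennreal (C * prob ?B)" using bspec[OF le B] unfolding int[OF B] .
    finally have "ennreal (C * prob ?B) + (\<integral>\<^sup>+x. (?e x - ennreal C) * indicator ?B x \<partial>P) \<le> ennreal (C * prob ?B)"
      using const[OF BP] by (subst (asm) nn_integral_add) auto
    then have "(\<integral>\<^sup>+x. (?e x - ennreal C) * indicator ?B x \<partial>P) = 0"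
      using ennreal_add_left_cancel_le[of "ennreal (C * prob ?B)" _ 0] by simp
    then have "AE x in P. (?e x - ennreal C) * indicator ?B x = 0"
      by (subst (asm) nn_integral_0_iff_AE) auto
    then show "AE x in P. ?e x \<le> ennreal C"
      using AE_space
    proof eventually_elim
      case (elim x)
      show ?case
      proof (rule ccontr)
        assume "\<not> ?e x \<le> ennreal C"
        then have "ennreal C < ?e x" by simp
        with elim show False by (auto simp: space_pre_sigma diff_eq_0_iff_ennreal dest: leD)
      qed
    qed
  qed
qed

lemma nn_cond_exp_le_weighted:
  assumes \<tau>: "\<tau> \<in> ST" and f[measurable]: "f \<in> borel_measurable P"
    and le: "AE x in P. nn_cond_exp P (pre_sigma \<tau>) f x \<le> ennreal C"
    and g: "g \<in> borel_measurable (pre_sigma \<tau>)"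
  shows "(\<integral>\<^sup>+x. g x * f x \<partial>P) \<le> ennreal C * (\<integral>\<^sup>+x. g x \<partial>P)"
proof -
  interpret S: sigma_finite_subalgebra P "pre_sigma \<tau>" by (rule finite_subalgebra_pre_sigma[OF \<tau>])
  note [measurable] = measurable_pre_sigma_P[OF \<tau> g]
  have "(\<integral>\<^sup>+x. g x * f x \<partial>P) = (\<integral>\<^sup>+x. g x * nn_cond_exp P (pre_sigma \<tau>) f x \<partial>P)"
    by (rule S.nn_cond_exp_intg[OF g f, symmetric])
  also have "\<dots> \<le> (\<integral>\<^sup>+x. ennreal C * g x \<partial>P)"
    by (rule nn_integral_mono_AE) (use le in eventually_elim, metis mult.commute mult_left_mono zero_le)
  also have "\<dots> = ennreal C * (\<integral>\<^sup>+x. g x \<partial>P)" by (rule nn_integral_cmult) measurable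
  finally show ?thesis .
qed

end

lemma ennreal_sqrt_measurable [measurable]: "ennreal_sqrt \<in> borel_measurable borel"
  unfolding ennreal_sqrt_def[abs_def] by measurable

lemma ennreal_sqrt_le_iff: "0 \<le> c \<Longrightarrow> ennreal_sqrt y \<le> ennreal c \<longleftrightarrow> y \<le> ennreal (c\<^sup>2)"
  by (cases y) (auto simp: ennreal_sqrt_def real_sqrt_le_iff' ennreal_le_iff real_le_lsqrt sqrt_le_D top_unique)

section \<open>BMO membership and the integrated bound\<close>

context localized_pair
begin

text \<open>The converse of \<open>square_increment_le\<close>. Its hypothesis does not mention
  \<open>A\<close>, so it may come from any other version of the square characteristic.\<close>

lemma bmo_of_square_increments:
  assumes C: "0 \<le> C" and sq: "\<And>\<tau> \<sigma>. \<tau> \<in> ST \<Longrightarrow> \<sigma> \<in> ST \<Longrightarrow> (\<And>x. x \<in> space P \<Longrightarrow> \<tau> x \<le> \<sigma> x) \<Longrightarrow>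
    (\<integral>\<^sup>+x. ennreal ((at_time M \<sigma> x - at_time M \<tau> x)\<^sup>2) \<partial>P) \<le> ennreal (C * prob (before \<tau>))"
  shows "bmo C"
proof (rule bmoI[OF C])
  fix \<tau> assume \<tau>: "\<tau> \<in> ST"
  let ?p = "prob (before \<tau>)"
  show "(\<integral>\<^sup>+x. ennreal (A T x - at_time A \<tau> x) \<partial>P) \<le> ennreal (C * ?p)"
  proof (rule increment_le_of_reduced[OF \<tau>])
    fix K \<rho> assume red: "reduces M A K \<rho>"
    have \<rho>: "\<rho> \<in> ST" by (rule reducesD(1)[OF red])
    let ?B = "{x \<in> space P. \<tau> x < \<rho> x}"
    \<comment> \<open>Where \<open>\<rho>\<close> does not come after \<open>\<tau>\<close> the
      increment is zero, and both times jump to \<open>T\<close>. Using the minimum of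
      \<open>\<tau>\<close> and \<open>\<rho>\<close> instead would leave the larger factor
      \<open>P(min \<tau> \<rho> < T)\<close>.\<close>
    let ?\<tau> = "\<lambda>x. if x \<in> ?B then \<tau> x else T" and ?\<rho> = "\<lambda>x. if x \<in> ?B then \<rho> x else T"
    have \<tau>': "?\<tau> \<in> ST" by (rule switch_ST[OF \<tau> T_ST STD(3)[OF \<tau>] sets_pre_sigma_less[OF \<tau> \<rho>]])
    have \<rho>': "?\<rho> \<in> ST" by (rule switch_ST[OF \<rho> T_ST STD(3)[OF \<rho>] sets_pre_sigma_less_min[OF \<tau> \<rho>]])
    let ?sq = "\<lambda>x. (M (min T (\<rho> x)) x - M (min (\<tau> x) (\<rho> x)) x)\<^sup>2"
    have "ennreal (\<integral>x. A (min T (\<rho> x)) x - A (min (\<tau> x) (\<rho> x)) x \<partial>P) = ennreal (\<integral>x. ?sq x \<partial>P)"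
      by (simp only: reduced_increment(1)[OF red \<tau> T_ST STD(3)[OF \<tau>]])
    also have "\<dots> = (\<integral>\<^sup>+x. ennreal (?sq x) \<partial>P)"
      by (rule nn_integral_eq_integral[symmetric, OF reduced_increment(2)[OF red \<tau> T_ST STD(3)[OF \<tau>]]]) auto
    also have "\<dots> = (\<integral>\<^sup>+x. ennreal ((at_time M ?\<rho> x - at_time M ?\<tau> x)\<^sup>2) \<partial>P)"
    proof (rule nn_integral_cong)
      fix x assume x: "x \<in> space P"
      have "min T (\<rho> x) = \<rho> x" using STD(3)[OF \<rho> x] by simp
      then show "ennreal (?sq x) = ennreal ((at_time M ?\<rho> x - at_time M ?\<tau> x)\<^sup>2)"
        using x by (cases "\<tau> x < \<rho> x") auto
    qed
    also have "\<dots> \<le> ennreal (C * prob (before ?\<tau>))"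
      by (rule sq[OF \<tau>' \<rho>']) auto
    also have "\<dots> \<le> ennreal (C * ?p)"
      using C less_T_sets[OF \<tau>] by (intro ennreal_leI mult_left_mono finite_measure_mono) (auto split: if_splits)
    finally show "(\<integral>x. A (min T (\<rho> x)) x - A (min (\<tau> x) (\<rho> x)) x \<partial>P) \<le> C * ?p"
      using C by (simp add: ennreal_le_iff)
  qed
qed

text \<open>At reducing times the second moments of \<open>M\<close> are at most \<open>C\<close>,
  which gives uniform integrability, so the mean zero survives the limit.\<close>

lemma bmo_imp_mart:
  assumes C: "bmo C" shows "mart M"
proof -
  have C0: "0 \<le> C" using C by (simp add: bmo_def)
  obtain \<rho> :: "nat \<Rightarrow> 'a \<Rightarrow> real" and K where \<rho>: "\<And>n. reduces M A (K n) (\<rho> n)" "AE x in P. \<forall>\<^sub>F n in sequentially. \<rho> n x = T"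
    using reducing_sequence by blast
  have zero: "(\<lambda>_. 0) \<in> ST" using T_pos by (intro const_ST) auto
  have main: "integrable P (at_time M \<tau>) \<and> (\<integral>x. at_time M \<tau> x \<partial>P) = 0" if \<tau>: "\<tau> \<in> ST" for \<tau>
  proof -
    let ?m = "\<lambda>n x. M (min (\<tau> x) (\<rho> n x)) x"
    have mi: "integrable P (?m n)" "integrable P (\<lambda>x. (?m n x)\<^sup>2)" for n
      using reduces_A_mart(2,3)[OF \<rho>(1)[of n] \<tau>] by auto
    have sq: "(\<integral>x. (?m n x)\<^sup>2 \<partial>P) \<le> C" for n
    proof -
      have \<rho>n: "\<rho> n \<in> ST" by (rule reducesD(1)[OF \<rho>(1)])
      have "ennreal (\<integral>x. (?m n x)\<^sup>2 \<partial>P) = (\<integral>\<^sup>+x. ennreal ((?m n x)\<^sup>2) \<partial>P)"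
        by (rule nn_integral_eq_integral[OF mi(2), symmetric]) auto
      also have "\<dots> = (\<integral>\<^sup>+x. ennreal ((?m n x - M 0 x)\<^sup>2) \<partial>P)"
      proof (rule nn_integral_cong_AE)
        show "AE x in P. ennreal ((?m n x)\<^sup>2) = ennreal ((?m n x - M 0 x)\<^sup>2)" using M_0 by eventually_elim simp
      qed
      also have "\<dots> \<le> ennreal (C * prob {x \<in> space P. 0 < T})"
        by (rule square_increment_le[OF C zero min_ST[OF \<tau> \<rho>n]]) (use STD(2)[OF \<tau>] STD(2)[OF \<rho>n] in auto)
      also have "\<dots> \<le> ennreal C" using C0 by (intro ennreal_leI mult_left_le) auto
      finally show ?thesis using C0 by (simp add: ennreal_le_iff)
    qed
    have mz: "(\<integral>x. ?m n x \<partial>P) = 0" for n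
    proof -
      have "(\<integral>x. ?m n x \<partial>P) = (\<integral>x. M (min 0 (\<rho> n x)) x \<partial>P)"
        using martD(2)[OF reducesD(3)[OF \<rho>(1)[of n]] \<tau>] .
      also have "\<dots> = (\<integral>x. M 0 x \<partial>P)"
        using STD(2)[OF reducesD(1)[OF \<rho>(1)]] by (intro Bochner_Integration.integral_cong) (simp_all add: min_absorb1)
      also have "\<dots> = (\<integral>x. 0 \<partial>P)"
        using stopped_measurable[OF M_cont zero] M_0 by (intro integral_cong_AE) auto
      finally show ?thesis by simp
    qed
    have lim: "AE x in P. (\<lambda>n. ?m n x) \<longlonglongrightarrow> at_time M \<tau> x"
      using \<rho>(2) AE_space
    proof eventually_elim
      case (elim x)
      have "\<forall>\<^sub>F n in sequentially. ?m n x = at_time M \<tau> x"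
        using elim(1) by (rule eventually_mono) (use STD(3)[OF \<tau> elim(2)] in simp)
      then show ?case by (rule tendsto_eventually)
    qed
    have UI: "\<exists>c\<ge>0. \<forall>n. (\<integral>x. max 0 (\<bar>?m n x\<bar> - c) \<partial>P) \<le> e" if e: "0 < e" for e
    \<comment> \<open>The excess over \<open>c\<close> is at most the square divided by
      \<open>c\<close>, so \<open>C / c \<le> e\<close> is wanted; the summand 1 keeps
      \<open>c\<close> positive when \<open>C = 0\<close>.\<close>
    proof (intro exI[of _ "(C + 1) / e"] conjI allI)
      let ?c = "(C + 1) / e"
      have c: "0 < ?c" using C0 e by simp
      then show "0 \<le> ?c" by simp
      fix n
      have "(\<integral>x. max 0 (\<bar>?m n x\<bar> - ?c) \<partial>P) \<le> (\<integral>x. (?m n x)\<^sup>2 / ?c \<partial>P)"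
      proof (rule integral_mono)
        show "integrable P (\<lambda>x. max 0 (\<bar>?m n x\<bar> - ?c))"
          using mi(1) by (intro Bochner_Integration.integrable_max integrable_abs Bochner_Integration.integrable_diff) auto
        show "integrable P (\<lambda>x. (?m n x)\<^sup>2 / ?c)" using mi(2) by simp
        show "max 0 (\<bar>?m n x\<bar> - ?c) \<le> (?m n x)\<^sup>2 / ?c" for x
        proof -
          have "d * (\<bar>y\<bar> - d) \<le> y\<^sup>2" for d y :: real
          proof -
            have "0 \<le> (\<bar>y\<bar> - d / 2)\<^sup>2 + 3 / 4 * d\<^sup>2" by simp
            then show ?thesis by (simp add: power2_eq_square algebra_simps)
          qed
          from this[of ?c "?m n x"] have "(\<bar>?m n x\<bar> - ?c) \<le> (?m n x)\<^sup>2 / ?c"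
            using c by (simp only: pos_le_divide_eq mult.commute[of ?c])
          then show ?thesis using divide_nonneg_pos[OF zero_le_power2 c] by (intro max.boundedI)
        qed
      qed
      also have "\<dots> = (\<integral>x. (?m n x)\<^sup>2 \<partial>P) / ?c" by simp
      also have "\<dots> \<le> C / ?c" using sq[of n] c by (intro divide_right_mono) auto
      also have "\<dots> \<le> e" using C0 e by (simp add: field_simps)
      finally show "(\<integral>x. max 0 (\<bar>?m n x\<bar> - ?c) \<partial>P) \<le> e" .
    qed
    note V = integral_tendsto_of_excess[OF mi(1) stopped_measurable[OF M_cont \<tau>] lim UI]
    have "(\<lambda>n. 0) \<longlonglongrightarrow> (\<integral>x. at_time M \<tau> x \<partial>P)" using V(2) unfolding mz by simp
    then have "(\<integral>x. at_time M \<tau> x \<partial>P) = 0" by (simp add: LIMSEQ_const_iff)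
    then show ?thesis using V(1) by simp
  qed
  show ?thesis
    unfolding mart_def using main main[OF zero] by simp
qed

lemma bmo_iff_norm:
  assumes c: "0 \<le> c"
  shows "bmo_norm P F T A \<le> ennreal c \<longleftrightarrow> bmo (c\<^sup>2)"
proof -
  let ?f = "\<lambda>\<tau> y. ennreal (A T y - at_time A \<tau> y)"
  let ?s = "\<lambda>\<tau> x. ennreal_sqrt (nn_cond_exp P (pre_sigma \<tau>) (?f \<tau>) x)"
  have fm: "?f \<tau> \<in> borel_measurable P" if "\<tau> \<in> ST" for \<tau>
    using stopped_measurable[OF A_cont that] by measurable
  have sm: "?s \<tau> \<in> borel_measurable P" for \<tau>
    by measurable
  have "bmo_norm P F T A \<le> ennreal c \<longleftrightarrow> (\<forall>\<tau>\<in>ST. esssup P (?s \<tau>) \<le> ennreal c)"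
    unfolding bmo_norm_def SUP_le_iff ..
  also have "\<dots> \<longleftrightarrow> (\<forall>\<tau>\<in>ST. AE x in P. ?s \<tau> x \<le> ennreal c)"
  proof (intro ball_cong refl iffI)
    fix \<tau> assume "esssup P (?s \<tau>) \<le> ennreal c"
    then show "AE x in P. ?s \<tau> x \<le> ennreal c"
      using esssup_AE[of "?s \<tau>" P] by (auto elim!: eventually_mono)
  next
    fix \<tau> assume "AE x in P. ?s \<tau> x \<le> ennreal c"
    then show "esssup P (?s \<tau>) \<le> ennreal c" by (rule esssup_I[OF sm])
  qed
  also have "\<dots> \<longleftrightarrow> (\<forall>\<tau>\<in>ST. AE x in P. nn_cond_exp P (pre_sigma \<tau>) (?f \<tau>) x \<le> ennreal (c\<^sup>2))"
    by (simp only: ennreal_sqrt_le_iff[OF c])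
  also have "\<dots> \<longleftrightarrow> bmo (c\<^sup>2)"
    unfolding bmo_def using nn_cond_exp_le_iff[OF _ fm, where C = "c\<^sup>2"] by auto
  finally show ?thesis .
qed

text \<open>\<open>BMO\<close> only provides some square characteristic \<open>A'\<close>. The
  comparison with \<open>A\<close> goes through the squared increments of \<open>M\<close>.\<close>

lemma BMO_iff_bmo: "M \<in> BMO P F T \<longleftrightarrow> (\<exists>C. bmo C)"
proof
  assume B: "M \<in> BMO P F T"
  then obtain A' where A': "square_char P F T M A'" "bmo_norm P F T A' < \<infinity>" by (auto simp: BMO_def)
  interpret A': localized_pair P F T M A'
  proof (intro localized_pair.intro increasing_pair.intro increasing_pair_axioms.intro localized_pair_axioms.intro)
    show "usual_conditions P F T" by (rule usual_conditions_axioms)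
    show "cont_adapted M" "AE x in P. M 0 x = 0" by (rule M_cont, rule M_0)
    show "cont_adapted A'" "AE x in P. A' 0 x = 0" "AE x in P. mono_on {0..T} (\<lambda>t. A' t x)"
      using A'(1) by (simp_all add: square_char_def cont_adapted_def)
    show "localized M A'"
      by (rule localizedI[OF localizedD(1)[OF loc M_cont M_0 A_cont A_0] _ M_0 A'(1)])
        (use M_cont in \<open>simp add: cont_adapted_def\<close>)
  qed
  obtain c where c: "0 \<le> c" "bmo_norm P F T A' = ennreal c"
    using A'(2) by (cases "bmo_norm P F T A'") auto
  then have "A'.bmo (c\<^sup>2)" using A'.bmo_iff_norm[OF c(1)] by simp
  then have "bmo (c\<^sup>2)"
    by (intro bmo_of_square_increments A'.square_increment_le) auto
  then show "\<exists>C. bmo C" ..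
next
  assume "\<exists>C. bmo C"
  then obtain C where C: "bmo C" by blast
  have C0: "0 \<le> C" using C by (simp add: bmo_def)
  have m: "martingale P F T M"
    by (rule mart_martingale[OF bmo_imp_mart[OF C]]) (use M_cont in \<open>simp add: cont_adapted_def\<close>)
  have "bmo ((sqrt C)\<^sup>2)" using C C0 by simp
  then have "bmo_norm P F T A \<le> ennreal (sqrt C)" using bmo_iff_norm[of "sqrt C"] C0 by simp
  then have "bmo_norm P F T A < \<infinity>" by (simp add: le_less_trans)
  moreover have "square_char P F T M A"
    using A_cont A_0 A_mono localizedD(2)[OF loc M_cont M_0 A_cont A_0]
    by (simp add: square_char_def cont_adapted_def)
  ultimately show "M \<in> BMO P F T"
    using m martingale_uniformly_integrable[OF m] M_cont M_0 by (auto simp: BMO_def cont_adapted_def)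
qed

end

section \<open>Moment conditions, duality and the cycle of implications\<close>

context exp_pair
begin

lemma expo_iff:
  assumes D: "0 \<le> D"
  shows "expo q D \<longleftrightarrow> (\<forall>\<tau>\<in>ST. AE x in P.
    nn_cond_exp P (pre_sigma \<tau>) (\<lambda>y. ennreal (exp (q * (L T y - at_time L \<tau> y)))) x \<le> ennreal D)"
proof -
  have "(\<lambda>y. ennreal (exp (q * (L T y - at_time L \<tau> y)))) \<in> borel_measurable P" if "\<tau> \<in> ST" for \<tau>
    using L_stopped_measurable[OF that] by measurable
  then show ?thesis unfolding expo_def using nn_cond_exp_le_iff[OF _ _ D] D by auto
qed

lemma expo_weighted:
  assumes E: "expo q D" and \<tau>: "\<tau> \<in> ST" and g: "g \<in> borel_measurable (pre_sigma \<tau>)"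
  shows "(\<integral>\<^sup>+x. g x * ennreal (exp (q * (L T x - at_time L \<tau> x))) \<partial>P) \<le> ennreal D * (\<integral>\<^sup>+x. g x \<partial>P)"
proof (rule nn_cond_exp_le_weighted[OF \<tau> _ _ g])
  show "(\<lambda>x. ennreal (exp (q * (L T x - at_time L \<tau> x)))) \<in> borel_measurable P"
    using L_stopped_measurable[OF \<tau>] by measurable
  have "0 \<le> D" using E by (simp add: expo_def)
  then show "AE x in P. nn_cond_exp P (pre_sigma \<tau>) (\<lambda>x. ennreal (exp (q * (L T x - at_time L \<tau> x)))) x \<le> ennreal D"
    using E \<tau> expo_iff by blast
qed

lemma stoch_exp_from_powr: "stoch_exp_from T M A \<tau> y powr q = exp (q * (L T y - at_time L \<tau> y))"
  by (simp add: stoch_exp_from_def stoch_exp_eq powr_def exp_diff[symmetric])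

lemma expo_exists_pos: 
  "(\<exists>C>0. \<forall>\<tau>\<in>ST. AE x in P. nn_cond_exp P (pre_sigma \<tau>)
     (\<lambda>y. ennreal (stoch_exp_from T M A \<tau> y powr q)) x \<le> ennreal C) \<longleftrightarrow> (\<exists>D. expo q D)"
  (is "?l \<longleftrightarrow> ?r")
proof
  assume ?l
  then show ?r unfolding stoch_exp_from_powr using expo_iff[of _ q] less_imp_le by blast
next
  assume ?r
  then obtain D where D: "expo q D" by blast
  have D0: "0 \<le> D" using D by (simp add: expo_def)
  show ?l
    unfolding stoch_exp_from_powr
  \<comment> \<open>The conditions of the theorem ask for a positive constant, while
    \<open>expo\<close> admits 0.\<close>
  proof (intro exI[of _ "D + 1"] conjI ballI)
    show "0 < D + 1" using D0 by simp
    fix \<tau> assume "\<tau> \<in> ST"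
    with D expo_iff[OF D0, of q] have
      "AE x in P. nn_cond_exp P (pre_sigma \<tau>) (\<lambda>y. ennreal (exp (q * (L T y - at_time L \<tau> y)))) x \<le> ennreal D" by blast
    then show "AE x in P. nn_cond_exp P (pre_sigma \<tau>) (\<lambda>y. ennreal (exp (q * (L T y - at_time L \<tau> y)))) x \<le> ennreal (D + 1)"
      by (rule eventually_mono) (erule order_trans, rule ennreal_leI, simp)
  qed
qed

lemma reverse_Hoelder_iff: "(\<exists>p>1. reverse_Hoelder P F T M A p) \<longleftrightarrow> (\<exists>q>1. \<exists>D. expo q D)"
  unfolding reverse_Hoelder_def expo_exists_pos ..

lemma Muckenhoupt_iff: "(\<exists>p>1. Muckenhoupt P F T M A p) \<longleftrightarrow> (\<exists>q<0. \<exists>D. expo q D)"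
  unfolding Muckenhoupt_def expo_exists_pos
proof
  assume "\<exists>p>1. \<exists>D. expo (- 1 / (p - 1)) D"
  then obtain p where p: "1 < p" "\<exists>D. expo (- 1 / (p - 1)) D" by blast
  have "- 1 / (p - 1) < 0" using p(1) by (intro divide_neg_pos) auto
  with p(2) show "\<exists>q<0. \<exists>D. expo q D" by blast
next
  assume "\<exists>q<0. \<exists>D. expo q D"
  then obtain q where q: "q < 0" "\<exists>D. expo q D" by blast
  \<comment> \<open>The witness \<open>p = 1 - 1 / q\<close> solves
    \<open>q = - 1 / (p - 1)\<close>.\<close>
  have "- 1 / (1 - 1 / q - 1) = q" "1 < 1 - 1 / q" using q(1) by (auto simp: divide_simps)
  with q(2) show "\<exists>p>1. \<exists>D. expo (- 1 / (p - 1)) D" by (metis (no_types))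
qed

text \<open>Bayes' rule. The density at \<open>T\<close> is its value at \<open>\<tau>\<close> times
  the ratio after \<open>\<tau>\<close>. The value is known at \<open>\<tau>\<close> and joins the
  test function; the ratio contributes exponent 1 to the exponent \<open>- q\<close> that comes from
  the dual logarithm \<open>- L\<close>.\<close>

lemma dual_expo:
  "exp_pair.expo Q F T (\<lambda>t x. A t x - M t x) A q D \<longleftrightarrow> expo (1 - q) D"
proof -
  interpret G: exp_pair Q F T "\<lambda>t x. A t x - M t x" A by (rule girsanov)
  have GL: "G.L t x = - L t x" for t x by (simp add: G.L_def L_def field_simps)
  have int: "(\<integral>\<^sup>+x. g x * ennreal (exp (q * (G.L T x - at_time G.L \<tau> x))) \<partial>Q)
      = (\<integral>\<^sup>+x. (g x * ennreal (exp (at_time L \<tau> x))) * ennreal (exp ((1 - q) * (L T x - at_time L \<tau> x))) \<partial>P)"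
    if \<tau>: "\<tau> \<in> ST" and g: "g \<in> borel_measurable (pre_sigma \<tau>)" for g \<tau>
  proof -
    note [measurable] = L_stopped_measurable[OF \<tau>] measurable_pre_sigma_P[OF \<tau> g]
    have e: "ennreal (exp (L T x)) * ennreal (exp (q * (- L T x - - at_time L \<tau> x)))
       = ennreal (exp (at_time L \<tau> x)) * ennreal (exp ((1 - q) * (L T x - at_time L \<tau> x)))" for x
      by (simp add: ennreal_mult[symmetric] exp_add[symmetric] algebra_simps)
    show ?thesis
      unfolding GL
      by (subst nn_integral_Q) (measurable, intro nn_integral_cong, simp only: mult.left_commute[of _ "g _"] e mult.assoc)
  qed
  have QB: "ennreal (G.prob B) = (\<integral>\<^sup>+x. indicator B x * ennreal (exp (at_time L \<tau> x)) \<partial>P)"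
    if \<tau>: "\<tau> \<in> ST" and B: "B \<in> sets (pre_sigma \<tau>)" for B \<tau>
  proof -
    have [measurable]: "B \<in> sets P" by (rule sets_pre_sigma_P[OF \<tau> B])
    have "ennreal (G.prob B) = (\<integral>\<^sup>+x. indicator B x \<partial>Q)" by (simp add: G.emeasure_eq_measure)
    also have "\<dots> = (\<integral>\<^sup>+x. indicator B x * ennreal (exp (L T x)) \<partial>P)"
      by (subst nn_integral_Q) (auto simp: mult.commute)
    also have "\<dots> = (\<integral>\<^sup>+x. indicator B x * ennreal (exp (at_time L \<tau> x)) \<partial>P)"
      by (rule exp_L_weighted[OF \<tau>]) (use B in measurable)
    finally show ?thesis .
  qed
  have preQ: "G.pre_sigma \<tau> = pre_sigma \<tau>" for \<tau> by simp
  show ?thesis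
  proof
    assume E: "expo (1 - q) D"
    have D: "0 \<le> D" using E by (simp add: expo_def)
    show "G.expo q D"
      unfolding G.expo_def ST_Q preQ
    proof (intro conjI D ballI)
      fix \<tau> B assume \<tau>: "\<tau> \<in> ST" and B: "B \<in> sets (pre_sigma \<tau>)"
      have g: "indicator B \<in> borel_measurable (pre_sigma \<tau>)" using B by measurable
      have "(\<integral>\<^sup>+x. ennreal (exp (q * (G.L T x - at_time G.L \<tau> x))) * indicator B x \<partial>Q)
         = (\<integral>\<^sup>+x. (indicator B x * ennreal (exp (at_time L \<tau> x))) * ennreal (exp ((1 - q) * (L T x - at_time L \<tau> x))) \<partial>P)"
        using int[OF \<tau> g] by (simp add: mult.commute)
      also have "\<dots> \<le> ennreal D * (\<integral>\<^sup>+x. indicator B x * ennreal (exp (at_time L \<tau> x)) \<partial>P)"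
        by (rule expo_weighted[OF E \<tau>]) (use B stopped_measurable_pre_sigma[OF L_cont \<tau>] in measurable)
      also have "\<dots> = ennreal (D * G.prob B)" using D by (simp add: QB[OF \<tau> B, symmetric] ennreal_mult)
      finally show "(\<integral>\<^sup>+x. ennreal (exp (q * (G.L T x - at_time G.L \<tau> x))) * indicator B x \<partial>Q) \<le> ennreal (D * G.prob B)" .
    qed
  next
    assume E: "G.expo q D"
    have D: "0 \<le> D" using E by (simp add: G.expo_def)
    show "expo (1 - q) D"
      unfolding expo_def
    proof (intro conjI D ballI)
      fix \<tau> B assume \<tau>: "\<tau> \<in> ST" and B: "B \<in> sets (pre_sigma \<tau>)"
      have BP[measurable]: "B \<in> sets P" by (rule sets_pre_sigma_P[OF \<tau> B])
      \<comment> \<open>The reciprocal density at \<open>\<tau>\<close> offsets the weight that the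
        change of measure puts on the test function.\<close>
      let ?g = "\<lambda>x. ennreal (exp (- at_time L \<tau> x)) * indicator B x"
      have g: "?g \<in> borel_measurable (pre_sigma \<tau>)"
        using B stopped_measurable_pre_sigma[OF L_cont \<tau>] by measurable
      have c: "?g x * ennreal (exp (at_time L \<tau> x)) = indicator B x" for x
        by (auto simp: indicator_def ennreal_mult[symmetric] exp_add[symmetric])
      have "(\<integral>\<^sup>+x. ennreal (exp ((1 - q) * (L T x - at_time L \<tau> x))) * indicator B x \<partial>P)
         = (\<integral>\<^sup>+x. ?g x * ennreal (exp (q * (G.L T x - at_time G.L \<tau> x))) \<partial>Q)"
        unfolding int[OF \<tau> g] c by (simp add: mult.commute)
      also have "\<dots> \<le> ennreal D * (\<integral>\<^sup>+x. ?g x \<partial>Q)"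
        by (rule G.expo_weighted[OF E]) (use \<tau> g in simp_all)
      also have "(\<integral>\<^sup>+x. ?g x \<partial>Q) = (\<integral>\<^sup>+x. ?g x * ennreal (exp (L T x)) \<partial>P)"
        using measurable_pre_sigma_P[OF \<tau> g] by (subst nn_integral_Q) (simp_all add: mult.commute)
      also have "\<dots> = (\<integral>\<^sup>+x. ?g x * ennreal (exp (at_time L \<tau> x)) \<partial>P)" by (rule exp_L_weighted[OF \<tau> g])
      also have "\<dots> = ennreal (prob B)" unfolding c by (simp add: emeasure_eq_measure)
      finally show "(\<integral>\<^sup>+x. ennreal (exp ((1 - q) * (L T x - at_time L \<tau> x))) * indicator B x \<partial>P) \<le> ennreal (D * prob B)"
        using D by (simp add: ennreal_mult)
    qed
  qed
qed

lemma equivalences: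
  "((\<lambda>t x. A t x - M t x) \<in> BMO Q F T \<longleftrightarrow> (\<exists>p>1. reverse_Hoelder P F T M A p)) \<and>
   ((\<exists>p>1. reverse_Hoelder P F T M A p) \<longleftrightarrow> M \<in> BMO P F T) \<and>
   (M \<in> BMO P F T \<longleftrightarrow> (\<exists>p>1. Muckenhoupt P F T M A p))"
proof -
  interpret G: exp_pair Q F T "\<lambda>t x. A t x - M t x" A by (rule girsanov)
  let ?neg = "\<exists>q<0. \<exists>D. expo q D" and ?pos = "\<exists>q>1. \<exists>D. expo q D"
  have 1: "?neg \<longleftrightarrow> (\<exists>C. bmo C)"
    using bmo_imp_negative_moment negative_moment_imp_bmo by blast
  have 2: "(\<exists>C. bmo C) \<Longrightarrow> ?pos" using bmo_imp_reverse_moment by blast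
  have G1: "(\<exists>q<0. \<exists>D. G.expo q D) \<longleftrightarrow> (\<exists>C. G.bmo C)"
    using G.bmo_imp_negative_moment G.negative_moment_imp_bmo by blast
  have G2: "(\<exists>C. G.bmo C) \<Longrightarrow> \<exists>q>1. \<exists>D. G.expo q D" using G.bmo_imp_reverse_moment by blast
  have d1: "(\<exists>q<0. \<exists>D. G.expo q D) \<longleftrightarrow> ?pos"
  proof
    assume "\<exists>q<0. \<exists>D. G.expo q D"
    then obtain q D where "q < 0" "expo (1 - q) D" unfolding dual_expo by blast
    then show ?pos by (intro exI[of _ "1 - q"] conjI exI[of _ D]) auto
  next
    assume ?pos
    then obtain q D where "1 < q" "expo q D" by blast
    then show "\<exists>q<0. \<exists>D. G.expo q D" unfolding dual_expo by (intro exI[of _ "1 - q"] conjI exI[of _ D]) auto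
  qed
  have d2: "?neg" if h: "\<exists>q>1. \<exists>D. G.expo q D"
  proof -
    obtain q D where "1 < q" "expo (1 - q) D" using h unfolding dual_expo by blast
    then show ?neg by (intro exI[of _ "1 - q"] conjI exI[of _ D]) auto
  qed
  show ?thesis
    unfolding G.BMO_iff_bmo BMO_iff_bmo reverse_Hoelder_iff Muckenhoupt_iff
    using 1 2 G1 G2 d1 d2 by blast
qed

end

theorem theorem1:
  fixes P P' :: "'a measure" and F :: "real \<Rightarrow> 'a measure" and T :: real
    and M M' A :: "real \<Rightarrow> 'a \<Rightarrow> real"
  assumes "usual_conditions P F T"
    and "local_martingale P F T M" and "continuous_paths P T M" and "AE x in P. M 0 x = 0"
    and "square_char P F T M A"
    and "martingale P F T (stoch_exp M A)" and "uniformly_integrable P T (stoch_exp M A)"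
    and "P' = density P (\<lambda>x. ennreal (stoch_exp M A T x))"
    and "M' = (\<lambda>t x. A t x - M t x)"
  shows "(M' \<in> BMO P' F T \<longleftrightarrow> (\<exists>p>1. reverse_Hoelder P F T M A p)) \<and>
         ((\<exists>p>1. reverse_Hoelder P F T M A p) \<longleftrightarrow> M \<in> BMO P F T) \<and>
         (M \<in> BMO P F T \<longleftrightarrow> (\<exists>p>1. Muckenhoupt P F T M A p))"
proof -
  interpret U: usual_conditions P F T by (rule assms(1))
  have Mc: "U.cont_adapted M" using assms(2,3) by (simp add: U.cont_adapted_def local_martingale_def)
  have A: "U.cont_adapted A" "AE x in P. A 0 x = 0" "AE x in P. mono_on {0..T} (\<lambda>t. A t x)"
    using assms(5) by (simp_all add: square_char_def U.cont_adapted_def)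
  have "continuous_paths P T (stoch_exp M A)"
    unfolding continuous_paths_def using U.cont_adapted_cont[OF Mc] U.cont_adapted_cont[OF A(1)]
    by eventually_elim (auto simp: stoch_exp_def intro!: continuous_intros)
  then interpret E: exp_pair P F T M A
    by (intro exp_pair.intro exp_pair_axioms.intro localized_pair.intro localized_pair_axioms.intro
        increasing_pair.intro increasing_pair_axioms.intro assms(1) Mc A assms(4)
        U.localizedI[OF assms(2-5)] U.martingale_mart[OF assms(6)])
  show ?thesis using E.equivalences unfolding assms(8,9) E.Q_def .
qed

end
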